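(* Let $(X,\mu)$ be a probability space and $f:X\to X$ a measurable map such that $\mu$ is $f$-invariant. Let $(\mathcal{A},\|\cdot\|_{\mathcal{A}})$ be a normed space of real (test) functions on $X$. Assume that $f^*:\varphi\mapsto\varphi\circ f$ is bounded with respect to $\|\cdot\|_{\mathcal{A}}$. Assume moreover that: (i) (mixing) the measure $\mu$ is exponentially mixing of all orders for observables in $\mathcal{A}$; (ii) (controlled tail) there exists a set of functions $\mathcal{B}$ such that $(X,\mu,f,\mathcal{A},\mathcal{B})$ satisfies the controlled tail property. Then all observables in $\mathcal{A}$ satisfy the central limit theorem with respect to $\mu$: for every $\varphi\in\mathcal{A}$, with $S_n(\varphi):=\varphi+\varphi\circ f+\dots+\varphi\circ f^{n-1}$ and $\sigma\ge0$ defined by $\sigma^2:=\lim_{n\to\infty}\frac1n\int(S_n(\varphi)-n\int\varphi\,d\mu)^2\,d\mu$, we have $$\frac{S_n(\varphi)-n\int\varphi\,d\mu}{\sqrt n}\longrightarrow\mathcal{N}(0,\sigma^2)\quad\text{as } n\to\infty\text{ in law},$$ where $\mathcal{N}(0,\sigma^2)$ is the Gaussian distribution with mean $0$ and variance $\sigma^2$ (the point mass at $0$ if $\sigma=0$).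
   Context: **Exponential mixing of all orders** for observables in a normed space $(\mathcal{E},\|\cdot\|_{\mathcal{E}})$ of real functions on $X$ (with, for each $1\le q<\infty$, $\|\cdot\|_{L^q(\mu)}\le c'_q\|\cdot\|_{\mathcal{E}}$ for some constant $c'_q$): for every integer $\kappa\ge1$ there exist $C_\kappa>0$ and $0<\theta_\kappa<1$ such that, for all $\varphi_0,\dots,\varphi_\kappa\in\mathcal{E}$ and integers $0=n_0\le n_1\le\dots\le n_\kappa$, $$\Big| \int \varphi_0 (\varphi_1\circ f^{n_1})\cdots ( \varphi_\kappa \circ f^{n_\kappa}) \,d \mu -\prod_{j=0}^\kappa \int \varphi_j \,d \mu \Big| \leq C_\kappa \,\theta_\kappa^{ \min_{0\leq j\leq \kappa-1}(n_{j+1}-n_j) }\prod_{j=0}^\kappa \|\varphi_j\|_{\mathcal{E}}.$$ **Controlled tail property.** Let $\mathcal{B}$ be a cone inside a normed vector space of real functions on $X$ (norm denoted $\|\cdot\|_{\mathcal{B}}$) such that: (B1) for every $\varphi\in\mathcal{B}$, $\|\varphi\|_\infty\le\|\varphi\|_{\mathcal{B}}$; (B2) the exponential mixing of all orders (the inequality displayed above) holds for all observables in $\mathcal{B}$, with $\|\cdot\|_{\mathcal{B}}$ in place of $\|\cdot\|_{\mathcal{E}}$; (B3) for every integer $t\ge2$ there exist functions $P_{t,1},\dots,P_{t,m_t}:\mathbb{R}^t\to\mathbb{R}$ and a constant $\tilde c_t$ (with $m_t$, $\tilde c_t$ and the $P_{t,l}$ depending only on $t$) such that $\sum_{l=1}^{m_t}P_{t,l}(x_1,\dots,x_t)=x_1x_2\cdots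 x_t$ for all $x_1,\dots,x_t\in\mathbb{R}$, and such that for every $g_1,\dots,g_t\in\mathcal{B}$ with $\|g_j\|_{\mathcal{B}}\le1$, either $P_{t,l}(g_1,\dots,g_t)\in\mathcal{B}$ and $\|P_{t,l}(g_1,\dots,g_t)\|_{\mathcal{B}}\le\tilde c_t$, or $-P_{t,l}(g_1,\dots,g_t)\in\mathcal{B}$ and $\|-P_{t,l}(g_1,\dots,g_t)\|_{\mathcal{B}}\le\tilde c_t$. With such a $\mathcal{B}$, $(X,\mu,f,\mathcal{A},\mathcal{B})$ satisfies the controlled tail property if there are constants $c\ge1$ and, for each integer $q\ge1$, $\alpha_q>0$, $c_q>0$ (depending only on $q$) such that for every $\varphi\in\mathcal{A}$ and every $M\ge0$ one can write $\varphi=\varphi_1^+-\varphi_1^-+\varphi_2$ with: (1) $\varphi_1^\pm\in\mathcal{B}$ and $\|\varphi_1^\pm\|_{\mathcal{B}}\le cM\|\varphi\|_{\mathcal{A}}$; (2) $\|\varphi_2\|_{L^q(\mu)}\le c_qe^{-\alpha_qM}\|\varphi\|_{\mathcal{A}}$ for every integer $q\ge1$. *)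

theory Defs
  imports "HOL-Probability.Probability"
begin

text \<open>
  A set of real functions on \<open>X\<close> is represented by a set \<open>F\<close> of total functions \<open>'a \<Rightarrow> real\<close> that
  only depends on values on \<open>X\<close>: two functions that agree on \<open>X\<close> represent the same function on
  \<open>X\<close>, so both or neither of them belong to \<open>F\<close>.
\<close>

definition functions_on :: "'a set \<Rightarrow> ('a \<Rightarrow> real) set \<Rightarrow> bool" where
  "functions_on X F \<longleftrightarrow> (\<forall>\<phi>\<in>F. \<forall>\<psi>. (\<forall>x\<in>X. \<psi> x = \<phi> x) \<longrightarrow> \<psi> \<in> F)"

text \<open>
  Invariance of \<open>N\<close> under changes of a function off \<open>X\<close> need not be required: it follows from the
  triangle inequality, since \<open>N\<close> vanishes on functions that are zero on \<open>X\<close>.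
\<close>

definition normed_function_space ::
    "'a set \<Rightarrow> ('a \<Rightarrow> real) set \<Rightarrow> (('a \<Rightarrow> real) \<Rightarrow> real) \<Rightarrow> bool" where
  "normed_function_space X V N \<longleftrightarrow>
     functions_on X V \<and>
     (\<lambda>x. 0) \<in> V \<and>
     (\<forall>\<phi>\<in>V. \<forall>\<psi>\<in>V. (\<lambda>x. \<phi> x + \<psi> x) \<in> V) \<and>
     (\<forall>c. \<forall>\<phi>\<in>V. (\<lambda>x. c * \<phi> x) \<in> V) \<and>
     (\<forall>\<phi>\<in>V. 0 \<le> N \<phi>) \<and>
     (\<forall>\<phi>\<in>V. N \<phi> = 0 \<longleftrightarrow> (\<forall>x\<in>X. \<phi> x = 0)) \<and>
     (\<forall>c. \<forall>\<phi>\<in>V. N (\<lambda>x. c * \<phi> x) = \<bar>c\<bar> * N \<phi>) \<and>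
     (\<forall>\<phi>\<in>V. \<forall>\<psi>\<in>V. N (\<lambda>x. \<phi> x + \<psi> x) \<le> N \<phi> + N \<psi>)"

text \<open>
  As in the library's \<^const>\<open>cone\<close> (which needs a type of class \<^class>\<open>real_vector\<close>), a cone is
  closed under scalars \<open>c \<ge> 0\<close>; it need not be convex.
\<close>

definition function_cone :: "('a \<Rightarrow> real) set \<Rightarrow> bool" where
  "function_cone B \<longleftrightarrow> (\<forall>\<phi>\<in>B. \<forall>c\<ge>0. (\<lambda>x. c * \<phi> x) \<in> B)"

definition Lq_norm :: "'a measure \<Rightarrow> real \<Rightarrow> ('a \<Rightarrow> real) \<Rightarrow> real" where
  "Lq_norm M q \<phi> = (LINT x|M. \<bar>\<phi> x\<bar> powr q) powr (1 / q)"

text \<open>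
  \<open>\<parallel>\<phi>\<parallel>\<^bsub>L^q(M)\<^esub> \<le> b\<close> with a finite bound includes membership in \<open>L^q(M)\<close>; it has to be
  spelled out because the Bochner integral of a non-integrable function is \<open>0\<close>.
\<close>

definition Lq_norm_le :: "'a measure \<Rightarrow> real \<Rightarrow> ('a \<Rightarrow> real) \<Rightarrow> real \<Rightarrow> bool" where
  "Lq_norm_le M q \<phi> b \<longleftrightarrow>
     \<phi> \<in> borel_measurable M \<and> integrable M (\<lambda>x. \<bar>\<phi> x\<bar> powr q) \<and> Lq_norm M q \<phi> \<le> b"

definition exp_mixing_inequalities ::
    "'a measure \<Rightarrow> ('a \<Rightarrow> 'a) \<Rightarrow> ('a \<Rightarrow> real) set \<Rightarrow> (('a \<Rightarrow> real) \<Rightarrow> real) \<Rightarrow> bool" where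
  "exp_mixing_inequalities M f E N \<longleftrightarrow>
     (\<forall>\<kappa>::nat. \<kappa> \<ge> 1 \<longrightarrow> (\<exists>C \<theta> :: real. C > 0 \<and> 0 < \<theta> \<and> \<theta> < 1 \<and>
       (\<forall>(\<phi> :: nat \<Rightarrow> 'a \<Rightarrow> real) (n :: nat \<Rightarrow> nat).
          (\<forall>j\<le>\<kappa>. \<phi> j \<in> E) \<longrightarrow> n 0 = 0 \<longrightarrow> (\<forall>j<\<kappa>. n j \<le> n (Suc j)) \<longrightarrow>
          \<bar>(LINT x|M. (\<Prod>j\<le>\<kappa>. \<phi> j ((f ^^ n j) x))) - (\<Prod>j\<le>\<kappa>. LINT x|M. \<phi> j x)\<bar>
            \<le> C * \<theta> ^ (Min ((\<lambda>j. n (Suc j) - n j) ` {..<\<kappa>})) * (\<Prod>j\<le>\<kappa>. N (\<phi> j)))))"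

definition exp_mixing_all_orders ::
    "'a measure \<Rightarrow> ('a \<Rightarrow> 'a) \<Rightarrow> ('a \<Rightarrow> real) set \<Rightarrow> (('a \<Rightarrow> real) \<Rightarrow> real) \<Rightarrow> bool" where
  "exp_mixing_all_orders M f E N \<longleftrightarrow>
     (\<forall>q::real. q \<ge> 1 \<longrightarrow> (\<exists>c'. \<forall>\<phi>\<in>E. Lq_norm_le M q \<phi> (c' * N \<phi>))) \<and>
     exp_mixing_inequalities M f E N"

text \<open>
  The ambient normed space is \<open>(V, N)\<close>. Measurability of the elements of \<open>B\<close> is implicit in the
  mixing inequalities, where they are integrated. In the last condition, points of \<open>\<real>\<^sup>t\<close> and tuples of functions are lists of length
  \<open>t\<close>; the sign may depend on \<open>l\<close> and on the tuple.
\<close>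

definition tail_cone ::
    "'a measure \<Rightarrow> ('a \<Rightarrow> 'a) \<Rightarrow> ('a \<Rightarrow> real) set \<Rightarrow> (('a \<Rightarrow> real) \<Rightarrow> real) \<Rightarrow> ('a \<Rightarrow> real) set \<Rightarrow> bool"
  where
  "tail_cone M f V N B \<longleftrightarrow>
     normed_function_space (space M) V N \<and>
     B \<subseteq> V \<and> functions_on (space M) B \<and> function_cone B \<and>
     (\<forall>\<phi>\<in>B. \<forall>x\<in>space M. \<bar>\<phi> x\<bar> \<le> N \<phi>) \<and>
     B \<subseteq> borel_measurable M \<and> exp_mixing_inequalities M f B N \<and>
     (\<forall>t::nat. t \<ge> 2 \<longrightarrow> (\<exists>(m :: nat) (P :: nat \<Rightarrow> real list \<Rightarrow> real) (c :: real).
        (\<forall>xs. length xs = t \<longrightarrow> (\<Sum>l<m. P l xs) = prod_list xs) \<and>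
        (\<forall>gs. length gs = t \<longrightarrow> set gs \<subseteq> B \<longrightarrow> (\<forall>g\<in>set gs. N g \<le> 1) \<longrightarrow>
          (\<forall>l<m. let h = (\<lambda>x. P l (map (\<lambda>g. g x) gs)) in
             h \<in> B \<and> N h \<le> c \<or> (\<lambda>x. - h x) \<in> B \<and> N (\<lambda>x. - h x) \<le> c))))"

definition controlled_tail ::
    "'a measure \<Rightarrow> ('a \<Rightarrow> 'a) \<Rightarrow> ('a \<Rightarrow> real) set \<Rightarrow> (('a \<Rightarrow> real) \<Rightarrow> real) \<Rightarrow>
      ('a \<Rightarrow> real) set \<Rightarrow> (('a \<Rightarrow> real) \<Rightarrow> real) \<Rightarrow> ('a \<Rightarrow> real) set \<Rightarrow> bool" where
  "controlled_tail M f A NA V NB B \<longleftrightarrow>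
     tail_cone M f V NB B \<and>
     (\<exists>(c :: real) (\<alpha> :: nat \<Rightarrow> real) (d :: nat \<Rightarrow> real).
        c \<ge> 1 \<and> (\<forall>q\<ge>1. \<alpha> q > 0 \<and> d q > 0) \<and>
        (\<forall>\<phi>\<in>A. \<forall>T::real. T \<ge> 0 \<longrightarrow>
          (\<exists>\<phi>p\<in>B. \<exists>\<phi>m\<in>B. \<exists>\<phi>2.
             (\<forall>x\<in>space M. \<phi> x = \<phi>p x - \<phi>m x + \<phi>2 x) \<and>
             NB \<phi>p \<le> c * T * NA \<phi> \<and> NB \<phi>m \<le> c * T * NA \<phi> \<and>
             (\<forall>q\<ge>1. Lq_norm_le M (real q) \<phi>2 (d q * exp (- \<alpha> q * T) * NA \<phi>)))))"

definition birkhoff_sum :: "('a \<Rightarrow> 'a) \<Rightarrow> ('a \<Rightarrow> real) \<Rightarrow> nat \<Rightarrow> 'a \<Rightarrow> real" where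
  "birkhoff_sum f \<phi> n x = (\<Sum>k<n. \<phi> ((f ^^ k) x))"

text \<open>For \<open>\<sigma> = 0\<close>, \<^const>\<open>normal_density\<close> is zero, so the degenerate case is separate.\<close>

definition centered_gaussian :: "real \<Rightarrow> real measure" where
  "centered_gaussian \<sigma> =
     (if \<sigma> = 0 then return borel 0 else density lborel (normal_density 0 \<sigma>))"

definition satisfies_CLT :: "'a measure \<Rightarrow> ('a \<Rightarrow> 'a) \<Rightarrow> ('a \<Rightarrow> real) \<Rightarrow> bool" where
  "satisfies_CLT M f \<phi> \<longleftrightarrow>
     (\<exists>\<sigma>\<ge>0.
        (\<lambda>n. (1 / real n) * (LINT x|M. (birkhoff_sum f \<phi> n x - real n * (LINT y|M. \<phi> y))\<^sup>2))
          \<longlonglongrightarrow> \<sigma>\<^sup>2 \<and>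
        weak_conv_m
          (\<lambda>n. distr M borel
             (\<lambda>x. (birkhoff_sum f \<phi> n x - real n * (LINT y|M. \<phi> y)) / sqrt (real n)))
          (centered_gaussian \<sigma>))"

end

theory Submission
  imports Defs "HOL-Real_Asymp.Real_Asymp"
begin

text \<open>
  Fix \<open>\<phi>\<close> in \<open>A\<close>, put \<open>X = \<phi> - \<integral>\<phi>\<close>, and let \<open>S\<^sub>n\<close> be the Birkhoff sums of \<open>X\<close>. The theorem is proved by the
  method of moments: every moment of \<open>S\<^sub>n / \<surd>n\<close> converges to the corresponding moment of the normal law
  with variance \<open>\<sigma>\<^sup>2\<close>, and normal laws are determined by their moments.

  The engine is a decorrelation estimate, \<open>cov_orbit_decay\<close>: if all times in \<open>I\<close> precede all times in
  \<open>J\<close> by at least \<open>\<Lambda> l\<close>, then the products of \<open>\<phi>\<close> along \<open>I\<close> and along \<open>J\<close>, with at most \<open>r\<close> factors in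
  all, have covariance \<open>O(\<rho>\<^sup>l)\<close>, however the times are arranged inside \<open>I\<close> and inside \<open>J\<close>. Exponential
  mixing does not give this directly, because its rate sees only the smallest of the gaps between the
  times. Instead the times are grouped into clusters whose mutual distances exceed \<open>H D\<close>, where \<open>D\<close>
  bounds their diameters and \<open>H\<close> is as large as needed (\<open>orbit_clustering\<close>), and the product over a
  cluster is treated as one observable. This observable need not belong to \<open>A\<close>, whose norm does not
  control products. So each factor \<open>\<phi> \<circ> f\<^sup>s\<close> with \<open>s \<le> D\<close>, whose norm is at most \<open>K\<^sup>D \<parallel>\<phi>\<parallel>\<close>, is truncated by
  the controlled tail property at a level \<open>T\<close> equal to the separation of the clusters. The truncated
  factors are differences of elements of the cone, and by (B3) the linear combinations of elements of
  the cone form an algebra with a submultiplicative size (\<open>span_mult\<close>), to which mixing extends by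
  multilinearity (\<open>cov_orbit_prod_span\<close>). All sizes are polynomial in \<open>T K\<^sup>D\<close>, whereas the mixing error
  and the truncation error are exponentially small in \<open>T \<ge> H D\<close>; for large \<open>H\<close> the exponential wins
  (\<open>geometric_gain\<close>).

  Consequently \<open>S\<^bsub>2n+g\<^esub>\<close> is, up to a block of negligible length \<open>g\<close>, the sum of two almost independent
  copies of \<open>S\<^sub>n\<close>, and its moments \<open>m\<^sub>r\<close> satisfy the binomial recursion
  \<open>m\<^sub>r(2n+g) \<approx> \<Sum>\<^sub>a (r choose a) m\<^sub>a(n) m\<^bsub>r-a\<^esub>(n)\<close> (\<open>moment_recursion\<close>). Gaussian moments solve this recursion
  exactly (\<open>gaussian_moment_convolution\<close>). After division by \<open>n\<^bsup>r/2\<^esup>\<close> the two terms that contain \<open>m\<^sub>r(n)\<close>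
  carry the weight \<open>2 \<cdot> 2\<^bsup>-r/2\<^esup>\<close>, which is less than \<open>1\<close> for \<open>r \<ge> 3\<close>; all other terms involve lower
  moments, and \<open>m\<^sub>1 = 0\<close>. Hence the recursion is a contraction: by induction it first bounds the even
  moments (\<open>even_moment_bounded\<close>) and then makes all moments converge (\<open>moment_tendsto\<close>). Only \<open>r = 2\<close>
  escapes this argument, and there the limit exists because the autocorrelations of \<open>X\<close> decay
  exponentially (\<open>variance_limit_exists\<close>).
\<close>

section \<open>Functions with finite moments, and covariances\<close>

text \<open>
  Functions of this kind are closed under sums, products and composition with the dynamics, so that
  the integrability of every expression below can be read off from its structure.
\<close>

definition has_moments :: "'a measure \<Rightarrow> ('a \<Rightarrow> real) \<Rightarrow> bool" where
  "has_moments M X \<longleftrightarrow> X \<in> borel_measurable M \<and> (\<forall>q::nat. integrable M (\<lambda>x. \<bar>X x\<bar> ^ q))"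

definition cov :: "'a measure \<Rightarrow> ('a \<Rightarrow> real) \<Rightarrow> ('a \<Rightarrow> real) \<Rightarrow> real" where
  "cov M X Y = (LINT x|M. X x * Y x) - (LINT x|M. X x) * (LINT x|M. Y x)"

lemma has_moments_measurable: "has_moments M X \<Longrightarrow> X \<in> borel_measurable M"
  by (simp add: has_moments_def)

lemma has_moments_integrable_abs: "has_moments M X \<Longrightarrow> integrable M (\<lambda>x. \<bar>X x\<bar> ^ q)"
  by (simp add: has_moments_def)

lemma has_moments_integrable: "has_moments M X \<Longrightarrow> integrable M X"
  using has_moments_integrable_abs[of M X 1] has_moments_measurable[of M X]
  by (simp add: integrable_abs_iff)

lemma abs_add_power_le: "\<bar>x + y\<bar> ^ q \<le> 2 ^ q * (\<bar>x\<bar> ^ q + \<bar>y\<bar> ^ q)" for x y :: real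
proof -
  have "\<bar>x + y\<bar> ^ q \<le> (2 * max \<bar>x\<bar> \<bar>y\<bar>) ^ q"
    by (intro power_mono) auto
  also have "\<dots> = 2 ^ q * (max \<bar>x\<bar> \<bar>y\<bar>) ^ q"
    by (simp add: power_mult_distrib)
  also have "\<dots> \<le> 2 ^ q * (\<bar>x\<bar> ^ q + \<bar>y\<bar> ^ q)"
    by (intro mult_left_mono) (auto simp: max_def)
  finally show ?thesis .
qed

lemma has_moments_add:
  assumes "has_moments M X" "has_moments M Y"
  shows "has_moments M (\<lambda>x. X x + Y x)"
proof -
  note [measurable] = assms[THEN has_moments_measurable]
  have "integrable M (\<lambda>x. \<bar>X x + Y x\<bar> ^ q)" for q
  proof (rule Bochner_Integration.integrable_bound)
    show "integrable M (\<lambda>x. 2 ^ q * (\<bar>X x\<bar> ^ q + \<bar>Y x\<bar> ^ q))"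
      using assms by (auto intro!: has_moments_integrable_abs)
  qed (auto intro!: AE_I2 order_trans[OF abs_add_power_le])
  then show ?thesis by (simp add: has_moments_def)
qed

lemma has_moments_mult:
  assumes "has_moments M X" "has_moments M Y"
  shows "has_moments M (\<lambda>x. X x * Y x)"
proof -
  note [measurable] = assms[THEN has_moments_measurable]
  have *: "a * b \<le> a ^ 2 + b ^ 2" for a b :: real
    using sum_squares_bound[of a b] sum_power2_ge_zero[of a b] by linarith
  have "integrable M (\<lambda>x. \<bar>X x * Y x\<bar> ^ q)" for q
  proof (rule Bochner_Integration.integrable_bound)
    show "integrable M (\<lambda>x. \<bar>X x\<bar> ^ (q * 2) + \<bar>Y x\<bar> ^ (q * 2))"
      using assms by (auto intro!: has_moments_integrable_abs)
  qed (auto intro!: AE_I2 order_trans[OF *] simp: abs_mult power_mult_distrib power_mult)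
  then show ?thesis by (simp add: has_moments_def)
qed

lemma has_moments_abs: "has_moments M X \<Longrightarrow> has_moments M (\<lambda>x. \<bar>X x\<bar>)"
  by (auto simp: has_moments_def)

lemma cov_cong:
  assumes "\<And>x. x \<in> space M \<Longrightarrow> X x = X' x" "\<And>x. x \<in> space M \<Longrightarrow> Y x = Y' x"
  shows "cov M X Y = cov M X' Y'"
  unfolding cov_def using assms
  by (intro arg_cong2[where f="(-)"] arg_cong2[where f="(*)"] Bochner_Integration.integral_cong) auto

lemma cov_scale_left: "cov M (\<lambda>x. c * X x) Y = c * cov M X Y"
  by (simp add: cov_def algebra_simps)

lemma cov_add_left:
  assumes "has_moments M X" "has_moments M X'" "has_moments M Y"
  shows "cov M (\<lambda>x. X x + X' x) Y = cov M X Y + cov M X' Y"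
  using assms has_moments_integrable[OF has_moments_mult[OF assms(1,3)]]
    has_moments_integrable[OF has_moments_mult[OF assms(2,3)]]
  by (simp add: cov_def algebra_simps has_moments_integrable)

text \<open>
  Replace the factors one at a time; in the step that replaces factor \<open>i\<close>, each other factor is one of
  the two candidates.
\<close>

lemma abs_prod_diff_le:
  fixes a b :: "'i \<Rightarrow> real"
  assumes "finite I"
  shows "\<bar>(\<Prod>i\<in>I. a i) - (\<Prod>i\<in>I. b i)\<bar>
    \<le> (\<Sum>i\<in>I. \<bar>a i - b i\<bar> * (\<Prod>j\<in>I - {i}. max \<bar>a j\<bar> \<bar>b j\<bar>))"
  using assms
proof (induction I)
  case empty
  then show ?case by simp
next
  case (insert k I)
  let ?m = "\<lambda>j. max \<bar>a j\<bar> \<bar>b j\<bar>"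
  have "\<bar>prod a (insert k I) - prod b (insert k I)\<bar>
      = \<bar>(a k - b k) * prod a I + b k * (prod a I - prod b I)\<bar>"
    using insert by (simp add: algebra_simps)
  also have "\<dots> \<le> \<bar>a k - b k\<bar> * \<bar>prod a I\<bar> + \<bar>b k\<bar> * \<bar>prod a I - prod b I\<bar>"
    by (metis abs_mult abs_triangle_ineq)
  also have "\<dots> \<le> \<bar>a k - b k\<bar> * prod ?m I
      + ?m k * (\<Sum>i\<in>I. \<bar>a i - b i\<bar> * (\<Prod>j\<in>I - {i}. ?m j))"
    using insert.IH
    by (intro add_mono mult_mono) (auto simp: abs_prod intro!: prod_mono prod_nonneg)
  also have "?m k * (\<Sum>i\<in>I. \<bar>a i - b i\<bar> * (\<Prod>j\<in>I - {i}. ?m j))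
      = (\<Sum>i\<in>I. \<bar>a i - b i\<bar> * (\<Prod>j\<in>insert k I - {i}. ?m j))"
    unfolding sum_distrib_left
  proof (rule sum.cong)
    fix i assume i: "i \<in> I"
    then have "insert k I - {i} = insert k (I - {i})"
      using insert by auto
    then show "?m k * (\<bar>a i - b i\<bar> * (\<Prod>j\<in>I - {i}. ?m j))
        = \<bar>a i - b i\<bar> * (\<Prod>j\<in>insert k I - {i}. ?m j)"
      using insert by (simp add: prod.insert)
  qed simp
  finally show ?case
    using insert by simp
qed

text \<open>
  A crude substitute for Hoelder's inequality: it bounds products of up to \<open>q\<close> factors by \<open>q\<close>-th powers,
  with one exponent for all numbers of factors.
\<close>

lemma prod_le_one_plus_sum_powers:
  fixes x :: "'i \<Rightarrow> real"
  assumes "finite J" "card J \<le> q" "\<And>j. j \<in> J \<Longrightarrow> 0 \<le> x j"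
  shows "(\<Prod>j\<in>J. x j) \<le> 1 + (\<Sum>j\<in>J. x j ^ q)"
proof (cases "\<forall>j\<in>J. x j \<le> 1")
  case True
  then have "(\<Prod>j\<in>J. x j) \<le> 1"
    using assms by (intro prod_le_1) auto
  moreover have "0 \<le> (\<Sum>j\<in>J. x j ^ q)"
    using assms by (intro sum_nonneg) auto
  ultimately show ?thesis by simp
next
  case False
  define y where "y = Max (x ` J)"
  have ne: "J \<noteq> {}" using False by auto
  have y: "x j \<le> y" if "j \<in> J" for j
    using that assms by (auto simp: y_def)
  then have "1 \<le> y" using False by force
  obtain j0 where j0: "j0 \<in> J" "y = x j0"
    using Max_in[of "x ` J"] ne assms(1) unfolding y_def by blast
  have "(\<Prod>j\<in>J. x j) \<le> (\<Prod>j\<in>J. y)"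
    using y assms by (intro prod_mono) auto
  also have "\<dots> \<le> y ^ q"
    using \<open>1 \<le> y\<close> assms by (simp add: power_increasing)
  also have "\<dots> \<le> (\<Sum>j\<in>J. x j ^ q)"
    unfolding j0 using assms j0 by (intro member_le_sum) auto
  finally show ?thesis by simp
qed

context prob_space
begin

lemma has_moments_const: "has_moments M (\<lambda>x. c)"
  by (auto simp: has_moments_def)

lemma has_moments_bounded:
  assumes "X \<in> borel_measurable M" "\<And>x. x \<in> space M \<Longrightarrow> \<bar>X x\<bar> \<le> c"
  shows "has_moments M X"
proof -
  note [measurable] = assms(1)
  have "integrable M (\<lambda>x. \<bar>X x\<bar> ^ q)" for q
    using assms(2) by (intro integrable_const_bound[where B="c ^ q"])
      (auto intro!: AE_I2 power_mono)
  then show ?thesis by (simp add: has_moments_def)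
qed

lemma has_moments_sum:
  "(\<And>i. i \<in> I \<Longrightarrow> has_moments M (X i)) \<Longrightarrow> has_moments M (\<lambda>x. \<Sum>i\<in>I. X i x)"
  by (induction I rule: infinite_finite_induct) (auto intro!: has_moments_add has_moments_const)

lemma has_moments_prod:
  "(\<And>i. i \<in> I \<Longrightarrow> has_moments M (X i)) \<Longrightarrow> has_moments M (\<lambda>x. \<Prod>i\<in>I. X i x)"
  by (induction I rule: infinite_finite_induct) (auto intro!: has_moments_mult has_moments_const)

lemma has_moments_power: "has_moments M X \<Longrightarrow> has_moments M (\<lambda>x. X x ^ n)"
  by (induction n) (auto intro!: has_moments_mult has_moments_const)

lemma has_moments_diff:
  assumes "has_moments M X" "has_moments M Y"
  shows "has_moments M (\<lambda>x. X x - Y x)"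
  using has_moments_add[OF assms(1) has_moments_mult[OF has_moments_const[of "-1"] assms(2)]]
  by simp

lemmas has_moments_intros =
  has_moments_const has_moments_add has_moments_diff has_moments_mult has_moments_sum
  has_moments_prod has_moments_power has_moments_abs

lemma abs_expectation_prod_le:
  assumes "finite I" "card I \<le> q"
    and "\<And>i. i \<in> I \<Longrightarrow> has_moments M (a i)"
    and "\<And>i. i \<in> I \<Longrightarrow> (LINT x|M. \<bar>a i x\<bar> ^ q) \<le> A"
  shows "\<bar>LINT x|M. (\<Prod>i\<in>I. a i x)\<bar> \<le> 1 + real (card I) * A"
proof -
  have "\<bar>LINT x|M. (\<Prod>i\<in>I. a i x)\<bar> \<le> (LINT x|M. \<bar>\<Prod>i\<in>I. a i x\<bar>)"
    by (rule integral_abs_bound)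
  also have "\<dots> \<le> (LINT x|M. 1 + (\<Sum>i\<in>I. \<bar>a i x\<bar> ^ q))"
    unfolding abs_prod using assms
    by (intro integral_mono prod_le_one_plus_sum_powers has_moments_integrable)
      (auto intro!: has_moments_intros)
  also have "\<dots> = 1 + (\<Sum>i\<in>I. LINT x|M. \<bar>a i x\<bar> ^ q)"
    using assms(3)
    by (simp add: Bochner_Integration.integral_sum has_moments_integrable_abs prob_space)
  also have "(\<Sum>i\<in>I. LINT x|M. \<bar>a i x\<bar> ^ q) \<le> real (card I) * A"
    using assms(4) by (intro sum_bounded_above) auto
  finally show ?thesis by simp
qed

text \<open>
  If the factors of a product change by at most \<open>\<eta>\<close> in \<open>L\<^sup>q\<close>, its expectation changes by \<open>O(\<eta>)\<close>. The
  small factor is first divided by \<open>\<eta>\<close>, because \<open>prod_le_one_plus_sum_powers\<close> is not homogeneous.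
\<close>

lemma expectation_prod_diff_le:
  assumes I: "finite I" "card I \<le> q"
    and mom: "\<And>i. i \<in> I \<Longrightarrow> has_moments M (a i)" "\<And>i. i \<in> I \<Longrightarrow> has_moments M (b i)"
    and A: "\<And>i. i \<in> I \<Longrightarrow> (LINT x|M. \<bar>a i x\<bar> ^ q) \<le> A"
    and B: "\<And>i. i \<in> I \<Longrightarrow> (LINT x|M. \<bar>b i x\<bar> ^ q) \<le> B"
    and \<eta>: "\<eta> > 0" "\<And>i. i \<in> I \<Longrightarrow> (LINT x|M. \<bar>a i x - b i x\<bar> ^ q) \<le> \<eta> ^ q"
  shows "\<bar>(LINT x|M. (\<Prod>i\<in>I. a i x)) - (LINT x|M. (\<Prod>i\<in>I. b i x))\<bar>
    \<le> real (card I) * (\<eta> * (2 + real (card I) * (A + B)))"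
proof -
  define h where "h i x = \<eta> * (1 + \<bar>a i x - b i x\<bar> ^ q / \<eta> ^ q
    + (\<Sum>j\<in>I. \<bar>a j x\<bar> ^ q + \<bar>b j x\<bar> ^ q))" for i x
  have point: "\<bar>a i x - b i x\<bar> * (\<Prod>j\<in>I - {i}. max \<bar>a j x\<bar> \<bar>b j x\<bar>) \<le> h i x"
    if i: "i \<in> I" for i x
  proof -
    define c where "c j = (if j = i then \<bar>a i x - b i x\<bar> / \<eta> else max \<bar>a j x\<bar> \<bar>b j x\<bar>)" for j
    have "\<bar>a i x - b i x\<bar> * (\<Prod>j\<in>I - {i}. max \<bar>a j x\<bar> \<bar>b j x\<bar>) = \<eta> * (\<Prod>j\<in>I. c j)"
      using i I \<eta>(1) by (subst prod.remove[of I i]) (auto simp: c_def intro!: prod.cong)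
    also have "\<dots> \<le> \<eta> * (1 + (\<Sum>j\<in>I. c j ^ q))"
      using I \<eta>(1) by (intro mult_left_mono prod_le_one_plus_sum_powers) (auto simp: c_def)
    also have "(\<Sum>j\<in>I. c j ^ q) = \<bar>a i x - b i x\<bar> ^ q / \<eta> ^ q
        + (\<Sum>j\<in>I - {i}. (max \<bar>a j x\<bar> \<bar>b j x\<bar>) ^ q)"
      using i I by (subst sum.remove[of I i]) (auto simp: c_def power_divide intro!: sum.cong)
    also have "(\<Sum>j\<in>I - {i}. (max \<bar>a j x\<bar> \<bar>b j x\<bar>) ^ q) \<le> (\<Sum>j\<in>I - {i}. \<bar>a j x\<bar> ^ q + \<bar>b j x\<bar> ^ q)"
      by (intro sum_mono) (auto simp: max_def)
    also have "\<dots> \<le> (\<Sum>j\<in>I. \<bar>a j x\<bar> ^ q + \<bar>b j x\<bar> ^ q)"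
      using I by (intro sum_mono2) auto
    finally show ?thesis
      using \<eta>(1) by (simp add: h_def add.assoc)
  qed
  have mom_h: "has_moments M (h i)" if "i \<in> I" for i
  proof -
    have "has_moments M (\<lambda>x. \<eta> * (1 + (1 / \<eta> ^ q) * \<bar>a i x - b i x\<bar> ^ q
      + (\<Sum>j\<in>I. \<bar>a j x\<bar> ^ q + \<bar>b j x\<bar> ^ q)))"
      using mom that by (intro has_moments_intros) auto
    then show ?thesis by (simp add: h_def[abs_def])
  qed
  have int_h: "(LINT x|M. h i x) \<le> \<eta> * (2 + real (card I) * (A + B))" if i: "i \<in> I" for i
  proof -
    have ia: "integrable M (\<lambda>x. \<bar>a i x - b i x\<bar> ^ q / \<eta> ^ q)"
      using i mom by (intro integrable_divide has_moments_integrable has_moments_intros) auto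
    have ib: "integrable M (\<lambda>x. \<Sum>j\<in>I. \<bar>a j x\<bar> ^ q + \<bar>b j x\<bar> ^ q)"
      using mom by (intro has_moments_integrable has_moments_intros) auto
    have "(LINT x|M. h i x) = \<eta> * (1 + (LINT x|M. \<bar>a i x - b i x\<bar> ^ q) / \<eta> ^ q
        + (LINT x|M. (\<Sum>j\<in>I. \<bar>a j x\<bar> ^ q + \<bar>b j x\<bar> ^ q)))"
      unfolding h_def using ia ib by (simp add: prob_space)
    also have "(LINT x|M. (\<Sum>j\<in>I. \<bar>a j x\<bar> ^ q + \<bar>b j x\<bar> ^ q))
        = (\<Sum>j\<in>I. (LINT x|M. \<bar>a j x\<bar> ^ q) + (LINT x|M. \<bar>b j x\<bar> ^ q))"
      using mom
      by (simp add: Bochner_Integration.integral_sum Bochner_Integration.integral_add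
          has_moments_integrable_abs)
    also have "\<dots> \<le> real (card I) * (A + B)"
      using A B by (intro sum_bounded_above add_mono) auto
    also have "(LINT x|M. \<bar>a i x - b i x\<bar> ^ q) / \<eta> ^ q \<le> 1"
      using \<eta>(1) \<eta>(2)[OF i] by simp
    finally show ?thesis
      using \<eta>(1) by simp
  qed
  have int: "integrable M (\<lambda>x. \<Prod>i\<in>I. a i x)" "integrable M (\<lambda>x. \<Prod>i\<in>I. b i x)"
    using mom by (auto intro!: has_moments_integrable has_moments_intros)
  have "\<bar>(LINT x|M. (\<Prod>i\<in>I. a i x)) - (LINT x|M. (\<Prod>i\<in>I. b i x))\<bar>
      = \<bar>LINT x|M. (\<Prod>i\<in>I. a i x) - (\<Prod>i\<in>I. b i x)\<bar>"
    using int by simp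
  also have "\<dots> \<le> (LINT x|M. \<bar>(\<Prod>i\<in>I. a i x) - (\<Prod>i\<in>I. b i x)\<bar>)"
    by (rule integral_abs_bound)
  also have "\<dots> \<le> (LINT x|M. (\<Sum>i\<in>I. h i x))"
  proof (rule integral_mono)
    show "integrable M (\<lambda>x. \<bar>(\<Prod>i\<in>I. a i x) - (\<Prod>i\<in>I. b i x)\<bar>)"
      using int by simp
    show "integrable M (\<lambda>x. \<Sum>i\<in>I. h i x)"
      using mom_h by (auto intro: has_moments_integrable)
    fix x
    show "\<bar>(\<Prod>i\<in>I. a i x) - (\<Prod>i\<in>I. b i x)\<bar> \<le> (\<Sum>i\<in>I. h i x)"
      using abs_prod_diff_le[OF I(1), of "\<lambda>i. a i x" "\<lambda>i. b i x"] sum_mono[of I _ "\<lambda>i. h i x", OF point]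
      by (meson order_trans)
  qed
  also have "\<dots> = (\<Sum>i\<in>I. LINT x|M. h i x)"
    using mom_h by (simp add: Bochner_Integration.integral_sum has_moments_integrable)
  also have "\<dots> \<le> real (card I) * (\<eta> * (2 + real (card I) * (A + B)))"
    using int_h by (intro sum_bounded_above) auto
  finally show ?thesis .
qed

lemma cov_sum_mult:
  assumes "\<And>i. i \<in> P \<Longrightarrow> has_moments M (X i)" "\<And>j. j \<in> Q \<Longrightarrow> has_moments M (Y j)"
  shows "cov M (\<lambda>x. \<Sum>i\<in>P. c i * X i x) (\<lambda>x. \<Sum>j\<in>Q. d j * Y j x)
    = (\<Sum>i\<in>P. \<Sum>j\<in>Q. c i * d j * cov M (X i) (Y j))"
proof -
  have 1: "(LINT x|M. (\<Sum>i\<in>P. c i * X i x) * (\<Sum>j\<in>Q. d j * Y j x))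
      = (\<Sum>i\<in>P. \<Sum>j\<in>Q. c i * d j * (LINT x|M. X i x * Y j x))"
  proof -
    have "(LINT x|M. (\<Sum>i\<in>P. c i * X i x) * (\<Sum>j\<in>Q. d j * Y j x))
        = (LINT x|M. (\<Sum>i\<in>P. \<Sum>j\<in>Q. (c i * d j) * (X i x * Y j x)))"
      by (intro arg_cong[where f="integral\<^sup>L M"] ext) (simp add: sum_product algebra_simps)
    also have "\<dots> = (\<Sum>i\<in>P. LINT x|M. (\<Sum>j\<in>Q. (c i * d j) * (X i x * Y j x)))"
      using assms by (intro Bochner_Integration.integral_sum has_moments_integrable has_moments_intros) auto
    also have "\<dots> = (\<Sum>i\<in>P. \<Sum>j\<in>Q. (LINT x|M. (c i * d j) * (X i x * Y j x)))"
      using assms by (intro sum.cong refl Bochner_Integration.integral_sum has_moments_integrable has_moments_intros) auto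
    finally show ?thesis by simp
  qed
  have 2: "(LINT x|M. (\<Sum>i\<in>P. c i * X i x)) = (\<Sum>i\<in>P. c i * (LINT x|M. X i x))"
    using assms(1) by (subst Bochner_Integration.integral_sum) (auto intro: has_moments_integrable)
  have 3: "(LINT x|M. (\<Sum>j\<in>Q. d j * Y j x)) = (\<Sum>j\<in>Q. d j * (LINT x|M. Y j x))"
    using assms(2) by (subst Bochner_Integration.integral_sum) (auto intro: has_moments_integrable)
  show ?thesis
    unfolding cov_def 1 2 3 by (simp add: sum_product sum_subtractf algebra_simps)
qed

text \<open>
  The weights \<open>u\<close> and \<open>v\<close> allow the covariances of powers to grow with the exponents, as needed for
  binomial expansions.
\<close>

lemma abs_cov_sum_le:
  assumes "\<And>i. i \<in> P \<Longrightarrow> has_moments M (X i)" "\<And>j. j \<in> Q \<Longrightarrow> has_moments M (Y j)"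
    and "\<And>i j. i \<in> P \<Longrightarrow> j \<in> Q \<Longrightarrow> \<bar>cov M (X i) (Y j)\<bar> \<le> \<epsilon> * (u i * v j)"
  shows "\<bar>cov M (\<lambda>x. \<Sum>i\<in>P. c i * X i x) (\<lambda>x. \<Sum>j\<in>Q. d j * Y j x)\<bar>
    \<le> \<epsilon> * ((\<Sum>i\<in>P. \<bar>c i\<bar> * u i) * (\<Sum>j\<in>Q. \<bar>d j\<bar> * v j))"
proof -
  have "\<bar>\<Sum>i\<in>P. \<Sum>j\<in>Q. c i * d j * cov M (X i) (Y j)\<bar>
      \<le> (\<Sum>i\<in>P. \<Sum>j\<in>Q. \<bar>c i * d j * cov M (X i) (Y j)\<bar>)"
    by (intro order_trans[OF sum_abs] sum_mono order_refl)
  also have "\<dots> \<le> (\<Sum>i\<in>P. \<Sum>j\<in>Q. \<bar>c i\<bar> * \<bar>d j\<bar> * (\<epsilon> * (u i * v j)))"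
    unfolding abs_mult using assms(3) by (intro sum_mono mult_left_mono) auto
  also have "\<dots> = \<epsilon> * ((\<Sum>i\<in>P. \<bar>c i\<bar> * u i) * (\<Sum>j\<in>Q. \<bar>d j\<bar> * v j))"
    unfolding sum_product by (simp add: sum_distrib_left mult_ac)
  finally show ?thesis
    using cov_sum_mult[OF assms(1,2), where c=c and d=d] by simp
qed

lemma cov_commute: "cov M X Y = cov M Y X"
  by (simp add: cov_def mult.commute)

end

section \<open>Measure-preserving maps\<close>

locale invariant_map = prob_space M for M :: "'a measure" +
  fixes f :: "'a \<Rightarrow> 'a"
  assumes f_measurable: "f \<in> M \<rightarrow>\<^sub>M M" and f_invariant: "distr M M f = M"
begin

lemma funpow_measurable [measurable]: "f ^^ n \<in> M \<rightarrow>\<^sub>M M"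
  by (rule measurable_compose_n[OF f_measurable])

lemma distr_funpow: "distr M M (f ^^ n) = M"
proof (induction n)
  case 0
  show ?case using distr_id[of M] by (simp add: id_def)
next
  case (Suc n)
  have "distr M M (f ^^ Suc n) = distr (distr M M (f ^^ n)) M f"
    by (subst distr_distr) (auto simp: f_measurable)
  then show ?case using Suc f_invariant by (simp add: o_def)
qed

lemma integral_funpow:
  fixes h :: "'a \<Rightarrow> real"
  assumes "h \<in> borel_measurable M"
  shows "(LINT x|M. h ((f ^^ n) x)) = (LINT x|M. h x)"
  using integral_distr[OF funpow_measurable assms, of n] by (simp add: distr_funpow)

lemma has_moments_funpow:
  assumes "has_moments M h"
  shows "has_moments M (\<lambda>x. h ((f ^^ n) x))"
proof -
  note [measurable] = has_moments_measurable[OF assms]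
  have "integrable M (\<lambda>x. \<bar>h ((f ^^ n) x)\<bar> ^ q)" for q
    using integrable_distr_eq[OF funpow_measurable, of "\<lambda>x. \<bar>h x\<bar> ^ q" n]
      has_moments_integrable_abs[OF assms, of q]
    by (simp add: distr_funpow)
  then show ?thesis
    by (simp add: has_moments_def)
qed

text \<open>
  The times are indexed, rather than collected in sets, because expanding a power of a Birkhoff sum
  produces products in which a time occurs repeatedly.
\<close>

definition block_decorrelation :: "('a \<Rightarrow> real) \<Rightarrow> nat \<Rightarrow> real \<Rightarrow> real \<Rightarrow> nat \<Rightarrow> bool" where
  "block_decorrelation \<phi> r C \<rho> \<Lambda> \<longleftrightarrow> (\<forall>l I J (k :: nat \<Rightarrow> nat).
     1 \<le> l \<longrightarrow> finite I \<longrightarrow> finite J \<longrightarrow> I \<inter> J = {} \<longrightarrow> card (I \<union> J) \<le> r \<longrightarrow>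
     (\<forall>i\<in>I. \<forall>j\<in>J. k i + \<Lambda> * l \<le> k j) \<longrightarrow>
     \<bar>cov M (\<lambda>x. \<Prod>i\<in>I. \<phi> ((f ^^ k i) x)) (\<lambda>x. \<Prod>j\<in>J. \<phi> ((f ^^ k j) x))\<bar> \<le> C * \<rho> ^ l)"

lemma funpow_space: "x \<in> space M \<Longrightarrow> (f ^^ n) x \<in> space M"
  using funpow_measurable by (rule measurable_space)

end

section \<open>The algebra spanned by the cone\<close>

text \<open>
  \<open>R\<close> bounds the atomic norm of \<open>g\<close> with respect to the cone: on \<open>X\<close>, the function \<open>g\<close> is a linear
  combination of elements of \<open>B\<close> of norm at most \<open>1\<close> whose coefficients have absolute sum at most \<open>R\<close>.
  Generating it by rules turns each multilinear extension below into a rule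
  induction.
\<close>

inductive cone_span :: "'a set \<Rightarrow> ('a \<Rightarrow> real) set \<Rightarrow> (('a \<Rightarrow> real) \<Rightarrow> real) \<Rightarrow> real \<Rightarrow> ('a \<Rightarrow> real) \<Rightarrow> bool"
  for X B N where
  atom: "g \<in> B \<Longrightarrow> N g \<le> 1 \<Longrightarrow> cone_span X B N 1 g"
| scale: "cone_span X B N R g \<Longrightarrow> cone_span X B N (\<bar>c\<bar> * R) (\<lambda>x. c * g x)"
| add: "cone_span X B N R g \<Longrightarrow> cone_span X B N S h \<Longrightarrow> cone_span X B N (R + S) (\<lambda>x. g x + h x)"
| weaken: "cone_span X B N R g \<Longrightarrow> R \<le> S \<Longrightarrow> cone_span X B N S g"
| cong: "cone_span X B N R g \<Longrightarrow> (\<And>x. x \<in> X \<Longrightarrow> h x = g x) \<Longrightarrow> cone_span X B N R h"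

lemma cone_span_nonneg: "cone_span X B N R g \<Longrightarrow> 0 \<le> R"
  by (induction rule: cone_span.induct) auto

locale cone_mixing = invariant_map M f for M :: "'a measure" and f +
  fixes V N B
  assumes tail_cone: "tail_cone M f V N B"
begin

abbreviation "cspan \<equiv> cone_span (space M) B N"

lemma cone_bound: "g \<in> B \<Longrightarrow> x \<in> space M \<Longrightarrow> \<bar>g x\<bar> \<le> N g"
  and cone_measurable: "g \<in> B \<Longrightarrow> g \<in> borel_measurable M"
  and cone_scale: "g \<in> B \<Longrightarrow> 0 \<le> c \<Longrightarrow> (\<lambda>x. c * g x) \<in> B"
  and cone_subset: "B \<subseteq> V"
  and cone_exp_mixing: "exp_mixing_inequalities M f B N"
  and norm_nonneg: "g \<in> V \<Longrightarrow> 0 \<le> N g"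
  and norm_scale: "g \<in> V \<Longrightarrow> N (\<lambda>x. c * g x) = \<bar>c\<bar> * N g"
proof -
  have *: "normed_function_space (space M) V N" "B \<subseteq> V" "function_cone B"
    "\<forall>\<phi>\<in>B. \<forall>x\<in>space M. \<bar>\<phi> x\<bar> \<le> N \<phi>" "B \<subseteq> borel_measurable M" "exp_mixing_inequalities M f B N"
    using tail_cone unfolding tail_cone_def by (auto simp only:)
  show "g \<in> B \<Longrightarrow> x \<in> space M \<Longrightarrow> \<bar>g x\<bar> \<le> N g" "g \<in> B \<Longrightarrow> g \<in> borel_measurable M"
    "B \<subseteq> V" "exp_mixing_inequalities M f B N"
    using * by auto
  show "g \<in> B \<Longrightarrow> 0 \<le> c \<Longrightarrow> (\<lambda>x. c * g x) \<in> B"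
    using *(3) by (simp add: function_cone_def)
  show "g \<in> V \<Longrightarrow> 0 \<le> N g" "g \<in> V \<Longrightarrow> N (\<lambda>x. c * g x) = \<bar>c\<bar> * N g"
    using *(1) by (simp_all add: normed_function_space_def)
qed

lemma span_bound: "cspan R g \<Longrightarrow> x \<in> space M \<Longrightarrow> \<bar>g x\<bar> \<le> R"
proof (induction rule: cone_span.induct)
  case (atom g)
  then show ?case using cone_bound by force
next
  case (scale R g c)
  then show ?case by (simp add: abs_mult mult_left_mono)
qed auto

lemma span_measurable: "cspan R g \<Longrightarrow> g \<in> borel_measurable M"
proof (induction rule: cone_span.induct)
  case (atom g)
  then show ?case using cone_measurable by simp
next
  case (cong R g h)
  then show ?case by (subst measurable_cong) auto
qed auto

lemma span_has_moments: "cspan R g \<Longrightarrow> has_moments M g"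
  using has_moments_bounded[of g R] span_measurable span_bound by blast

lemma span_cone:
  assumes "g \<in> B" "N g \<le> R" "R > 0"
  shows "cspan R g"
proof -
  have "(\<lambda>x. (1 / R) * g x) \<in> B"
    using assms by (intro cone_scale) auto
  moreover have "N (\<lambda>x. (1 / R) * g x) \<le> 1"
    using assms cone_subset by (subst norm_scale) auto
  ultimately have "cspan 1 (\<lambda>x. (1 / R) * g x)"
    using cone_span.atom[of "\<lambda>x. (1 / R) * g x" B N "space M"] by blast
  from cone_span.scale[OF this, of R] show ?thesis
    using assms by simp
qed

lemma span_uminus: "cspan R g \<Longrightarrow> cspan R (\<lambda>x. - g x)"
  using cone_span.scale[of "space M" B N R g "-1"] by simp

lemma span_diff:
  assumes "cspan R g" "cspan S h"
  shows "cspan (R + S) (\<lambda>x. g x - h x)"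
  using cone_span.add[OF assms(1) span_uminus[OF assms(2)]] by simp

lemma span_sum:
  assumes "finite I" "I \<noteq> {}" "\<And>i. i \<in> I \<Longrightarrow> cspan R (g i)"
  shows "cspan (real (card I) * R) (\<lambda>x. \<Sum>i\<in>I. g i x)"
  using assms
proof (induction rule: finite_ne_induct)
  case (insert i I)
  then have "cspan (R + real (card I) * R) (\<lambda>x. g i x + (\<Sum>i\<in>I. g i x))"
    by (intro cone_span.add) auto
  with insert show ?case by (simp add: algebra_simps)
qed simp

text \<open>
  The decomposition (B3), for products of two functions, writes the product as a sum of boundedly many
  signed elements of the cone.
\<close>

lemma span_atoms_mult:
  obtains C where "C \<ge> 1"
    "\<And>g h. g \<in> B \<Longrightarrow> N g \<le> 1 \<Longrightarrow> h \<in> B \<Longrightarrow> N h \<le> 1 \<Longrightarrow> cspan C (\<lambda>x. g x * h x)"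
proof -
  have "\<forall>t::nat. t \<ge> 2 \<longrightarrow> (\<exists>(m :: nat) (P :: nat \<Rightarrow> real list \<Rightarrow> real) (c :: real).
        (\<forall>xs. length xs = t \<longrightarrow> (\<Sum>l<m. P l xs) = prod_list xs) \<and>
        (\<forall>gs. length gs = t \<longrightarrow> set gs \<subseteq> B \<longrightarrow> (\<forall>g\<in>set gs. N g \<le> 1) \<longrightarrow>
          (\<forall>l<m. let h = (\<lambda>x. P l (map (\<lambda>g. g x) gs)) in
             h \<in> B \<and> N h \<le> c \<or> (\<lambda>x. - h x) \<in> B \<and> N (\<lambda>x. - h x) \<le> c)))"
    using tail_cone unfolding tail_cone_def by (elim conjE) assumption
  from this[rule_format, OF order_refl] obtain m :: nat and P c where PQ:
    "(\<forall>xs. length xs = 2 \<longrightarrow> (\<Sum>l<m. P l xs) = prod_list (xs :: real list)) \<and>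
        (\<forall>gs. length gs = 2 \<longrightarrow> set gs \<subseteq> B \<longrightarrow> (\<forall>g\<in>set gs. N g \<le> 1) \<longrightarrow>
          (\<forall>l<m. let h = (\<lambda>x. P l (map (\<lambda>g. g x) gs)) in
             h \<in> B \<and> N h \<le> c \<or> (\<lambda>x. - h x) \<in> B \<and> N (\<lambda>x. - h x) \<le> c))"
    by (elim exE) (rule that)
  have sum: "(\<Sum>l<m. P l xs) = prod_list xs" if "length xs = 2" for xs
    using PQ that by blast
  have cone: "(\<lambda>x. P l (map (\<lambda>g. g x) gs)) \<in> B \<and> N (\<lambda>x. P l (map (\<lambda>g. g x) gs)) \<le> c \<or>
       (\<lambda>x. - P l (map (\<lambda>g. g x) gs)) \<in> B \<and> N (\<lambda>x. - P l (map (\<lambda>g. g x) gs)) \<le> c"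
    if "length gs = 2" "set gs \<subseteq> B" "\<forall>g\<in>set gs. N g \<le> 1" "l < m" for gs l
    using PQ[THEN conjunct2, rule_format, OF that(1,2) _ that(4)] that(3) by (simp add: Let_def)
  have m: "m > 0"
    using sum[of "[1, 1]"] by (cases m) auto
  define C where "C = max 1 (real m * max 1 c)"
  have "cspan C (\<lambda>x. g x * h x)" if gh: "g \<in> B" "N g \<le> 1" "h \<in> B" "N h \<le> 1" for g h
  proof -
    have "cspan (max 1 c) (\<lambda>x. P l [g x, h x])" if "l < m" for l
    proof -
      have "(\<lambda>x. P l [g x, h x]) \<in> B \<and> N (\<lambda>x. P l [g x, h x]) \<le> c \<or>
          (\<lambda>x. - P l [g x, h x]) \<in> B \<and> N (\<lambda>x. - P l [g x, h x]) \<le> c"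
        using cone[of "[g, h]" l] gh that by simp
      then show ?thesis
      proof
        assume "(\<lambda>x. P l [g x, h x]) \<in> B \<and> N (\<lambda>x. P l [g x, h x]) \<le> c"
        then show ?thesis by (intro span_cone) auto
      next
        assume "(\<lambda>x. - P l [g x, h x]) \<in> B \<and> N (\<lambda>x. - P l [g x, h x]) \<le> c"
        then have "cspan (max 1 c) (\<lambda>x. - (- P l [g x, h x]))"
          by (intro span_uminus span_cone) auto
        then show ?thesis by simp
      qed
    qed
    then have "cspan (real (card {..<m}) * max 1 c) (\<lambda>x. \<Sum>l<m. P l [g x, h x])"
      using m by (intro span_sum) auto
    then have "cspan (real m * max 1 c) (\<lambda>x. g x * h x)"
      by (simp add: sum)
    then show ?thesis
      by (rule cone_span.weaken) (simp add: C_def)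
  qed
  moreover have "C \<ge> 1" by (simp add: C_def)
  ultimately show ?thesis by (rule that[rotated])
qed

text \<open>
  Bilinearity extends the case of two atoms. Products of any length follow from products of two
  factors.
\<close>

lemma span_mult:
  obtains C where "C \<ge> 1"
    "\<And>R S g h. cspan R g \<Longrightarrow> cspan S h \<Longrightarrow> cspan (C * R * S) (\<lambda>x. g x * h x)"
proof -
  obtain C where C: "C \<ge> 1" and atoms:
    "\<And>g h. g \<in> B \<Longrightarrow> N g \<le> 1 \<Longrightarrow> h \<in> B \<Longrightarrow> N h \<le> 1 \<Longrightarrow> cspan C (\<lambda>x. g x * h x)"
    by (rule span_atoms_mult) blast
  have atom_left: "cspan (C * S) (\<lambda>x. g x * h x)" if "cspan S h" "g \<in> B" "N g \<le> 1" for S g h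
    using that(1)
  proof induction
    case (atom h)
    then show ?case using atoms that by simp
  next
    case (scale R h c)
    from cone_span.scale[OF scale.IH, of c] show ?case
      by (simp add: mult_ac)
  next
    case (add R h S h')
    from cone_span.add[OF add.IH] show ?case
      by (simp add: algebra_simps)
  next
    case (weaken R h S)
    from cone_span.weaken[OF weaken.IH] show ?case
      using weaken C by simp
  next
    case (cong R h h')
    from cone_span.cong[OF cong.IH] show ?case
      using cong by simp
  qed
  have "cspan (C * R * S) (\<lambda>x. g x * h x)" if "cspan R g" "cspan S h" for R S g h
    using that(1)
  proof induction
    case (atom g)
    then show ?case using atom_left that(2) by simp
  next
    case (scale R g c)
    from cone_span.scale[OF scale.IH, of c] show ?case
      by (simp add: mult_ac)
  next
    case (add R g S g')
    from cone_span.add[OF add.IH] show ?case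
      by (simp add: algebra_simps)
  next
    case (weaken R g R')
    from cone_span.weaken[OF weaken.IH] show ?case
      using weaken C cone_span_nonneg[OF that(2)] by (simp add: mult_left_mono mult_right_mono)
  next
    case (cong R g g')
    from cone_span.cong[OF cong.IH] show ?case
      using cong by simp
  qed
  with C show ?thesis by (rule that)
qed

lemma span_prod:
  assumes C: "\<And>R S g h. cspan R g \<Longrightarrow> cspan S h \<Longrightarrow> cspan (C * R * S) (\<lambda>x. g x * h x)" "C \<ge> 1"
    and "finite I" "I \<noteq> {}" "\<And>i. i \<in> I \<Longrightarrow> cspan R (g i)"
  shows "cspan ((C * R) ^ card I) (\<lambda>x. \<Prod>i\<in>I. g i x)"
  using assms(3-)
proof (induction rule: finite_ne_induct)
  case (singleton i)
  then have "R \<le> C * R"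
    using C(2) cone_span_nonneg[of "space M" B N R "g i"] mult_right_mono[of 1 C R] by auto
  then show ?case
    using singleton by (auto intro: cone_span.weaken)
next
  case (insert i I)
  then have "cspan (C * R * (C * R) ^ card I) (\<lambda>x. g i x * (\<Prod>i\<in>I. g i x))"
    by (intro C) auto
  with insert show ?case by simp
qed

section \<open>Mixing for products along an orbit\<close>

text \<open>
  Observables are indexed by the time at which they are evaluated, so that the times form a finite set
  and no increasing enumeration of them has to be carried along.
\<close>

definition orbit_prod :: "nat set \<Rightarrow> (nat \<Rightarrow> 'a \<Rightarrow> real) \<Rightarrow> 'a \<Rightarrow> real" where
  "orbit_prod U g x = (\<Prod>u\<in>U. g u ((f ^^ u) x))"

lemma expectation_shift_prod:
  assumes "\<And>u. u \<in> U \<Longrightarrow> g u \<in> borel_measurable M" "\<And>u. u \<in> U \<Longrightarrow> t \<le> u"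
  shows "(LINT x|M. orbit_prod U g x) = (LINT x|M. (\<Prod>u\<in>U. g u ((f ^^ (u - t)) x)))"
proof -
  have "(\<lambda>x. \<Prod>u\<in>U. g u ((f ^^ (u - t)) x)) \<in> borel_measurable M"
    using assms(1) measurable_compose[OF funpow_measurable] by (intro borel_measurable_prod) blast
  from integral_funpow[OF this, of t]
  have "(LINT x|M. (\<Prod>u\<in>U. g u ((f ^^ (u - t)) x)))
      = (LINT x|M. (\<Prod>u\<in>U. g u ((f ^^ (u - t)) ((f ^^ t) x))))" ..
  also have "\<dots> = (LINT x|M. orbit_prod U g x)"
    unfolding orbit_prod_def using assms(2)
    by (intro arg_cong[where f="integral\<^sup>L M"] ext prod.cong refl)
      (metis comp_apply funpow_add le_add_diff_inverse2)
  finally show ?thesis ..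
qed

text \<open>
  Exponential mixing, freed from its normalisations: the first time need not be \<open>0\<close>, by invariance of
  the measure; and one pair of constants serves for up to \<open>r\<close> observables.
\<close>

lemma mixing_at_times:
  fixes r :: nat
  obtains C \<theta> :: real where "C > 0" "0 < \<theta>" "\<theta> < 1"
    "\<And>U g G. finite U \<Longrightarrow> card U \<le> r \<Longrightarrow> (\<And>u. u \<in> U \<Longrightarrow> g u \<in> B \<and> N (g u) \<le> 1) \<Longrightarrow>
      (\<And>u v. u \<in> U \<Longrightarrow> v \<in> U \<Longrightarrow> u < v \<Longrightarrow> u + G \<le> v) \<Longrightarrow>
      \<bar>(LINT x|M. orbit_prod U g x) - (\<Prod>u\<in>U. LINT x|M. g u x)\<bar> \<le> C * \<theta> ^ G"
proof -
  define mixes :: "nat \<Rightarrow> real \<Rightarrow> real \<Rightarrow> bool" where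
    "mixes \<kappa> C \<theta> \<longleftrightarrow> C > 0 \<and> 0 < \<theta> \<and> \<theta> < 1 \<and>
       (\<forall>(\<phi> :: nat \<Rightarrow> 'a \<Rightarrow> real) (n :: nat \<Rightarrow> nat).
          (\<forall>j\<le>\<kappa>. \<phi> j \<in> B) \<longrightarrow> n 0 = 0 \<longrightarrow> (\<forall>j<\<kappa>. n j \<le> n (Suc j)) \<longrightarrow>
          \<bar>(LINT x|M. (\<Prod>j\<le>\<kappa>. \<phi> j ((f ^^ n j) x))) - (\<Prod>j\<le>\<kappa>. LINT x|M. \<phi> j x)\<bar>
            \<le> C * \<theta> ^ (Min ((\<lambda>j. n (Suc j) - n j) ` {..<\<kappa>})) * (\<Prod>j\<le>\<kappa>. N (\<phi> j)))"
    for \<kappa> C \<theta>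
  have "\<forall>\<kappa>. \<exists>C \<theta>. \<kappa> \<ge> 1 \<longrightarrow> mixes \<kappa> C \<theta>"
    using cone_exp_mixing unfolding exp_mixing_inequalities_def mixes_def by presburger
  then obtain Cf \<theta>f where mixes: "\<And>\<kappa>. \<kappa> \<ge> 1 \<Longrightarrow> mixes \<kappa> (Cf \<kappa>) (\<theta>f \<kappa>)"
    by metis
  have C\<theta>: "\<And>\<kappa>. \<kappa> \<ge> 1 \<Longrightarrow> Cf \<kappa> > 0 \<and> 0 < \<theta>f \<kappa> \<and> \<theta>f \<kappa> < 1"
    and mix: "\<And>\<kappa> (\<phi> :: nat \<Rightarrow> 'a \<Rightarrow> real) (n :: nat \<Rightarrow> nat). \<kappa> \<ge> 1 \<Longrightarrow>
          (\<forall>j\<le>\<kappa>. \<phi> j \<in> B) \<Longrightarrow> n 0 = 0 \<Longrightarrow> (\<forall>j<\<kappa>. n j \<le> n (Suc j)) \<Longrightarrow>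
          \<bar>(LINT x|M. (\<Prod>j\<le>\<kappa>. \<phi> j ((f ^^ n j) x))) - (\<Prod>j\<le>\<kappa>. LINT x|M. \<phi> j x)\<bar>
            \<le> Cf \<kappa> * \<theta>f \<kappa> ^ (Min ((\<lambda>j. n (Suc j) - n j) ` {..<\<kappa>})) * (\<Prod>j\<le>\<kappa>. N (\<phi> j))"
    using mixes unfolding mixes_def by blast+
  define C where "C = 1 + (\<Sum>\<kappa>\<in>{1..r}. Cf \<kappa>)"
  define \<theta> where "\<theta> = Max (insert (1/2) (\<theta>f ` {1..r}))"
  have C0: "C > 0"
    unfolding C_def by (rule add_pos_nonneg) (auto intro!: sum_nonneg simp: C\<theta> less_imp_le)
  have CfC: "Cf \<kappa> \<le> C" if "\<kappa> \<in> {1..r}" for \<kappa>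
    using that C\<theta> member_le_sum[of \<kappa> "{1..r}" Cf] by (fastforce simp: C_def intro: less_imp_le)
  have \<theta>1: "\<theta> < 1" using C\<theta> by (auto simp: \<theta>_def)
  have "1/2 \<le> \<theta>" unfolding \<theta>_def by (rule Max_ge) auto
  then have \<theta>0: "\<theta> > 0" by simp
  have \<theta>f\<theta>: "\<theta>f \<kappa> \<le> \<theta>" if "\<kappa> \<in> {1..r}" for \<kappa>
    using that unfolding \<theta>_def by (intro Max_ge) auto
  have "\<bar>(LINT x|M. orbit_prod U g x) - (\<Prod>u\<in>U. LINT x|M. g u x)\<bar> \<le> C * \<theta> ^ G"
    if U: "finite U" "card U \<le> r" and g: "\<And>u. u \<in> U \<Longrightarrow> g u \<in> B \<and> N (g u) \<le> 1"
      and G: "\<And>u v. u \<in> U \<Longrightarrow> v \<in> U \<Longrightarrow> u < v \<Longrightarrow> u + G \<le> v" for U g G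
  proof (cases "card U \<le> 1")
    case True
    then consider "U = {}" | u where "U = {u}"
      using U(1) by (metis One_nat_def card_1_singletonE card_eq_0_iff le_Suc_eq le_zero_eq)
    then show ?thesis
    proof cases
      case 1
      then show ?thesis using C0 \<theta>0 by (simp add: orbit_prod_def prob_space)
    next
      case 2
      then have "(LINT x|M. g u ((f ^^ u) x)) = (LINT x|M. g u x)"
        using g cone_measurable by (intro integral_funpow) auto
      then show ?thesis using 2 C0 \<theta>0 by (simp add: orbit_prod_def)
    qed
  next
    case False
    define us where "us = sorted_list_of_set U"
    define \<kappa> where "\<kappa> = card U - 1"
    have \<kappa>: "\<kappa> \<in> {1..r}" "card U = Suc \<kappa>" using False U by (auto simp: \<kappa>_def)
    have us: "set us = U" "length us = Suc \<kappa>" "sorted_wrt (<) us" "distinct us"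
      using U \<kappa>(2) by (auto simp: us_def)
    have bij: "bij_betw (\<lambda>j. us ! j) {..\<kappa>} U"
      using bij_betw_nth[OF us(4), of "{..\<kappa>}" U] us by (auto simp: lessThan_Suc_atMost)
    have in_U: "us ! j \<in> U" if "j \<le> \<kappa>" for j
      using that us(1,2) by (metis le_imp_less_Suc nth_mem)
    have less: "us ! i < us ! j" if "i < j" "j \<le> \<kappa>" for i j
      using that us(2,3) by (simp add: sorted_wrt_iff_nth_less)
    define t where "t = us ! 0"
    define n where "n j = us ! j - t" for j
    have t_le: "t \<le> us ! j" if "j \<le> \<kappa>" for j
      using less[of 0 j] that by (cases "j = 0") (auto simp: t_def)
    then have t_le_U: "t \<le> u" if "u \<in> U" for u
      using that bij by (auto simp: bij_betw_def)
    have gap: "G \<le> n (Suc j) - n j" if "j < \<kappa>" for j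
      using G[OF in_U in_U less, of j "Suc j"] that t_le[of j] by (auto simp: n_def)
    have "(LINT x|M. orbit_prod U g x) = (LINT x|M. (\<Prod>u\<in>U. g u ((f ^^ (u - t)) x)))"
      using g cone_measurable t_le_U by (intro expectation_shift_prod) auto
    also have "\<dots> = (LINT x|M. (\<Prod>j\<le>\<kappa>. g (us ! j) ((f ^^ n j) x)))"
      by (subst prod.reindex_bij_betw[OF bij, symmetric]) (simp add: n_def)
    finally have 1: "(LINT x|M. orbit_prod U g x) = (LINT x|M. (\<Prod>j\<le>\<kappa>. g (us ! j) ((f ^^ n j) x)))" .
    have 2: "(\<Prod>u\<in>U. LINT x|M. g u x) = (\<Prod>j\<le>\<kappa>. LINT x|M. g (us ! j) x)"
      by (rule prod.reindex_bij_betw[OF bij, symmetric])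
    have "\<bar>(LINT x|M. orbit_prod U g x) - (\<Prod>u\<in>U. LINT x|M. g u x)\<bar>
       \<le> Cf \<kappa> * \<theta>f \<kappa> ^ (Min ((\<lambda>j. n (Suc j) - n j) ` {..<\<kappa>})) * (\<Prod>j\<le>\<kappa>. N (g (us ! j)))"
      unfolding 1 2
    proof (rule mix)
      show "\<forall>j<\<kappa>. n j \<le> n (Suc j)"
        using less by (simp add: n_def diff_le_mono less_imp_le)
    qed (use \<kappa> g in_U in \<open>auto simp: n_def t_def\<close>)
    also have "\<dots> \<le> C * \<theta> ^ G * 1"
    proof (intro mult_mono)
      have "\<theta>f \<kappa> ^ (Min ((\<lambda>j. n (Suc j) - n j) ` {..<\<kappa>})) \<le> \<theta>f \<kappa> ^ G"
        using C\<theta>[of \<kappa>] \<kappa> gap by (intro power_decreasing) (auto simp: Min_ge_iff lessThan_empty_iff)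
      also have "\<dots> \<le> \<theta> ^ G"
        using \<theta>f\<theta>[of \<kappa>] C\<theta>[of \<kappa>] \<kappa> by (intro power_mono) auto
      finally show "\<theta>f \<kappa> ^ (Min ((\<lambda>j. n (Suc j) - n j) ` {..<\<kappa>})) \<le> \<theta> ^ G" .
      show "(\<Prod>j\<le>\<kappa>. N (g (us ! j))) \<le> 1"
        using g in_U norm_nonneg cone_subset by (intro prod_le_1) auto
      show "0 \<le> (\<Prod>j\<le>\<kappa>. N (g (us ! j)))"
        using g in_U norm_nonneg cone_subset by (intro prod_nonneg) auto
    qed (use CfC[of \<kappa>] \<kappa> C0 \<theta>0 C\<theta>[of \<kappa>] in auto)
    finally show ?thesis by simp
  qed
  then show ?thesis
    using that[OF C0 \<theta>0 \<theta>1] by blast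
qed

lemma orbit_prod_has_moments:
  "(\<And>u. u \<in> U \<Longrightarrow> has_moments M (g u)) \<Longrightarrow> has_moments M (orbit_prod U g)"
  unfolding orbit_prod_def[abs_def] by (intro has_moments_prod has_moments_funpow)

lemma orbit_prod_union:
  "finite U \<Longrightarrow> finite W \<Longrightarrow> U \<inter> W = {} \<Longrightarrow> orbit_prod (U \<union> W) g x = orbit_prod U g x * orbit_prod W g x"
  by (simp add: orbit_prod_def prod.union_disjoint)

text \<open>
  Apply mixing to all the observables and to those in each of the two groups: each expectation of a
  product is close to the product of the expectations, and the latter splits along the two groups.
\<close>

lemma cov_orbit_prod_atoms:
  fixes r :: nat
  obtains C \<theta> :: real where "C > 0" "0 < \<theta>" "\<theta> < 1"
    "\<And>U W g G. finite U \<Longrightarrow> finite W \<Longrightarrow> U \<inter> W = {} \<Longrightarrow> card (U \<union> W) \<le> r \<Longrightarrow>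
      (\<And>u. u \<in> U \<union> W \<Longrightarrow> g u \<in> B \<and> N (g u) \<le> 1) \<Longrightarrow>
      (\<And>u v. u \<in> U \<union> W \<Longrightarrow> v \<in> U \<union> W \<Longrightarrow> u < v \<Longrightarrow> u + G \<le> v) \<Longrightarrow>
      \<bar>cov M (orbit_prod U g) (orbit_prod W g)\<bar> \<le> C * \<theta> ^ G"
proof -
  obtain C \<theta> :: real where C\<theta>: "C > 0" "0 < \<theta>" "\<theta> < 1" and mix:
    "\<And>U g G. finite U \<Longrightarrow> card U \<le> r \<Longrightarrow> (\<And>u. u \<in> U \<Longrightarrow> g u \<in> B \<and> N (g u) \<le> 1) \<Longrightarrow>
      (\<And>u v. u \<in> U \<Longrightarrow> v \<in> U \<Longrightarrow> u < v \<Longrightarrow> u + G \<le> v) \<Longrightarrow>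
      \<bar>(LINT x|M. orbit_prod U g x) - (\<Prod>u\<in>U. LINT x|M. g u x)\<bar> \<le> C * \<theta> ^ G"
    by (rule mixing_at_times[of r]) blast
  have "\<bar>cov M (orbit_prod U g) (orbit_prod W g)\<bar> \<le> (3 * C) * \<theta> ^ G"
    if fin: "finite U" "finite W" and disj: "U \<inter> W = {}" and card: "card (U \<union> W) \<le> r"
      and g: "\<And>u. u \<in> U \<union> W \<Longrightarrow> g u \<in> B \<and> N (g u) \<le> 1"
      and G: "\<And>u v. u \<in> U \<union> W \<Longrightarrow> v \<in> U \<union> W \<Longrightarrow> u < v \<Longrightarrow> u + G \<le> v" for U W g G
  proof -
    let ?E = "\<lambda>U. LINT x|M. orbit_prod U g x" and ?P = "\<lambda>U. \<Prod>u\<in>U. LINT x|M. g u x"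
    have cardU: "card U \<le> r" "card W \<le> r"
      using card card_mono[of "U \<union> W" U] card_mono[of "U \<union> W" W] fin by auto
    have 1: "\<bar>?E (U \<union> W) - ?P (U \<union> W)\<bar> \<le> C * \<theta> ^ G"
      using fin card g G by (intro mix) auto
    have 2: "\<bar>?E U - ?P U\<bar> \<le> C * \<theta> ^ G" and 3: "\<bar>?E W - ?P W\<bar> \<le> C * \<theta> ^ G"
      using fin cardU g G by (auto intro!: mix)
    have bd: "\<bar>g u x\<bar> \<le> 1" if "u \<in> U \<union> W" "x \<in> space M" for u x
      using cone_bound[of "g u" x] g[of u] that by force
    have mom: "has_moments M (g u)" if "u \<in> U \<union> W" for u
      using g[OF that] by (intro span_has_moments[OF cone_span.atom]) auto
    have le1: "\<bar>LINT x|M. h x\<bar> \<le> 1"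
      if "has_moments M h" "\<And>x. x \<in> space M \<Longrightarrow> \<bar>h x\<bar> \<le> 1" for h
    proof -
      have "\<bar>LINT x|M. h x\<bar> \<le> (LINT x|M. \<bar>h x\<bar>)" by (rule integral_abs_bound)
      also have "\<dots> \<le> (LINT x|M. 1)"
        using that by (intro integral_mono has_moments_integrable has_moments_intros) auto
      finally show ?thesis by (simp add: prob_space)
    qed
    have E1: "\<bar>?E U\<bar> \<le> 1"
    proof (rule le1)
      show "has_moments M (orbit_prod U g)" using mom by (intro orbit_prod_has_moments) auto
      fix x assume "x \<in> space M"
      then show "\<bar>orbit_prod U g x\<bar> \<le> 1"
        unfolding orbit_prod_def abs_prod using bd funpow_space by (intro prod_le_1) auto
    qed
    have P1: "\<bar>?P W\<bar> \<le> 1"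
      unfolding abs_prod using mom bd by (intro prod_le_1 conjI le1) auto
    have PUW: "?P (U \<union> W) = ?P U * ?P W"
      using fin disj by (simp add: prod.union_disjoint)
    have EUW: "?E (U \<union> W) = (LINT x|M. orbit_prod U g x * orbit_prod W g x)"
      using fin disj by (simp add: orbit_prod_union)
    have "\<bar>cov M (orbit_prod U g) (orbit_prod W g)\<bar>
        = \<bar>(?E (U \<union> W) - ?P (U \<union> W)) - ((?E U - ?P U) * ?P W + ?E U * (?E W - ?P W))\<bar>"
      unfolding cov_def PUW EUW by (simp add: algebra_simps)
    also have "\<dots> \<le> \<bar>?E (U \<union> W) - ?P (U \<union> W)\<bar> + (\<bar>?E U - ?P U\<bar> * \<bar>?P W\<bar> + \<bar>?E U\<bar> * \<bar>?E W - ?P W\<bar>)"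
      unfolding abs_mult[symmetric] by linarith
    also have "\<dots> \<le> C * \<theta> ^ G + ((C * \<theta> ^ G) * 1 + 1 * (C * \<theta> ^ G))"
      using 1 2 3 E1 P1 C\<theta> by (intro add_mono mult_mono) auto
    finally show ?thesis by simp
  qed
  then show ?thesis
    using that[of "3 * C" \<theta>] C\<theta> by simp
qed

lemma orbit_prod_upd:
  assumes "finite U"
  shows "orbit_prod U (g(u := w)) x
    = (if u \<in> U then w ((f ^^ u) x) * orbit_prod (U - {u}) g x else orbit_prod U g x)"
proof (cases "u \<in> U")
  case True
  have "orbit_prod U (g(u := w)) x = w ((f ^^ u) x) * orbit_prod (U - {u}) (g(u := w)) x"
    unfolding orbit_prod_def using assms True by (subst prod.remove[of U u]) (auto simp del: fun_upd_apply simp: fun_upd_same)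
  also have "orbit_prod (U - {u}) (g(u := w)) x = orbit_prod (U - {u}) g x"
    unfolding orbit_prod_def by (intro prod.cong) auto
  finally show ?thesis using True by (simp del: fun_upd_apply)
next
  case False
  then have "orbit_prod U (g(u := w)) x = orbit_prod U g x"
    unfolding orbit_prod_def by (intro prod.cong) auto
  then show ?thesis using False by (simp del: fun_upd_apply)
qed

lemma cov_span_factor:
  assumes "has_moments M Q" "has_moments M Y"
    and atom: "\<And>a. a \<in> B \<Longrightarrow> N a \<le> 1 \<Longrightarrow> \<bar>cov M (\<lambda>x. a ((f ^^ u) x) * Q x) Y\<bar> \<le> \<epsilon>"
    and "0 \<le> \<epsilon>" "cspan R w"
  shows "\<bar>cov M (\<lambda>x. w ((f ^^ u) x) * Q x) Y\<bar> \<le> R * \<epsilon>"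
  using \<open>cspan R w\<close>
proof induction
  case (atom g)
  then show ?case using assms(3) by simp
next
  case (scale R g c)
  have "cov M (\<lambda>x. c * g ((f ^^ u) x) * Q x) Y = c * cov M (\<lambda>x. g ((f ^^ u) x) * Q x) Y"
    using cov_scale_left[of M c "\<lambda>x. g ((f ^^ u) x) * Q x" Y] by (simp add: mult.assoc)
  then show ?case
    using scale.IH by (simp add: abs_mult mult.assoc mult_left_mono)
next
  case (add R g S h)
  have "cov M (\<lambda>x. (g ((f ^^ u) x) + h ((f ^^ u) x)) * Q x) Y
      = cov M (\<lambda>x. g ((f ^^ u) x) * Q x) Y + cov M (\<lambda>x. h ((f ^^ u) x) * Q x) Y"
    unfolding distrib_right using assms(1,2) add.hyps[THEN span_has_moments]
    by (intro cov_add_left has_moments_mult has_moments_funpow)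
  then show ?case
    using add.IH by (simp add: distrib_right)
next
  case (weaken R g S)
  then show ?case using assms(4) by (meson mult_right_mono order_trans)
next
  case (cong R g h)
  have "cov M (\<lambda>x. h ((f ^^ u) x) * Q x) Y = cov M (\<lambda>x. g ((f ^^ u) x) * Q x) Y"
    using cong.hyps funpow_space by (intro cov_cong) auto
  then show ?case using cong.IH by simp
qed

text \<open>
  The covariance is linear in each observable. The induction frees the observables at the times in \<open>S\<close>,
  one after the other, from being atoms, at the price of a factor \<open>R\<close> each.
\<close>

lemma cov_orbit_prod_span:
  assumes fin: "finite U" "finite W" and disj: "U \<inter> W = {}"
    and atoms: "\<And>g. (\<And>u. u \<in> U \<union> W \<Longrightarrow> g u \<in> B \<and> N (g u) \<le> 1) \<Longrightarrow>
      \<bar>cov M (orbit_prod U g) (orbit_prod W g)\<bar> \<le> \<epsilon>"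
    and \<epsilon>: "0 \<le> \<epsilon>" and "finite S" "S \<subseteq> U \<union> W"
    and "\<And>u. u \<in> S \<Longrightarrow> cspan R (g u)" and "\<And>u. u \<in> U \<union> W - S \<Longrightarrow> g u \<in> B \<and> N (g u) \<le> 1"
    and R: "0 \<le> R"
  shows "\<bar>cov M (orbit_prod U g) (orbit_prod W g)\<bar> \<le> R ^ card S * \<epsilon>"
  using assms(6-9)
proof (induction S arbitrary: g rule: finite_induct)
  case empty
  then show ?case using atoms by simp
next
  case (insert u S)
  have u: "u \<in> U \<union> W" using insert by auto
  have IH: "\<bar>cov M (orbit_prod U (g(u := a))) (orbit_prod W (g(u := a)))\<bar> \<le> R ^ card S * \<epsilon>"
    if "a \<in> B" "N a \<le> 1" for a
    using insert that by (intro insert.IH) auto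
  have span: "cspan (max 1 R) (g v)" if "v \<in> U \<union> W" for v
  proof (cases "v \<in> insert u S")
    case True
    from insert.prems(2)[OF True] show ?thesis by (rule cone_span.weaken) simp
  next
    case False
    with insert.prems(3)[of v] that have "cspan 1 (g v)"
      using cone_span.atom[of "g v" B N "space M"] by simp
    then show ?thesis by (rule cone_span.weaken) simp
  qed
  have mom: "has_moments M (orbit_prod U' g)" if "U' \<subseteq> U \<union> W" for U'
    using that by (intro orbit_prod_has_moments span_has_moments[OF span]) auto
  have ge0: "0 \<le> R ^ card S * \<epsilon>" using R \<epsilon> by simp
  have su: "cspan R (g u)" using insert.prems by simp
  have *: "\<bar>cov M (orbit_prod U1 g) (orbit_prod U2 g)\<bar> \<le> R * (R ^ card S * \<epsilon>)"
    if U12: "finite U1" "finite U2" "u \<in> U1" "u \<notin> U2" "U1 \<subseteq> U \<union> W" "U2 \<subseteq> U \<union> W"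
      and IH: "\<And>a. a \<in> B \<Longrightarrow> N a \<le> 1 \<Longrightarrow>
        \<bar>cov M (orbit_prod U1 (g(u := a))) (orbit_prod U2 (g(u := a)))\<bar> \<le> R ^ card S * \<epsilon>"
    for U1 U2
  proof -
    have eq: "cov M (orbit_prod U1 (g(u := a))) (orbit_prod U2 (g(u := a)))
        = cov M (\<lambda>x. a ((f ^^ u) x) * orbit_prod (U1 - {u}) g x) (orbit_prod U2 g)" for a
      using U12 by (intro cov_cong) (simp_all add: orbit_prod_upd)
    have "\<bar>cov M (\<lambda>x. g u ((f ^^ u) x) * orbit_prod (U1 - {u}) g x) (orbit_prod U2 g)\<bar>
        \<le> R * (R ^ card S * \<epsilon>)"
      using IH unfolding eq by (intro cov_span_factor[OF mom mom _ ge0 su]) (use U12 in auto)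
    then show ?thesis
      unfolding eq[symmetric] by simp
  qed
  have "\<bar>cov M (orbit_prod U g) (orbit_prod W g)\<bar> \<le> R * (R ^ card S * \<epsilon>)"
  proof (cases "u \<in> U")
    case True
    then show ?thesis using fin disj IH by (intro *) auto
  next
    case False
    then show ?thesis using fin disj IH u
      by (subst cov_commute, intro *) (auto simp: cov_commute[of "orbit_prod W _"])
  qed
  then show ?case using insert by (simp add: mult_ac)
qed

end

section \<open>Clusters of times and decorrelation\<close>

text \<open>
  Here \<open>b x\<close> is the first time of the cluster of \<open>x\<close>, and \<open>D\<close> bounds the diameters; the initial
  clustering, later the one into singletons, is arbitrary for the sake of the induction. As long as the
  first times of two clusters are closer than \<open>l + H D\<close>, merge these clusters. This replaces \<open>D\<close> by
  \<open>l + (H + 1) D\<close> and removes a cluster, so each step multiplies \<open>D + l\<close> by at most \<open>H + 2\<close>. Starting from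
  singletons, the process stops while \<open>D\<close> is at most a multiple of \<open>l\<close> that depends only on \<open>H\<close> and on the
  number of times. Times on different
  sides of a sufficiently long gap are never merged.
\<close>

lemma orbit_clustering:
  fixes b :: "nat \<Rightarrow> nat" and H l D :: nat
  assumes "finite Z"
    and "\<And>x. x \<in> Z \<Longrightarrow> b x \<in> Z" "\<And>x. x \<in> Z \<Longrightarrow> b x \<le> x \<and> x \<le> b x + D"
    and "\<And>x. x \<in> Z \<Longrightarrow> left (b x) \<longleftrightarrow> left x"
    and "(H + 2) ^ card (b ` Z) * (D + l) \<le> m"
    and "\<And>u v. u \<in> Z \<Longrightarrow> v \<in> Z \<Longrightarrow> u < v \<Longrightarrow> left u \<noteq> left v \<Longrightarrow> u + (H + 1) * m \<le> v"
  shows "\<exists>D' b'. D' + l \<le> m \<and> (\<forall>x\<in>Z. b' x \<in> Z \<and> b' x \<le> x \<and> x \<le> b' x + D' \<and> (left (b' x) \<longleftrightarrow> left x)) \<and>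
    (\<forall>u\<in>b' ` Z. \<forall>v\<in>b' ` Z. u < v \<longrightarrow> u + (l + H * D') \<le> v)"
  using assms(2-5)
proof (induction "card (b ` Z)" arbitrary: b D rule: less_induct)
  case less
  have m: "D + l \<le> m"
    using less.prems(4) by (rule order_trans[rotated]) simp
  show ?case
  proof (cases "\<forall>u\<in>b ` Z. \<forall>v\<in>b ` Z. u < v \<longrightarrow> u + (l + H * D) \<le> v")
    case True
    with less.prems m show ?thesis by blast
  next
    case False
    then obtain u v where uv: "u \<in> b ` Z" "v \<in> b ` Z" "u < v" "v < u + (l + H * D)"
      by (auto simp: not_le)
    have uvZ: "u \<in> Z" "v \<in> Z" using uv less.prems by auto
    have "l + H * D \<le> (H + 1) * (D + l)" by (simp add: algebra_simps)
    also have "\<dots> \<le> (H + 1) * m" using m by (intro mult_left_mono) auto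
    finally have same: "left u = left v"
      using assms(6)[OF uvZ uv(3)] uv(4) by (meson add_left_mono leD order_trans)
    define b' where "b' x = (if b x = v then u else b x)" for x
    define D' where "D' = D + (l + H * D)"
    have sub: "b' ` Z \<subseteq> b ` Z - {v}"
      using uv by (auto simp: b'_def)
    then have "card (b' ` Z) \<le> card (b ` Z - {v})"
      using assms(1) by (intro card_mono) auto
    also have "\<dots> = card (b ` Z) - 1" using uv assms(1) by simp
    finally have "card (b' ` Z) \<le> card (b ` Z) - 1" .
    moreover have "card (b ` Z) > 0" using uv assms(1) by (auto simp: card_gt_0_iff)
    ultimately have card: "card (b' ` Z) < card (b ` Z)" "Suc (card (b' ` Z)) \<le> card (b ` Z)" by auto
    show ?thesis
    proof (rule less.hyps[OF card(1)])
      show "b' x \<in> Z" if "x \<in> Z" for x using less.prems(1)[OF that] uvZ by (auto simp: b'_def)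
      show "b' x \<le> x \<and> x \<le> b' x + D'" if "x \<in> Z" for x
        using less.prems(2)[OF that] uv by (auto simp: b'_def D'_def)
      show "left (b' x) \<longleftrightarrow> left x" if "x \<in> Z" for x
        using less.prems(3)[OF that] same by (auto simp: b'_def)
      have "(H + 2) ^ card (b' ` Z) * (D' + l) \<le> (H + 2) ^ card (b' ` Z) * ((H + 2) * (D + l))"
        by (intro mult_left_mono) (auto simp: D'_def algebra_simps)
      also have "\<dots> = (H + 2) ^ Suc (card (b' ` Z)) * (D + l)" by (simp add: algebra_simps)
      also have "\<dots> \<le> (H + 2) ^ card (b ` Z) * (D + l)"
        using card(2) by (intro mult_right_mono power_increasing) auto
      also have "\<dots> \<le> m" by (rule less.prems(4))
      finally show "(H + 2) ^ card (b' ` Z) * (D' + l) \<le> m" .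
    qed
  qed
qed

lemma poly_times_geometric_tendsto_0:
  fixes \<theta> :: real
  assumes "0 < \<theta>" "\<theta> < 1"
  shows "(\<lambda>n. (1 + real n) ^ p * \<theta> ^ n) \<longlonglongrightarrow> 0"
proof (cases "p = 0")
    case True
    then show ?thesis using assms by (simp add: LIMSEQ_power_zero)
  next
    case False
    define \<tau> where "\<tau> = root p \<theta>"
    have \<tau>: "0 < \<tau>" "\<tau> < 1" "\<tau> ^ p = \<theta>" using False assms by (auto simp: \<tau>_def)
    have "(\<lambda>n. \<tau> ^ n + real n * \<tau> ^ n) \<longlonglongrightarrow> 0 + 0"
      using \<tau> by (intro tendsto_add LIMSEQ_power_zero powser_times_n_limit_0) auto
    then have "(\<lambda>n. (\<tau> ^ n + real n * \<tau> ^ n) ^ p) \<longlonglongrightarrow> 0 ^ p"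
      by (intro tendsto_power) simp
    moreover have "(\<tau> ^ n + real n * \<tau> ^ n) ^ p = (1 + real n) ^ p * \<theta> ^ n" for n
      by (simp add: \<tau>(3)[symmetric] power_mult_distrib[symmetric] algebra_simps flip: power_mult)
         (simp add: power_mult_distrib[symmetric] power_mult algebra_simps)
    ultimately show ?thesis using False by (simp add: zero_power)
  qed

lemma poly_times_geometric_bounded:
  fixes \<theta> :: real
  assumes "0 < \<theta>" "\<theta> < 1"
  obtains C where "C > 0" "\<And>n::nat. (1 + real n) ^ p * \<theta> ^ n \<le> C"
proof -
  obtain C where "C > 0" "\<And>n. norm ((1 + real n) ^ p * \<theta> ^ n) \<le> C"
    using poly_times_geometric_tendsto_0[OF assms, of p]
    by (meson Bseq_def convergentI convergent_imp_Bseq)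
  then show ?thesis using that[of C] by (auto simp: abs_le_iff)
qed

text \<open>
  The competition that decides the choice of the separation \<open>l + H D\<close>: half of the exponential decay
  absorbs the polynomial factor, and the other half, for large \<open>H\<close>, absorbs the growth \<open>K\<^bsup>p D\<^esup>\<close> and still
  leaves decay in \<open>l\<close>.
\<close>

lemma geometric_gain:
  fixes \<theta> K :: real and p :: nat
  assumes "0 < \<theta>" "\<theta> < 1" "1 \<le> K"
  obtains C \<rho> :: real and H :: nat where "C > 0" "0 < \<rho>" "\<rho> < 1"
    "\<And>l D :: nat. ((1 + real (l + H * D)) * K ^ D) ^ p * \<theta> ^ (l + H * D) \<le> C * \<rho> ^ l"
proof -
  define \<rho> where "\<rho> = sqrt \<theta>"
  have \<rho>: "0 < \<rho>" "\<rho> < 1" "\<theta> = \<rho> * \<rho>" using assms by (auto simp: \<rho>_def)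
  obtain C where C: "C > 0" "\<And>n::nat. (1 + real n) ^ p * \<rho> ^ n \<le> C"
    using poly_times_geometric_bounded[OF \<rho>(1,2), of p] by blast
  have Kp: "K ^ p > 0" using assms by simp
  obtain H where H: "\<rho> ^ H < 1 / K ^ p"
    using real_arch_pow_inv[of "1 / K ^ p" \<rho>] \<rho> Kp by auto
  have "((1 + real (l + H * D)) * K ^ D) ^ p * \<theta> ^ (l + H * D) \<le> C * \<rho> ^ l" for l D
  proof -
    have "((1 + real (l + H * D)) * K ^ D) ^ p * \<theta> ^ (l + H * D)
        = ((1 + real (l + H * D)) ^ p * \<rho> ^ (l + H * D)) * (\<rho> ^ l * (K ^ p * \<rho> ^ H) ^ D)"
      unfolding \<rho>(3) power_mult_distrib by (simp add: power_add flip: power_mult) (simp add: mult_ac)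
    also have "\<dots> \<le> C * (\<rho> ^ l * 1)"
    proof (intro mult_mono C(2))
      show "(K ^ p * \<rho> ^ H) ^ D \<le> 1"
        using H Kp \<rho> by (intro power_le_one) (auto simp: field_simps)
    qed (use C(1) \<rho> Kp in auto)
    finally show ?thesis by simp
  qed
  with C(1) \<rho> show ?thesis using that by blast
qed

context cone_mixing
begin

text \<open>
  The assumption \<open>approx\<close> is what the controlled tail property yields for the functions \<open>\<phi> \<circ> f\<^sup>s\<close>, whose
  norms may grow like \<open>K\<^sup>s\<close>. The loss \<open>K\<^sup>s\<close> would be fatal if \<open>s\<close> ranged over the actual times; relative
  to the first time of its cluster, \<open>s\<close> is at most the diameter \<open>D\<close>, and \<open>geometric_gain\<close> applies.
\<close>

lemma cov_orbit_decay:
  fixes r :: nat and K c :: real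
  assumes mom: "has_moments M \<phi>" and K: "1 \<le> K" and c: "1 \<le> c"
    and approx: "\<And>q::nat. 1 \<le> q \<Longrightarrow> \<exists>d>0. \<exists>\<theta>>0. \<theta> < 1 \<and> (\<forall>s T :: nat. \<exists>w.
      cspan (c * (1 + real T) * K ^ s) w \<and>
      (LINT x|M. \<bar>\<phi> ((f ^^ s) x) - w x\<bar> ^ q) \<le> (d * \<theta> ^ T * K ^ s) ^ q)"
  obtains C \<rho> :: real and \<Lambda> :: nat where "C > 0" "0 < \<rho>" "\<rho> < 1"
    "block_decorrelation \<phi> r C \<rho> \<Lambda>"
proof -
  define q where "q = max 1 r"
  have q: "1 \<le> q" "r \<le> q" by (auto simp: q_def)
  obtain C1 \<theta>1 :: real where C1: "C1 > 0" "0 < \<theta>1" "\<theta>1 < 1" and atoms: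
    "\<And>U W g G. finite U \<Longrightarrow> finite W \<Longrightarrow> U \<inter> W = {} \<Longrightarrow> card (U \<union> W) \<le> r \<Longrightarrow>
      (\<And>u. u \<in> U \<union> W \<Longrightarrow> g u \<in> B \<and> N (g u) \<le> 1) \<Longrightarrow>
      (\<And>u v. u \<in> U \<union> W \<Longrightarrow> v \<in> U \<union> W \<Longrightarrow> u < v \<Longrightarrow> u + G \<le> v) \<Longrightarrow>
      \<bar>cov M (orbit_prod U g) (orbit_prod W g)\<bar> \<le> C1 * \<theta>1 ^ G"
    by (rule cov_orbit_prod_atoms[of r]) blast
  obtain d \<theta>2 :: real where d: "d > 0" "0 < \<theta>2" "\<theta>2 < 1" and appr: "\<And>s T :: nat. \<exists>w.
      cspan (c * (1 + real T) * K ^ s) w \<and>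
      (LINT x|M. \<bar>\<phi> ((f ^^ s) x) - w x\<bar> ^ q) \<le> (d * \<theta>2 ^ T * K ^ s) ^ q"
    using approx[OF q(1)] by blast
  obtain Cm where Cm: "Cm \<ge> 1" and span_mul:
    "\<And>R S g h. cspan R g \<Longrightarrow> cspan S h \<Longrightarrow> cspan (Cm * R * S) (\<lambda>x. g x * h x)"
    by (rule span_mult) blast
  define \<theta> where "\<theta> = max \<theta>1 \<theta>2"
  have \<theta>: "0 < \<theta>" "\<theta> < 1" "\<theta>1 \<le> \<theta>" "\<theta>2 \<le> \<theta>" using C1 d by (auto simp: \<theta>_def)
  define p where "p = q * q + 2 * q + 1"
  obtain C3 \<rho> :: real and H :: nat where C3: "C3 > 0" "0 < \<rho>" "\<rho> < 1" and gain:
    "\<And>l D :: nat. ((1 + real (l + H * D)) * K ^ D) ^ p * \<theta> ^ (l + H * D) \<le> C3 * \<rho> ^ l"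
    using geometric_gain[OF \<theta>(1,2) K, of p] by blast
  define B0 where "B0 = (LINT x|M. \<bar>\<phi> x\<bar> ^ q)"
  have B0: "0 \<le> B0" by (simp add: B0_def)
  define c1 where "c1 = real q * d * (2 + real q * B0 + real q)"
  define c2 where "c2 = C1 * Cm ^ (q * q) + (3 + real q * B0 + real q) * c1"
  have c1: "c1 \<ge> 0" using d B0 by (simp add: c1_def)
  have c2: "c2 > 0" using C1 Cm c1 B0 by (auto simp: c2_def intro!: add_pos_nonneg)
  define \<Lambda> where "\<Lambda> = (H + 1) * (H + 2) ^ q"
  have main: "\<bar>cov M (\<lambda>x. \<Prod>i\<in>I. \<phi> ((f ^^ k i) x)) (\<lambda>x. \<Prod>j\<in>J. \<phi> ((f ^^ k j) x))\<bar>
      \<le> c2 * c ^ p * C3 * \<rho> ^ l"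
    if l: "1 \<le> l" and fin: "finite I" "finite J" and disj: "I \<inter> J = {}" and card: "card (I \<union> J) \<le> r"
      and sep: "\<And>i j. i \<in> I \<Longrightarrow> j \<in> J \<Longrightarrow> k i + \<Lambda> * l \<le> k j" for l I J and k :: "nat \<Rightarrow> nat"
  proof -
    define Z where "Z = k ` (I \<union> J)"
    define left where "left x \<longleftrightarrow> x \<in> k ` I" for x
    have finZ: "finite Z" using fin by (simp add: Z_def)
    have cardZ: "card Z \<le> q"
      using card card_image_le[of "I \<union> J" k] fin q by (auto simp: Z_def)
    have "0 < \<Lambda>" unfolding \<Lambda>_def by simp
    then have \<Lambda>l: "\<Lambda> * l \<ge> 1" using l mult_le_mono[of 1 \<Lambda> 1 l] by simp
    have left: "left (k i)" if "i \<in> I" for i using that by (simp add: left_def)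
    have right: "\<not> left (k j)" if "j \<in> J" for j
    proof
      assume "left (k j)"
      then obtain i where "i \<in> I" "k j = k i" by (auto simp: left_def)
      then show False using sep[OF _ that, of i] \<Lambda>l by linarith
    qed
    have "\<exists>D' b'. D' + l \<le> (H + 2) ^ q * l \<and>
        (\<forall>x\<in>Z. b' x \<in> Z \<and> b' x \<le> x \<and> x \<le> b' x + D' \<and> (left (b' x) \<longleftrightarrow> left x)) \<and>
        (\<forall>u\<in>b' ` Z. \<forall>v\<in>b' ` Z. u < v \<longrightarrow> u + (l + H * D') \<le> v)"
    proof (rule orbit_clustering[where b = "\<lambda>x. x" and D = 0])
      show "(H + 2) ^ card ((\<lambda>x. x) ` Z) * (0 + l) \<le> (H + 2) ^ q * l"
        using cardZ by (auto intro!: power_increasing)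
      fix u v assume uv: "u \<in> Z" "v \<in> Z" "u < v" "left u \<noteq> left v"
      have "left u"
      proof (rule ccontr)
        assume "\<not> left u"
        then obtain i j where "i \<in> I" "j \<in> J" "v = k i" "u = k j"
          using uv left by (auto simp: Z_def left_def)
        then show False using sep[of i j] uv by auto
      qed
      then obtain i j where "i \<in> I" "j \<in> J" "u = k i" "v = k j"
        using uv left by (auto simp: Z_def left_def)
      then show "u + (H + 1) * ((H + 2) ^ q * l) \<le> v"
        using sep[of i j] by (simp add: \<Lambda>_def algebra_simps)
    qed (use finZ in auto)
    then obtain D b where
      "\<forall>x\<in>Z. b x \<in> Z \<and> b x \<le> x \<and> x \<le> b x + D \<and> (left (b x) \<longleftrightarrow> left x)"
      "\<forall>u\<in>b ` Z. \<forall>v\<in>b ` Z. u < v \<longrightarrow> u + (l + H * D) \<le> v"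
      by (elim exE conjE) (rule that)
    then have bZ: "\<And>x. x \<in> Z \<Longrightarrow> b x \<in> Z \<and> b x \<le> x \<and> x \<le> b x + D \<and> (left (b x) \<longleftrightarrow> left x)"
      and gap: "\<And>u v. u \<in> b ` Z \<Longrightarrow> v \<in> b ` Z \<Longrightarrow> u < v \<Longrightarrow> u + (l + H * D) \<le> v"
      by blast+
    \<comment> \<open>The truncation level is the separation of the clusters, so both errors decay at this rate.\<close>
    define T where "T = l + H * D"
    define z where "z = c * (1 + real T) * K ^ D"
    have KD: "1 \<le> K ^ D" using K by simp
    have "1 * 1 \<le> c * (1 + real T)" using c by (intro mult_mono) auto
    then have z: "1 \<le> z" "K ^ D \<le> z"
      using KD mult_mono[of 1 "c * (1 + real T)" 1 "K ^ D"] mult_mono[of 1 "c * (1 + real T)" "K ^ D" "K ^ D"]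
      by (auto simp: z_def)
    define \<beta> where "\<beta> i = b (k i)" for i
    have \<beta>: "\<beta> i \<le> k i" "k i - \<beta> i \<le> D" if "i \<in> I \<union> J" for i
      using bZ[of "k i"] that by (auto simp: Z_def \<beta>_def)
    have \<beta>left: "left (\<beta> i)" if "i \<in> I" for i
      using bZ[of "k i"] left that by (auto simp: Z_def \<beta>_def)
    have \<beta>right: "\<not> left (\<beta> i)" if "i \<in> J" for i
      using bZ[of "k i"] right that by (auto simp: Z_def \<beta>_def)
    have \<beta>ne: "\<beta> i \<noteq> \<beta> j" if "i \<in> I" "j \<in> J" for i j
      using \<beta>left[OF that(1)] \<beta>right[OF that(2)] by metis
    define U where "U = \<beta> ` I"
    define W where "W = \<beta> ` J"
    have UW: "finite U" "finite W" "U \<inter> W = {}" "U \<union> W = b ` Z"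
      using fin \<beta>ne by (auto simp: U_def W_def Z_def image_Un image_image \<beta>_def[abs_def])
    have cardUW: "card (U \<union> W) \<le> r"
      using card card_image_le[of "I \<union> J" \<beta>] fin by (simp add: U_def W_def image_Un)
    have "\<exists>w. \<forall>s. cspan (c * (1 + real T) * K ^ s) (w s) \<and>
        (LINT x|M. \<bar>\<phi> ((f ^^ s) x) - w s x\<bar> ^ q) \<le> (d * \<theta>2 ^ T * K ^ s) ^ q"
      by (rule choice) (intro allI appr)
    then obtain w where w: "\<And>s. cspan (c * (1 + real T) * K ^ s) (w s)"
      "\<And>s. (LINT x|M. \<bar>\<phi> ((f ^^ s) x) - w s x\<bar> ^ q) \<le> (d * \<theta>2 ^ T * K ^ s) ^ q"
      by blast
    have wz: "cspan z (w s)" if "s \<le> D" for s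
    proof (rule cone_span.weaken[OF w(1)])
      show "c * (1 + real T) * K ^ s \<le> z"
        unfolding z_def using c K that by (intro mult_left_mono power_increasing) auto
    qed
    \<comment> \<open>Factor \<open>i\<close> and its truncation, which is done at the first time \<open>\<beta> i\<close> of the cluster;
      \<open>h u\<close> is the product of the truncated factors in the cluster that starts at \<open>u\<close>.\<close>
    define a where "a i x = \<phi> ((f ^^ k i) x)" for i x
    define a' where "a' i x = w (k i - \<beta> i) ((f ^^ \<beta> i) x)" for i x
    define h where "h u x = (\<Prod>i\<in>{i \<in> I \<union> J. \<beta> i = u}. w (k i - u) x)" for u x
    have moma: "has_moments M (a i)" for i
      unfolding a_def using mom by (rule has_moments_funpow)
    have mom_w: "has_moments M (w s)" for s
      using span_has_moments[OF w(1)] .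
    have moma': "has_moments M (a' i)" for i
      unfolding a'_def using mom_w by (rule has_moments_funpow)
    define \<eta> where "\<eta> = d * \<theta>2 ^ T * K ^ D"
    have \<eta>: "\<eta> > 0" using d K by (simp add: \<eta>_def)
    have Ea: "(LINT x|M. \<bar>a i x\<bar> ^ q) \<le> B0" for i
    proof -
      have "(LINT x|M. \<bar>\<phi> ((f ^^ k i) x)\<bar> ^ q) = B0"
        unfolding B0_def using has_moments_measurable[OF mom]
        by (intro integral_funpow[of "\<lambda>x. \<bar>\<phi> x\<bar> ^ q"]) measurable
      then show ?thesis by (simp add: a_def)
    qed
    have Ea': "(LINT x|M. \<bar>a' i x\<bar> ^ q) \<le> z ^ q" if "i \<in> I \<union> J" for i
    proof -
      have "(LINT x|M. \<bar>a' i x\<bar> ^ q) \<le> (LINT x|M. z ^ q)"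
        using span_bound[OF wz[OF \<beta>(2)[OF that]] funpow_space]
        by (intro integral_mono has_moments_integrable_abs[OF moma'] power_mono) (auto simp: a'_def)
      then show ?thesis by (simp add: prob_space)
    qed
    have Ed: "(LINT x|M. \<bar>a i x - a' i x\<bar> ^ q) \<le> \<eta> ^ q" if i: "i \<in> I \<union> J" for i
    proof -
      let ?s = "k i - \<beta> i"
      have "(LINT x|M. \<bar>a i x - a' i x\<bar> ^ q)
          = (LINT x|M. (\<lambda>y. \<bar>\<phi> ((f ^^ ?s) y) - w ?s y\<bar> ^ q) ((f ^^ \<beta> i) x))"
        using \<beta>(1)[OF i] by (intro arg_cong[where f="integral\<^sup>L M"] ext)
          (simp add: a_def a'_def flip: comp_apply[of "f ^^ _" "f ^^ _"] funpow_add)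
      also have "\<dots> = (LINT x|M. \<bar>\<phi> ((f ^^ ?s) x) - w ?s x\<bar> ^ q)"
        using has_moments_measurable[OF mom_w[of ?s]] has_moments_measurable[OF has_moments_funpow[OF mom, of ?s]]
        by (intro integral_funpow) measurable
      also have "\<dots> \<le> (d * \<theta>2 ^ T * K ^ ?s) ^ q" by (rule w(2))
      also have "\<dots> \<le> \<eta> ^ q"
        unfolding \<eta>_def using d K \<beta>(2)[OF i] by (intro power_mono mult_left_mono power_increasing) auto
      finally show ?thesis .
    qed
    \<comment> \<open>The error of replacing every factor by its truncation, in any of the three products that
      occur in the covariance.\<close>
    define \<delta> where "\<delta> = real q * (\<eta> * (2 + real q * (B0 + z ^ q)))"
    have zq: "1 \<le> z ^ q" using z by simp
    have \<delta>0: "0 \<le> \<delta>" using \<eta> B0 zq by (simp add: \<delta>_def)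
    have diff: "\<bar>(LINT x|M. (\<Prod>i\<in>P. a i x)) - (LINT x|M. (\<Prod>i\<in>P. a' i x))\<bar> \<le> \<delta>"
      and Pa: "\<bar>LINT x|M. (\<Prod>i\<in>P. a i x)\<bar> \<le> 1 + real q * B0"
      and Pa': "\<bar>LINT x|M. (\<Prod>i\<in>P. a' i x)\<bar> \<le> 1 + real q * z ^ q"
      if P: "P \<subseteq> I \<union> J" for P
    proof -
      have finP: "finite P" using P fin by (meson finite_Un finite_subset)
      have cardP: "card P \<le> q" using card_mono[OF _ P] fin card q by auto
      have "\<bar>(LINT x|M. (\<Prod>i\<in>P. a i x)) - (LINT x|M. (\<Prod>i\<in>P. a' i x))\<bar>
          \<le> real (card P) * (\<eta> * (2 + real (card P) * (B0 + z ^ q)))"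
        using P by (intro expectation_prod_diff_le[where q = q] finP cardP moma moma' Ea Ea' Ed \<eta>) auto
      also have "\<dots> \<le> \<delta>"
        unfolding \<delta>_def using cardP \<eta> B0 zq
        by (intro mult_mono add_mono order_refl) auto
      finally show "\<bar>(LINT x|M. (\<Prod>i\<in>P. a i x)) - (LINT x|M. (\<Prod>i\<in>P. a' i x))\<bar> \<le> \<delta>" .
      have "\<bar>LINT x|M. (\<Prod>i\<in>P. a i x)\<bar> \<le> 1 + real (card P) * B0"
        by (intro abs_expectation_prod_le[where q = q] finP cardP moma Ea)
      also have "\<dots> \<le> 1 + real q * B0" using cardP B0 by (intro add_mono mult_right_mono) auto
      finally show "\<bar>LINT x|M. (\<Prod>i\<in>P. a i x)\<bar> \<le> 1 + real q * B0" .
      have "\<bar>LINT x|M. (\<Prod>i\<in>P. a' i x)\<bar> \<le> 1 + real (card P) * z ^ q"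
        using P by (intro abs_expectation_prod_le[where q = q] finP cardP moma' Ea') auto
      also have "\<dots> \<le> 1 + real q * z ^ q" using cardP zq by (intro add_mono mult_right_mono) auto
      finally show "\<bar>LINT x|M. (\<Prod>i\<in>P. a' i x)\<bar> \<le> 1 + real q * z ^ q" .
    qed
    let ?A = "\<lambda>x. \<Prod>i\<in>I. a i x" and ?B = "\<lambda>x. \<Prod>i\<in>J. a i x"
    let ?A' = "\<lambda>x. \<Prod>i\<in>I. a' i x" and ?B' = "\<lambda>x. \<Prod>i\<in>J. a' i x"
    have group: "(\<Prod>i\<in>P. a' i x) = orbit_prod (\<beta> ` P) h x"
      if P: "finite P" "\<And>u. u \<in> \<beta> ` P \<Longrightarrow> {i \<in> P. \<beta> i = u} = {i \<in> I \<union> J. \<beta> i = u}" for P x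
    proof -
      have "(\<Prod>i\<in>P. a' i x) = (\<Prod>u\<in>\<beta> ` P. \<Prod>i\<in>{i \<in> P. \<beta> i = u}. a' i x)"
        by (rule prod.image_gen[OF P(1)])
      also have "\<dots> = (\<Prod>u\<in>\<beta> ` P. \<Prod>i\<in>{i \<in> I \<union> J. \<beta> i = u}. a' i x)"
        using P(2) by (intro prod.cong) auto
      also have "\<dots> = orbit_prod (\<beta> ` P) h x"
        unfolding orbit_prod_def h_def a'_def by (intro prod.cong) auto
      finally show ?thesis .
    qed
    have A'h: "?A' = orbit_prod U h" and B'h: "?B' = orbit_prod W h"
      using fin \<beta>ne unfolding U_def W_def by (auto intro!: ext group) metis+
    have cov': "\<bar>cov M ?A' ?B'\<bar> \<le> ((Cm * z) ^ q) ^ q * (C1 * \<theta>1 ^ T)"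
    proof -
      have Cz: "1 \<le> Cm * z" using Cm z mult_mono[of 1 Cm 1 z] by auto
      have span_h: "cspan ((Cm * z) ^ q) (h u)" if u: "u \<in> U \<union> W" for u
      proof -
        let ?F = "{i \<in> I \<union> J. \<beta> i = u}"
        have "cspan ((Cm * z) ^ card ?F) (\<lambda>x. \<Prod>i\<in>?F. w (k i - u) x)"
          using u fin \<beta>(2) by (intro span_prod[OF span_mul Cm] wz) (auto simp: U_def W_def)
        moreover have "card ?F \<le> card (I \<union> J)" using fin by (intro card_mono) auto
        then have "card ?F \<le> q" using card q by linarith
        ultimately show ?thesis
          unfolding h_def[abs_def] using Cz by (auto intro: cone_span.weaken power_increasing)
      qed
      have "\<bar>cov M (orbit_prod U h) (orbit_prod W h)\<bar> \<le> ((Cm * z) ^ q) ^ card (U \<union> W) * (C1 * \<theta>1 ^ T)"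
        using UW cardUW gap span_h Cz C1 finZ
        by (intro cov_orbit_prod_span atoms) (auto simp: T_def)
      also have "\<dots> \<le> ((Cm * z) ^ q) ^ q * (C1 * \<theta>1 ^ T)"
        using Cz C1 cardUW q by (intro mult_right_mono power_increasing) auto
      finally show ?thesis unfolding A'h B'h .
    qed
    have EAB: "(LINT x|M. ?A x * ?B x) = (LINT x|M. (\<Prod>i\<in>I \<union> J. a i x))"
      and EAB': "(LINT x|M. ?A' x * ?B' x) = (LINT x|M. (\<Prod>i\<in>I \<union> J. a' i x))"
      using fin disj by (simp_all add: prod.union_disjoint)
    have "\<bar>cov M ?A ?B - cov M ?A' ?B'\<bar>
        = \<bar>((LINT x|M. ?A x * ?B x) - (LINT x|M. ?A' x * ?B' x))
          - ((LINT x|M. ?A x) - (LINT x|M. ?A' x)) * (LINT x|M. ?B x)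
          - (LINT x|M. ?A' x) * ((LINT x|M. ?B x) - (LINT x|M. ?B' x))\<bar>"
      by (simp add: cov_def algebra_simps)
    also have "\<dots> \<le> \<bar>(LINT x|M. ?A x * ?B x) - (LINT x|M. ?A' x * ?B' x)\<bar>
        + \<bar>(LINT x|M. ?A x) - (LINT x|M. ?A' x)\<bar> * \<bar>LINT x|M. ?B x\<bar>
        + \<bar>LINT x|M. ?A' x\<bar> * \<bar>(LINT x|M. ?B x) - (LINT x|M. ?B' x)\<bar>"
      unfolding abs_mult[symmetric] by linarith
    also have "\<dots> \<le> \<delta> + \<delta> * (1 + real q * B0) + (1 + real q * z ^ q) * \<delta>"
      unfolding EAB EAB' using \<delta>0 B0 zq
      by (intro add_mono mult_mono diff Pa Pa') auto
    also have "\<dots> = (3 + real q * B0 + real q * z ^ q) * \<delta>" by (simp add: algebra_simps)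
    also have "\<dots> \<le> ((3 + real q * B0 + real q) * z ^ q) * (c1 * (\<theta> ^ T * z ^ (q + 1)))"
    proof (intro mult_mono)
      have "(3 + real q * B0) * 1 \<le> (3 + real q * B0) * z ^ q"
        using B0 zq by (intro mult_left_mono) auto
      then show "3 + real q * B0 + real q * z ^ q \<le> (3 + real q * B0 + real q) * z ^ q"
        by (simp add: algebra_simps)
      have "\<eta> \<le> d * \<theta> ^ T * z"
        unfolding \<eta>_def using d \<theta> z KD by (intro mult_mono power_mono) auto
      moreover have "(2 + real q * B0) * 1 \<le> (2 + real q * B0) * z ^ q"
        using B0 zq by (intro mult_left_mono) auto
      then have "2 + real q * (B0 + z ^ q) \<le> (2 + real q * B0 + real q) * z ^ q"
        by (simp add: algebra_simps)
      ultimately have "\<delta> \<le> real q * ((d * \<theta> ^ T * z) * ((2 + real q * B0 + real q) * z ^ q))"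
        unfolding \<delta>_def using \<eta> B0 zq d \<theta> z by (intro mult_left_mono mult_mono) auto
      then show "\<delta> \<le> c1 * (\<theta> ^ T * z ^ (q + 1))"
        by (simp add: c1_def mult_ac)
    qed (use B0 zq \<delta>0 in auto)
    finally have cov_diff: "\<bar>cov M ?A ?B - cov M ?A' ?B'\<bar>
      \<le> ((3 + real q * B0 + real q) * c1) * (z ^ (2 * q + 1) * \<theta> ^ T)"
      by (simp add: power_add power2_eq_square mult_ac power_mult)
    have "\<bar>cov M ?A' ?B'\<bar> \<le> (C1 * Cm ^ (q * q)) * (z ^ (q * q) * \<theta> ^ T)"
    proof -
      have "((Cm * z) ^ q) ^ q * (C1 * \<theta>1 ^ T) \<le> ((Cm * z) ^ q) ^ q * (C1 * \<theta> ^ T)"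
        using C1 Cm z \<theta> by (intro mult_left_mono power_mono) auto
      with cov' show ?thesis
        by (simp add: power_mult_distrib power_mult mult_ac)
    qed
    also have "\<dots> \<le> (C1 * Cm ^ (q * q)) * (z ^ p * \<theta> ^ T)"
      using C1 Cm z \<theta> by (intro mult_left_mono mult_right_mono power_increasing) (auto simp: p_def)
    finally have 1: "\<bar>cov M ?A' ?B'\<bar> \<le> (C1 * Cm ^ (q * q)) * (z ^ p * \<theta> ^ T)" .
    have 2: "\<bar>cov M ?A ?B - cov M ?A' ?B'\<bar> \<le> ((3 + real q * B0 + real q) * c1) * (z ^ p * \<theta> ^ T)"
      using cov_diff by (rule order_trans)
        (use B0 c1 z \<theta> in \<open>intro mult_left_mono mult_right_mono power_increasing; simp add: p_def\<close>)
    have "\<bar>cov M ?A ?B\<bar> \<le> c2 * (z ^ p * \<theta> ^ T)"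
      using 1 2 unfolding c2_def distrib_right by linarith
    also have "z ^ p * \<theta> ^ T = c ^ p * (((1 + real T) * K ^ D) ^ p * \<theta> ^ T)"
      unfolding z_def by (simp add: power_mult_distrib mult_ac)
    also have "c2 * (c ^ p * (((1 + real T) * K ^ D) ^ p * \<theta> ^ T)) \<le> c2 * (c ^ p * (C3 * \<rho> ^ l))"
      using c2 c unfolding T_def by (intro mult_left_mono gain) auto
    finally show ?thesis
      unfolding a_def by (simp add: mult.assoc)
  qed
  show ?thesis
  proof (rule that)
    show "block_decorrelation \<phi> r (c2 * c ^ p * C3) \<rho> \<Lambda>"
      unfolding block_decorrelation_def by (intro allI impI main) auto
  qed (use c2 c C3 in auto)
qed

end

section \<open>Birkhoff sums of decorrelated observables\<close>

lemma abs_add_power_diff_le: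
  "\<bar>(y + w) ^ r - y ^ r\<bar> \<le> (\<bar>y\<bar> + \<bar>w\<bar>) ^ r - \<bar>y\<bar> ^ r" for y w :: real
proof (induction r)
  case (Suc r)
  have "\<bar>(y + w) ^ Suc r - y ^ Suc r\<bar> = \<bar>(y + w) * ((y + w) ^ r - y ^ r) + w * y ^ r\<bar>"
    by (simp add: algebra_simps)
  also have "\<dots> \<le> \<bar>y + w\<bar> * \<bar>(y + w) ^ r - y ^ r\<bar> + \<bar>w\<bar> * \<bar>y\<bar> ^ r"
    by (metis abs_mult abs_triangle_ineq power_abs)
  also have "\<dots> \<le> (\<bar>y\<bar> + \<bar>w\<bar>) * ((\<bar>y\<bar> + \<bar>w\<bar>) ^ r - \<bar>y\<bar> ^ r) + \<bar>w\<bar> * \<bar>y\<bar> ^ r"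
    using Suc by (intro add_mono mult_mono) auto
  also have "\<dots> = (\<bar>y\<bar> + \<bar>w\<bar>) ^ Suc r - \<bar>y\<bar> ^ Suc r"
    by (simp add: algebra_simps)
  finally show ?case .
qed simp

text \<open>
  Distinguish whether \<open>\<bar>w\<bar>\<close> is smaller than a fixed small multiple of \<open>\<bar>y\<bar>\<close>. In this form the two terms can
  be integrated separately, without Minkowski's inequality.
\<close>

lemma perturbed_power_le:
  fixes \<epsilon> :: real
  assumes "\<epsilon> > 0"
  obtains C where "C \<ge> 0" "\<And>y w :: real. \<bar>(y + w) ^ r - y ^ r\<bar> \<le> \<epsilon> * \<bar>y\<bar> ^ r + C * \<bar>w\<bar> ^ r"
proof -
  \<comment> \<open>This choice makes \<open>(1 + \<delta>)\<^sup>r \<le> 1 + \<epsilon>\<close>.\<close>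
  define \<delta> where "\<delta> = min 1 (\<epsilon> / 2 ^ r)"
  have \<delta>: "0 < \<delta>" "\<delta> \<le> 1" "\<delta> * 2 ^ r \<le> \<epsilon>"
    using assms by (auto simp: \<delta>_def min_def field_simps)
  have "(1 + \<delta>) ^ r \<le> 1 + \<delta> * (2 ^ r - 1)"
  proof (induction r)
    case (Suc r)
    have "(1 + \<delta>) ^ Suc r \<le> (1 + \<delta>) * (1 + \<delta> * (2 ^ r - 1))"
      using Suc \<delta> by simp
    also have "\<dots> = 1 + \<delta> + (1 + \<delta>) * (\<delta> * (2 ^ r - 1))" by (simp add: algebra_simps)
    also have "\<dots> \<le> 1 + \<delta> + 2 * (\<delta> * (2 ^ r - 1))"
      using \<delta> by (intro add_left_mono mult_right_mono) auto
    also have "\<dots> = 1 + \<delta> * (2 ^ Suc r - 1)" by (simp add: algebra_simps)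
    finally show ?case .
  qed simp
  also have "\<dots> \<le> 1 + \<epsilon>" using \<delta> by (simp add: algebra_simps)
  finally have pow: "(1 + \<delta>) ^ r \<le> 1 + \<epsilon>" .
  have "\<bar>(y + w) ^ r - y ^ r\<bar> \<le> \<epsilon> * \<bar>y\<bar> ^ r + (1 / \<delta> + 1) ^ r * \<bar>w\<bar> ^ r" for y w :: real
  proof (cases "\<bar>w\<bar> \<le> \<delta> * \<bar>y\<bar>")
    case True
    have "(\<bar>y\<bar> + \<bar>w\<bar>) ^ r \<le> ((1 + \<delta>) * \<bar>y\<bar>) ^ r"
      using True by (intro power_mono) (auto simp: algebra_simps)
    also have "\<dots> \<le> (1 + \<epsilon>) * \<bar>y\<bar> ^ r"
      using pow by (simp add: power_mult_distrib mult_right_mono)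
    finally have "(\<bar>y\<bar> + \<bar>w\<bar>) ^ r - \<bar>y\<bar> ^ r \<le> \<epsilon> * \<bar>y\<bar> ^ r" by (simp add: algebra_simps)
    moreover have "0 \<le> (1 / \<delta> + 1) ^ r * \<bar>w\<bar> ^ r" using \<delta> by simp
    ultimately show ?thesis using abs_add_power_diff_le[of y w r] by linarith
  next
    case False
    have "(\<bar>y\<bar> + \<bar>w\<bar>) ^ r \<le> ((1 / \<delta> + 1) * \<bar>w\<bar>) ^ r"
      using False \<delta> by (intro power_mono) (auto simp: field_simps)
    then have "(\<bar>y\<bar> + \<bar>w\<bar>) ^ r \<le> (1 / \<delta> + 1) ^ r * \<bar>w\<bar> ^ r" by (simp add: power_mult_distrib)
    moreover have "0 \<le> \<bar>y\<bar> ^ r" "0 \<le> \<epsilon> * \<bar>y\<bar> ^ r" using assms by auto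
    ultimately show ?thesis using abs_add_power_diff_le[of y w r] by linarith
  qed
  moreover have "(1 / \<delta> + 1) ^ r \<ge> 0" using \<delta> by simp
  ultimately show ?thesis using that by blast
qed

lemma abs_sum_power_le:
  fixes x :: "nat \<Rightarrow> real"
  assumes "0 < r"
  shows "\<bar>\<Sum>i<g. x i\<bar> ^ r \<le> real g ^ r * (\<Sum>i<g. \<bar>x i\<bar> ^ r)"
proof (cases "g = 0")
  case True
  then show ?thesis using assms by (simp add: zero_power)
next
  case False
  define y where "y = Max ((\<lambda>i. \<bar>x i\<bar>) ` {..<g})"
  have y: "\<bar>x i\<bar> \<le> y" if "i < g" for i
    using that by (auto simp: y_def)
  have "y \<in> (\<lambda>i. \<bar>x i\<bar>) ` {..<g}"
    unfolding y_def using False by (intro Max_in) (auto simp: lessThan_empty_iff)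
  then obtain j where j: "j < g" "y = \<bar>x j\<bar>" by auto
  have "\<bar>\<Sum>i<g. x i\<bar> \<le> (\<Sum>i<g. \<bar>x i\<bar>)" by (rule sum_abs)
  also have "\<dots> \<le> real g * y"
    using sum_bounded_above[of "{..<g}" "\<lambda>i. \<bar>x i\<bar>" y] y by simp
  finally have "\<bar>\<Sum>i<g. x i\<bar> ^ r \<le> (real g * y) ^ r"
    by (intro power_mono) auto
  also have "\<dots> = real g ^ r * \<bar>x j\<bar> ^ r" using j by (simp add: power_mult_distrib)
  also have "\<dots> \<le> real g ^ r * (\<Sum>i<g. \<bar>x i\<bar> ^ r)"
    using j by (intro mult_left_mono member_le_sum) auto
  finally show ?thesis .
qed

lemma birkhoff_sum_add:
  "birkhoff_sum f X (m + n) x = birkhoff_sum f X m x + birkhoff_sum f X n ((f ^^ m) x)"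
proof (induction n)
  case (Suc n)
  have "(f ^^ (m + n)) x = (f ^^ n) ((f ^^ m) x)"
    by (metis add.commute comp_apply funpow_add)
  then show ?case using Suc by (simp add: birkhoff_sum_def)
qed (simp add: birkhoff_sum_def)

context invariant_map
begin

lemma birkhoff_sum_has_moments:
  "has_moments M X \<Longrightarrow> has_moments M (birkhoff_sum f X n)"
  unfolding birkhoff_sum_def[abs_def] by (intro has_moments_sum has_moments_funpow)

text \<open>
  Expanding the powers gives \<open>n\<^bsup>a+b\<^esup>\<close> pairs of products. This polynomial loss is harmless, since the
  exponential factor is later made smaller than any power of \<open>n\<close>.
\<close>

lemma cov_birkhoff_powers:
  fixes C \<rho> :: real
  assumes mom: "has_moments M \<phi>"
    and decay: "block_decorrelation \<phi> r C \<rho> \<Lambda>"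
    and ab: "a + b \<le> r" and l: "1 \<le> l" "\<Lambda> * l \<le> g"
  shows "\<bar>cov M (\<lambda>x. birkhoff_sum f \<phi> n x ^ a) (\<lambda>x. birkhoff_sum f \<phi> n ((f ^^ (n + g)) x) ^ b)\<bar>
    \<le> C * \<rho> ^ l * (real n ^ a * real n ^ b)"
proof -
  let ?P = "{..<a} \<rightarrow>\<^sub>E {..<n}" and ?Q = "{a..<a + b} \<rightarrow>\<^sub>E {..<n}"
  have L: "birkhoff_sum f \<phi> n x ^ a = (\<Sum>k\<in>?P. 1 * (\<Prod>i\<in>{..<a}. \<phi> ((f ^^ k i) x)))" for x
  proof -
    have "birkhoff_sum f \<phi> n x ^ a = (\<Prod>i\<in>{..<a}. \<Sum>k<n. \<phi> ((f ^^ k) x))"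
      by (simp add: birkhoff_sum_def)
    also have "\<dots> = (\<Sum>k\<in>?P. \<Prod>i\<in>{..<a}. \<phi> ((f ^^ k i) x))"
      by (rule prod_sum_PiE) auto
    finally show ?thesis by simp
  qed
  have R: "birkhoff_sum f \<phi> n ((f ^^ (n + g)) x) ^ b
      = (\<Sum>k\<in>?Q. 1 * (\<Prod>i\<in>{a..<a + b}. \<phi> ((f ^^ (k i + (n + g))) x)))" for x
  proof -
    have "birkhoff_sum f \<phi> n ((f ^^ (n + g)) x) ^ b
        = (\<Prod>i\<in>{a..<a + b}. \<Sum>k<n. \<phi> ((f ^^ (k + (n + g))) x))"
      by (simp add: birkhoff_sum_def funpow_add)
    also have "\<dots> = (\<Sum>k\<in>?Q. \<Prod>i\<in>{a..<a + b}. \<phi> ((f ^^ (k i + (n + g))) x))"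
      by (rule prod_sum_PiE) auto
    finally show ?thesis by simp
  qed
  have "\<bar>cov M (\<lambda>x. \<Sum>k\<in>?P. 1 * (\<Prod>i\<in>{..<a}. \<phi> ((f ^^ k i) x)))
      (\<lambda>x. \<Sum>k\<in>?Q. 1 * (\<Prod>i\<in>{a..<a + b}. \<phi> ((f ^^ (k i + (n + g))) x)))\<bar>
    \<le> C * \<rho> ^ l * ((\<Sum>k\<in>?P. \<bar>1\<bar> * 1) * (\<Sum>k\<in>?Q. \<bar>1\<bar> * 1))"
  proof (rule abs_cov_sum_le)
    fix k k' assume k: "k \<in> ?P" and k': "k' \<in> ?Q"
    define kk where "kk i = (if i < a then k i else k' i + (n + g))" for i
    have "\<bar>cov M (\<lambda>x. \<Prod>i\<in>{..<a}. \<phi> ((f ^^ kk i) x)) (\<lambda>x. \<Prod>j\<in>{a..<a + b}. \<phi> ((f ^^ kk j) x))\<bar> \<le> C * \<rho> ^ l"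
    proof (rule decay[unfolded block_decorrelation_def, rule_format])
      fix i j assume "i \<in> {..<a}" "j \<in> {a..<a + b}"
      moreover from this have "k i < n" using k by (auto simp: PiE_iff)
      ultimately show "kk i + \<Lambda> * l \<le> kk j" using l by (simp add: kk_def)
    qed (use ab l in \<open>auto simp: ivl_disj_un\<close>)
    also have "(\<lambda>x. \<Prod>i\<in>{..<a}. \<phi> ((f ^^ kk i) x)) = (\<lambda>x. \<Prod>i\<in>{..<a}. \<phi> ((f ^^ k i) x))"
      by (intro ext prod.cong) (auto simp: kk_def)
    also have "(\<lambda>x. \<Prod>j\<in>{a..<a + b}. \<phi> ((f ^^ kk j) x)) = (\<lambda>x. \<Prod>j\<in>{a..<a + b}. \<phi> ((f ^^ (k' j + (n + g))) x))"
      by (intro ext prod.cong) (auto simp: kk_def)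
    finally show "\<bar>cov M (\<lambda>x. \<Prod>i\<in>{..<a}. \<phi> ((f ^^ k i) x))
      (\<lambda>x. \<Prod>i\<in>{a..<a + b}. \<phi> ((f ^^ (k' i + (n + g))) x))\<bar> \<le> C * \<rho> ^ l * (1 * 1)" by simp
  qed (intro has_moments_prod has_moments_funpow mom)+
  also have "(\<Sum>k\<in>?P. \<bar>1\<bar> * 1) * (\<Sum>k\<in>?Q. \<bar>1\<bar> * 1) = real n ^ a * real n ^ b"
    by (simp add: card_PiE)
  finally show ?thesis unfolding L R .
qed

text \<open>
  Subtracting a constant only mixes lower powers by the binomial theorem; constants do not contribute
  to covariances. This avoids enlarging the function spaces by constants.
\<close>

lemma cov_centered_birkhoff_powers:
  fixes C \<rho> m :: real
  assumes mom: "has_moments M \<phi>"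
    and decay: "block_decorrelation \<phi> r C \<rho> \<Lambda>"
    and ab: "a + b \<le> r" and l: "1 \<le> l" "\<Lambda> * l \<le> g"
  defines "X \<equiv> \<lambda>x. \<phi> x - m"
  shows "\<bar>cov M (\<lambda>x. birkhoff_sum f X n x ^ a) (\<lambda>x. birkhoff_sum f X n ((f ^^ (n + g)) x) ^ b)\<bar>
    \<le> C * \<rho> ^ l * ((1 + \<bar>m\<bar>) * real n) ^ (a + b)"
proof -
  let ?c = "\<lambda>a i. real (a choose i) * (- (real n * m)) ^ (a - i)"
  have X: "birkhoff_sum f X n x ^ a = (\<Sum>i\<le>a. ?c a i * birkhoff_sum f \<phi> n x ^ i)" for x a
  proof -
    have "birkhoff_sum f X n x = birkhoff_sum f \<phi> n x + (- (real n * m))"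
      by (simp add: birkhoff_sum_def X_def sum_subtractf)
    then show ?thesis unfolding binomial_ring by (simp only: binomial_ring mult_ac)
  qed
  have c: "(\<Sum>i\<le>a. \<bar>?c a i\<bar> * real n ^ i) = ((1 + \<bar>m\<bar>) * real n) ^ a" for a
  proof -
    have "(\<Sum>i\<le>a. \<bar>?c a i\<bar> * real n ^ i) = (\<Sum>i\<le>a. real (a choose i) * real n ^ i * (real n * \<bar>m\<bar>) ^ (a - i))"
      by (intro sum.cong) (auto simp: abs_mult power_abs)
    also have "\<dots> = (real n + real n * \<bar>m\<bar>) ^ a" by (rule binomial_ring[symmetric])
    finally show ?thesis by (simp add: algebra_simps)
  qed
  have "\<bar>cov M (\<lambda>x. \<Sum>i\<le>a. ?c a i * birkhoff_sum f \<phi> n x ^ i)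
      (\<lambda>x. \<Sum>i\<le>b. ?c b i * birkhoff_sum f \<phi> n ((f ^^ (n + g)) x) ^ i)\<bar>
    \<le> C * \<rho> ^ l * ((\<Sum>i\<le>a. \<bar>?c a i\<bar> * real n ^ i) * (\<Sum>i\<le>b. \<bar>?c b i\<bar> * real n ^ i))"
  proof (rule abs_cov_sum_le)
    fix i j assume "i \<in> {..a}" "j \<in> {..b}"
    then show "\<bar>cov M (\<lambda>x. birkhoff_sum f \<phi> n x ^ i) (\<lambda>x. birkhoff_sum f \<phi> n ((f ^^ (n + g)) x) ^ j)\<bar>
        \<le> C * \<rho> ^ l * (real n ^ i * real n ^ j)"
      using ab by (intro cov_birkhoff_powers[OF mom decay _ l]) auto
  next
    fix j show "has_moments M (\<lambda>x. birkhoff_sum f \<phi> n ((f ^^ (n + g)) x) ^ j)"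
      by (intro has_moments_power has_moments_funpow[OF birkhoff_sum_has_moments] mom)
  qed (intro has_moments_power birkhoff_sum_has_moments mom)
  then show ?thesis unfolding X c by (simp add: power_add)
qed

end

text \<open>
  All that the rest of the argument uses about \<open>X\<close>. The assumption \<open>decorrelated\<close> concerns two blocks of
  the same length \<open>n\<close>, separated by a gap \<open>g\<close>.
\<close>

locale decorrelated_process = invariant_map M f for M :: "'a measure" and f +
  fixes X :: "'a \<Rightarrow> real" and \<sigma> :: real
  assumes variance_limit:
      "(\<lambda>n. (1 / real n) * (LINT x|M. (birkhoff_sum f X n x)\<^sup>2)) \<longlonglongrightarrow> \<sigma>\<^sup>2"
    and X_moments: "has_moments M X" and X_centered: "(LINT x|M. X x) = 0"
    and decorrelated: "\<And>r. \<exists>(C :: real) (\<rho> :: real) (\<Lambda> :: nat). 0 \<le> C \<and> 0 < \<rho> \<and> \<rho> < 1 \<and>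
      (\<forall>a b l n g. a + b = r \<longrightarrow> 1 \<le> l \<longrightarrow> \<Lambda> * l \<le> g \<longrightarrow>
        \<bar>cov M (\<lambda>x. birkhoff_sum f X n x ^ a) (\<lambda>x. birkhoff_sum f X n ((f ^^ (n + g)) x) ^ b)\<bar>
          \<le> C * real n ^ r * \<rho> ^ l)"
begin

abbreviation "S \<equiv> birkhoff_sum f X"

definition moment :: "nat \<Rightarrow> nat \<Rightarrow> real" where
  "moment r n = (LINT x|M. S n x ^ r)"

definition abs_moment :: "nat \<Rightarrow> nat \<Rightarrow> real" where
  "abs_moment r n = (LINT x|M. \<bar>S n x\<bar> ^ r)"

lemma S_moments: "has_moments M (S n)"
  by (rule birkhoff_sum_has_moments[OF X_moments])

lemma abs_moment_nonneg: "0 \<le> abs_moment r n"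
  by (simp add: abs_moment_def)

text \<open>
  The bound is far from the true order \<open>g\<^bsup>r/2\<^esup>\<close>, but it holds without decorrelation and suffices for
  the short block between the two long ones.
\<close>

lemma abs_moment_linear_bound:
  assumes "0 < r"
  shows "abs_moment r g \<le> real g ^ (r + 1) * (LINT x|M. \<bar>X x\<bar> ^ r)"
proof -
  have "abs_moment r g \<le> (LINT x|M. real g ^ r * (\<Sum>i<g. \<bar>X ((f ^^ i) x)\<bar> ^ r))"
    unfolding abs_moment_def
  proof (rule integral_mono)
    show "integrable M (\<lambda>x. \<bar>S g x\<bar> ^ r)" by (rule has_moments_integrable_abs[OF S_moments])
    show "integrable M (\<lambda>x. real g ^ r * (\<Sum>i<g. \<bar>X ((f ^^ i) x)\<bar> ^ r))"
      using X_moments by (intro has_moments_integrable has_moments_intros has_moments_funpow)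
  qed (auto simp: birkhoff_sum_def intro: abs_sum_power_le[OF assms])
  also have "\<dots> = real g ^ r * (\<Sum>i<g. LINT x|M. \<bar>X ((f ^^ i) x)\<bar> ^ r)"
    using X_moments
    by (simp add: Bochner_Integration.integral_sum has_moments_integrable_abs has_moments_funpow)
  also have "(\<Sum>i<g. LINT x|M. \<bar>X ((f ^^ i) x)\<bar> ^ r) = (\<Sum>i<g. LINT x|M. \<bar>X x\<bar> ^ r)"
    using has_moments_measurable[OF X_moments]
    by (intro sum.cong refl integral_funpow[of "\<lambda>x. \<bar>X x\<bar> ^ r"]) measurable
  finally show ?thesis by (simp add: mult_ac)
qed

text \<open>
  Write \<open>S\<^bsub>2n+g\<^esub> = Y + W\<close> with \<open>W\<close> the middle block of length \<open>g\<close> and \<open>Y\<close> the sum of the two outer blocks.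
  Dropping \<open>W\<close> costs the first two terms, and treating the outer blocks as independent in the binomial
  expansion of \<open>Y\<^sup>r\<close> costs the last one.
\<close>

lemma two_block_moment:
  fixes \<epsilon> :: real
  assumes r: "0 < r" and \<epsilon>: "0 < \<epsilon>"
  shows "\<exists>K \<ge> 0. \<forall>(C :: real) (\<rho> :: real) n g l.
    (\<forall>a b. a + b = r \<longrightarrow>
      \<bar>cov M (\<lambda>x. S n x ^ a) (\<lambda>x. S n ((f ^^ (n + g)) x) ^ b)\<bar> \<le> C * real n ^ r * \<rho> ^ l) \<longrightarrow>
    \<bar>moment r (2 * n + g) - (\<Sum>a\<le>r. real (r choose a) * moment a n * moment (r - a) n)\<bar>
      \<le> \<epsilon> * abs_moment r n + K * real g ^ (r + 1) + 2 ^ r * (C * real n ^ r * \<rho> ^ l)"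
proof -
  have "\<epsilon> / 2 ^ (r + 1) > 0" using \<epsilon> by simp
  then obtain K where K: "K \<ge> 0" and
    pert: "\<And>y w :: real. \<bar>(y + w) ^ r - y ^ r\<bar> \<le> \<epsilon> / 2 ^ (r + 1) * \<bar>y\<bar> ^ r + K * \<bar>w\<bar> ^ r"
    by (rule perturbed_power_le[where r = r]) blast
  define K' where "K' = K * (LINT x|M. \<bar>X x\<bar> ^ r)"
  have K': "K' \<ge> 0" using K by (simp add: K'_def)
  have "\<bar>moment r (2 * n + g) - (\<Sum>a\<le>r. real (r choose a) * moment a n * moment (r - a) n)\<bar>
      \<le> \<epsilon> * abs_moment r n + K' * real g ^ (r + 1) + 2 ^ r * (C * real n ^ r * \<rho> ^ l)"
    if cov: "\<And>a b. a + b = r \<Longrightarrow>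
      \<bar>cov M (\<lambda>x. S n x ^ a) (\<lambda>x. S n ((f ^^ (n + g)) x) ^ b)\<bar> \<le> C * real n ^ r * \<rho> ^ l"
    for C \<rho> n g l
  proof -
    define S' where "S' x = S n ((f ^^ (n + g)) x)" for x
    define W where "W x = S g ((f ^^ n) x)" for x
    define Y where "Y x = S n x + S' x" for x
    have mom: "has_moments M S'" "has_moments M W" "has_moments M Y"
      unfolding S'_def[abs_def] W_def[abs_def] Y_def[abs_def]
      by (intro has_moments_add has_moments_funpow S_moments)+
    have S_eq: "S (2 * n + g) x = Y x + W x" for x
      unfolding Y_def W_def S'_def
      using birkhoff_sum_add[of f X n "g + n" x] birkhoff_sum_add[of f X g n "(f ^^ n) x"]
      by (simp add: mult_2 add_ac funpow_add)
    have [simp]: "(LINT x|M. S' x ^ b) = moment b n" for b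
      unfolding S'_def moment_def using has_moments_measurable[OF S_moments]
      by (intro integral_funpow[of "\<lambda>x. S n x ^ b"]) measurable
    have ES': "(LINT x|M. \<bar>S' x\<bar> ^ r) = abs_moment r n"
      unfolding S'_def abs_moment_def using has_moments_measurable[OF S_moments]
      by (intro integral_funpow[of "\<lambda>x. \<bar>S n x\<bar> ^ r"]) measurable
    have EW: "(LINT x|M. \<bar>W x\<bar> ^ r) = abs_moment r g"
      unfolding W_def abs_moment_def using has_moments_measurable[OF S_moments]
      by (intro integral_funpow[of "\<lambda>x. \<bar>S g x\<bar> ^ r"]) measurable
    have int: "integrable M (\<lambda>x. (Y x + W x) ^ r)" "integrable M (\<lambda>x. Y x ^ r)"
      "integrable M (\<lambda>x. \<bar>Y x\<bar> ^ r)" "integrable M (\<lambda>x. \<bar>W x\<bar> ^ r)"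
      "integrable M (\<lambda>x. \<bar>S n x\<bar> ^ r)" "integrable M (\<lambda>x. \<bar>S' x\<bar> ^ r)"
      using mom S_moments by (auto intro!: has_moments_integrable has_moments_intros)
    have "\<bar>moment r (2 * n + g) - (LINT x|M. Y x ^ r)\<bar> = \<bar>LINT x|M. (Y x + W x) ^ r - Y x ^ r\<bar>"
      unfolding moment_def S_eq using int by simp
    also have "\<dots> \<le> (LINT x|M. \<bar>(Y x + W x) ^ r - Y x ^ r\<bar>)" by (rule integral_abs_bound)
    also have "\<dots> \<le> (LINT x|M. \<epsilon> / 2 ^ (r + 1) * \<bar>Y x\<bar> ^ r + K * \<bar>W x\<bar> ^ r)"
      using int pert by (intro integral_mono) auto
    also have "\<dots> = \<epsilon> / 2 ^ (r + 1) * (LINT x|M. \<bar>Y x\<bar> ^ r) + K * abs_moment r g"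
      using int by (simp add: EW)
    finally have YW: "\<bar>moment r (2 * n + g) - (LINT x|M. Y x ^ r)\<bar>
        \<le> \<epsilon> / 2 ^ (r + 1) * (LINT x|M. \<bar>Y x\<bar> ^ r) + K * abs_moment r g" .
    have "(LINT x|M. \<bar>Y x\<bar> ^ r) \<le> (LINT x|M. 2 ^ r * (\<bar>S n x\<bar> ^ r + \<bar>S' x\<bar> ^ r))"
      unfolding Y_def using int by (intro integral_mono abs_add_power_le) (auto simp: Y_def)
    also have "\<dots> = 2 ^ (r + 1) * abs_moment r n"
      using int by (simp add: ES' abs_moment_def)
    finally have "\<epsilon> / 2 ^ (r + 1) * (LINT x|M. \<bar>Y x\<bar> ^ r)
        \<le> \<epsilon> / 2 ^ (r + 1) * (2 ^ (r + 1) * abs_moment r n)"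
      using \<epsilon> by (intro mult_left_mono) auto
    moreover have "K * abs_moment r g \<le> K * (real g ^ (r + 1) * (LINT x|M. \<bar>X x\<bar> ^ r))"
      using K abs_moment_linear_bound[OF r] by (intro mult_left_mono) auto
    ultimately have 1: "\<bar>moment r (2 * n + g) - (LINT x|M. Y x ^ r)\<bar>
        \<le> \<epsilon> * abs_moment r n + K' * real g ^ (r + 1)"
      using YW by (simp add: K'_def mult_ac)
    have "(LINT x|M. Y x ^ r) = (LINT x|M. (\<Sum>a\<le>r. real (r choose a) * (S n x ^ a * S' x ^ (r - a))))"
      unfolding Y_def binomial_ring by (simp add: mult_ac)
    also have "\<dots> = (\<Sum>a\<le>r. real (r choose a) * (LINT x|M. S n x ^ a * S' x ^ (r - a)))"
      using S_moments mom(1)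
      by (subst Bochner_Integration.integral_sum) (auto intro!: has_moments_integrable has_moments_intros)
    finally have "(LINT x|M. Y x ^ r) - (\<Sum>a\<le>r. real (r choose a) * moment a n * moment (r - a) n)
        = (\<Sum>a\<le>r. real (r choose a) * cov M (\<lambda>x. S n x ^ a) (\<lambda>x. S' x ^ (r - a)))"
      by (simp add: cov_def moment_def algebra_simps sum_subtractf)
    also have "\<bar>\<dots>\<bar> \<le> (\<Sum>a\<le>r. real (r choose a) * (C * real n ^ r * \<rho> ^ l))"
    proof (intro order_trans[OF sum_abs] sum_mono)
      fix a assume "a \<in> {..r}"
      then have "\<bar>cov M (\<lambda>x. S n x ^ a) (\<lambda>x. S' x ^ (r - a))\<bar> \<le> C * real n ^ r * \<rho> ^ l"
        unfolding S'_def by (intro cov) simp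
      then show "\<bar>real (r choose a) * cov M (\<lambda>x. S n x ^ a) (\<lambda>x. S' x ^ (r - a))\<bar>
          \<le> real (r choose a) * (C * real n ^ r * \<rho> ^ l)"
        unfolding abs_mult by (intro mult_mono) auto
    qed
    also have "\<dots> = 2 ^ r * (C * real n ^ r * \<rho> ^ l)"
      using choose_row_sum[of r] by (simp add: sum_distrib_right[symmetric] flip: of_nat_sum)
    finally show ?thesis using 1 by linarith
  qed
  with K' show ?thesis by blast
qed


section \<open>The binomial recursion for the moments\<close>

text \<open>
  The gap \<open>g\<close> is of order \<open>N\<^bsup>1/4\<^esup>\<close>: long enough for \<open>N\<^sup>r \<rho>\<^bsup>g/\<Lambda>\<^esup>\<close> to vanish, and short enough for
  \<open>g\<^bsup>r+1\<^esup>\<close> to be negligible against \<open>N\<^bsup>r/2\<^esup>\<close>. With \<open>h\<close> as the common length of the two outer blocks, \<open>N\<close> is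
  exactly \<open>2 h + g\<close>.
\<close>

lemma moment_recursion:
  assumes r: "2 \<le> r"
  obtains h :: "nat \<Rightarrow> nat" where "\<And>N. 2 * h N \<le> N" "(\<lambda>N. real (h N) / real N) \<longlonglongrightarrow> 1 / 2"
    "\<And>\<epsilon>. 0 < \<epsilon> \<Longrightarrow> \<forall>\<^sub>F N in sequentially.
      \<bar>moment r N - (\<Sum>a\<le>r. real (r choose a) * moment a (h N) * moment (r - a) (h N))\<bar>
        \<le> \<epsilon> * (abs_moment r (h N) + sqrt (real N) ^ r)"
proof -
  obtain C \<rho> :: real and \<Lambda> :: nat where C: "0 \<le> C" "0 < \<rho>" "\<rho> < 1" and decay:
    "\<And>a b l n g. a + b = r \<Longrightarrow> 1 \<le> l \<Longrightarrow> \<Lambda> * l \<le> g \<Longrightarrow>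
        \<bar>cov M (\<lambda>x. S n x ^ a) (\<lambda>x. S n ((f ^^ (n + g)) x) ^ b)\<bar> \<le> C * real n ^ r * \<rho> ^ l"
    using decorrelated[of r] by blast
  \<comment> \<open>\<open>l\<close> is the integer part of \<open>N\<^bsup>1/4\<^esup>\<close>; for large \<open>N\<close> the gap \<open>g\<close> is \<open>\<Lambda> l\<close> or \<open>\<Lambda> l + 1\<close>,
    whichever makes \<open>N - g\<close> even.\<close>
  define s where "s N = sqrt (sqrt (real N))" for N :: nat
  define l where "l N = nat \<lfloor>s N\<rfloor>" for N
  define h where "h N = (N - \<Lambda> * l N) div 2" for N
  define g where "g N = N - 2 * h N" for N
  have hN: "2 * h N \<le> N" for N by (simp add: h_def)
  have s1: "1 \<le> s N" if "1 \<le> N" for N using that by (simp add: s_def)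
  have l_le: "real (l N) \<le> s N" and s_le: "s N \<le> 1 + real (l N)" for N
    unfolding l_def using floor_correct[of "s N"] by (auto simp: s_def, linarith+)
  have s4: "s N ^ 4 = real N" for N
  proof -
    have "s N ^ 4 = (s N ^ 2) ^ 2" by (simp flip: power_mult)
    then show ?thesis by (simp add: s_def)
  qed
  have s2: "s N ^ 2 = sqrt (real N)" for N by (simp add: s_def)
  have s_top: "filterlim s at_top sequentially" unfolding s_def by real_asymp
  have ev: "\<forall>\<^sub>F N in sequentially. 1 \<le> N \<and> real \<Lambda> * s N \<le> real N"
  proof (intro eventually_conj eventually_ge_at_top)
    show "\<forall>\<^sub>F N in sequentially. real \<Lambda> * s N \<le> real N"
      unfolding s_def by real_asymp
  qed
  have props: "\<Lambda> * l N \<le> N" "1 \<le> l N" "\<Lambda> * l N \<le> g N" "real (g N) \<le> (real \<Lambda> + 1) * s N"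
    if N: "1 \<le> N" "real \<Lambda> * s N \<le> real N" for N
  proof -
    have "real (\<Lambda> * l N) \<le> real \<Lambda> * s N" using l_le[of N] by (simp add: mult_left_mono)
    then have 1: "real (\<Lambda> * l N) \<le> real N" using N by linarith
    then show le: "\<Lambda> * l N \<le> N" by linarith
    show "1 \<le> l N" using s1[OF N(1)] unfolding l_def by (simp add: le_nat_iff le_floor_iff)
    show "\<Lambda> * l N \<le> g N" using le by (simp add: g_def h_def)
    have "g N \<le> \<Lambda> * l N + 1" using le unfolding g_def h_def by presburger
    then have "real (g N) \<le> real \<Lambda> * real (l N) + 1" by (simp flip: of_nat_mult)
    also have "\<dots> \<le> real \<Lambda> * s N + s N"
      using l_le[of N] s1[OF N(1)] by (intro add_mono mult_left_mono) auto
    finally show "real (g N) \<le> (real \<Lambda> + 1) * s N" by (simp add: algebra_simps)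
  qed
  have "(\<lambda>N. real (h N) / real N - 1 / 2) \<longlonglongrightarrow> 0"
  proof (rule Lim_null_comparison)
    show "\<forall>\<^sub>F N in sequentially. norm (real (h N) / real N - 1 / 2) \<le> (real \<Lambda> + 1) * s N / real N"
      using ev
    proof eventually_elim
      case (elim N)
      have gN: "real (g N) = real N - 2 * real (h N)" using hN[of N] by (simp add: g_def of_nat_diff)
      then have "real (h N) / real N - 1 / 2 = - (real (g N) / (2 * real N))"
        unfolding gN using elim by (simp add: field_simps)
      then have "norm (real (h N) / real N - 1 / 2) = real (g N) / (2 * real N)" by simp
      also have "\<dots> \<le> real (g N) / real N" using elim by (intro divide_left_mono) auto
      also have "\<dots> \<le> (real \<Lambda> + 1) * s N / real N"
        using props(4)[of N] elim by (intro divide_right_mono) auto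
      finally show ?case .
    qed
    show "(\<lambda>N. (real \<Lambda> + 1) * s N / real N) \<longlonglongrightarrow> 0"
      unfolding s_def by real_asymp
  qed
  then have half: "(\<lambda>N. real (h N) / real N) \<longlonglongrightarrow> 1 / 2"
    by (simp add: LIM_zero_iff)
  have rec: "\<forall>\<^sub>F N in sequentially.
      \<bar>moment r N - (\<Sum>a\<le>r. real (r choose a) * moment a (h N) * moment (r - a) (h N))\<bar>
        \<le> \<epsilon> * (abs_moment r (h N) + sqrt (real N) ^ r)" if \<epsilon>: "0 < \<epsilon>" for \<epsilon>
  proof -
    obtain K where K: "K \<ge> 0" and two: "\<And>(C :: real) (\<rho> :: real) n g l.
      (\<And>a b. a + b = r \<Longrightarrow>
        \<bar>cov M (\<lambda>x. S n x ^ a) (\<lambda>x. S n ((f ^^ (n + g)) x) ^ b)\<bar> \<le> C * real n ^ r * \<rho> ^ l) \<Longrightarrow>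
      \<bar>moment r (2 * n + g) - (\<Sum>a\<le>r. real (r choose a) * moment a n * moment (r - a) n)\<bar>
        \<le> \<epsilon> * abs_moment r n + K * real g ^ (r + 1) + 2 ^ r * (C * real n ^ r * \<rho> ^ l)"
      using two_block_moment[of r \<epsilon>] r \<epsilon> by auto
    define K' where "K' = K * (real \<Lambda> + 1) ^ (r + 1)"
    have K': "0 \<le> K'" using K by (simp add: K'_def)
    have "(\<lambda>N. K' / s N) \<longlonglongrightarrow> 0"
      using s_top by (intro real_tendsto_divide_at_top[OF tendsto_const]) 
    then have ev1: "\<forall>\<^sub>F N in sequentially. K' / s N < \<epsilon> / 2"
      using \<epsilon> by (intro order_tendstoD) auto
    have "filterlim l sequentially sequentially"
      unfolding l_def[abs_def] using s_top
      by (intro filterlim_compose[OF filterlim_nat_sequentially] filterlim_compose[OF filterlim_floor_sequentially])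
    then have "(\<lambda>N. (1 + real (l N)) ^ (4 * r) * \<rho> ^ l N) \<longlonglongrightarrow> 0"
      by (rule filterlim_compose[OF poly_times_geometric_tendsto_0[OF C(2,3)]])
    then have "(\<lambda>N. 2 ^ r * C * ((1 + real (l N)) ^ (4 * r) * \<rho> ^ l N)) \<longlonglongrightarrow> 2 ^ r * C * 0"
      by (intro tendsto_intros)
    then have ev2: "\<forall>\<^sub>F N in sequentially. 2 ^ r * C * ((1 + real (l N)) ^ (4 * r) * \<rho> ^ l N) < \<epsilon> / 2"
      using \<epsilon> by (intro order_tendstoD) auto
    show ?thesis
      using ev ev1 ev2
    proof eventually_elim
      case (elim N)
      note p = props[of N]
      have N: "1 \<le> N" using elim by simp
      have sN: "1 \<le> s N" by (rule s1[OF N])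
      have "2 * h N + g N = N" using hN[of N] by (simp add: g_def)
      moreover have "\<bar>moment r (2 * h N + g N)
          - (\<Sum>a\<le>r. real (r choose a) * moment a (h N) * moment (r - a) (h N))\<bar>
        \<le> \<epsilon> * abs_moment r (h N) + K * real (g N) ^ (r + 1) + 2 ^ r * (C * real (h N) ^ r * \<rho> ^ l N)"
        using elim p by (intro two decay) auto
      moreover have "K * real (g N) ^ (r + 1) \<le> \<epsilon> / 2 * sqrt (real N) ^ r"
      proof -
        have "K * real (g N) ^ (r + 1) \<le> K * ((real \<Lambda> + 1) * s N) ^ (r + 1)"
          using K elim p by (intro mult_left_mono power_mono) auto
        also have "\<dots> = K' / s N * s N ^ (r + 2)"
          using sN by (simp add: K'_def power_mult_distrib)
        also have "\<dots> \<le> \<epsilon> / 2 * s N ^ (2 * r)"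
          using elim sN r \<epsilon> by (intro mult_mono power_increasing) auto
        also have "s N ^ (2 * r) = sqrt (real N) ^ r" by (simp add: power_mult s2)
        finally show ?thesis .
      qed
      moreover have "2 ^ r * (C * real (h N) ^ r * \<rho> ^ l N) \<le> \<epsilon> / 2 * sqrt (real N) ^ r"
      proof -
        have "real (h N) \<le> real N" using hN[of N] by linarith
        also have "\<dots> = s N ^ 4" by (rule s4[symmetric])
        also have "\<dots> \<le> (1 + real (l N)) ^ 4" using s_le[of N] sN by (intro power_mono) auto
        finally have "real (h N) ^ r \<le> ((1 + real (l N)) ^ 4) ^ r" by (rule power_mono) simp
        then have "2 ^ r * (C * real (h N) ^ r * \<rho> ^ l N) \<le> 2 ^ r * (C * ((1 + real (l N)) ^ 4) ^ r * \<rho> ^ l N)"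
          using C by (intro mult_left_mono mult_right_mono) auto
        also have "\<dots> = 2 ^ r * C * ((1 + real (l N)) ^ (4 * r) * \<rho> ^ l N)"
          unfolding power_mult by (simp only: mult_ac)
        also have "\<dots> \<le> \<epsilon> / 2 * 1" using elim by simp
        also have "\<dots> \<le> \<epsilon> / 2 * sqrt (real N) ^ r"
          using \<epsilon> N by (intro mult_left_mono one_le_power) auto
        finally show ?thesis .
      qed
      ultimately show ?case by (simp add: algebra_simps)
    qed
  qed
  show ?thesis using that[OF hN half rec] .
qed

end

section \<open>Convergence of the moments\<close>

text \<open>
  Iterating the inequality \<open>k\<close> times shows that \<open>\<bar>e\<bar>\<close> is eventually at most \<open>\<epsilon>/2 + L\<^sup>k B\<close>.
\<close>

lemma contraction_tendsto_0:
  fixes e :: "nat \<Rightarrow> real"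
  assumes bdd: "\<And>n. \<bar>e n\<bar> \<le> B" and L: "0 \<le> L" "L < 1"
    and h: "filterlim h sequentially sequentially" and \<delta>: "\<delta> \<longlonglongrightarrow> 0"
    and rec: "\<forall>\<^sub>F n in sequentially. \<bar>e n\<bar> \<le> L * \<bar>e (h n)\<bar> + \<delta> n"
  shows "e \<longlonglongrightarrow> 0"
proof (rule tendstoI)
  fix \<epsilon> :: real assume \<epsilon>: "0 < \<epsilon>"
  have step: "\<forall>\<^sub>F n in sequentially. \<bar>e n\<bar> \<le> \<epsilon> / 2 + L ^ k * B" for k
  proof (induction k)
    case 0
    have "\<bar>e n\<bar> \<le> \<epsilon> / 2 + L ^ 0 * B" for n using bdd[of n] \<epsilon> by simp
    then show ?case by simp
  next
    case (Suc k)
    have "\<forall>\<^sub>F n in sequentially. \<delta> n < (1 - L) * (\<epsilon> / 2)"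
      using \<epsilon> L by (intro order_tendstoD[OF \<delta>]) auto
    moreover have "\<forall>\<^sub>F n in sequentially. \<bar>e (h n)\<bar> \<le> \<epsilon> / 2 + L ^ k * B"
      by (rule eventually_compose_filterlim[OF Suc h])
    ultimately show ?case
      using rec
    proof eventually_elim
      case (elim n)
      have "L * \<bar>e (h n)\<bar> \<le> L * (\<epsilon> / 2 + L ^ k * B)"
        using elim L by (intro mult_left_mono) auto
      with elim show ?case by (simp add: algebra_simps)
    qed
  qed
  have "(\<lambda>k. \<epsilon> / 2 + L ^ k * B) \<longlonglongrightarrow> \<epsilon> / 2 + 0 * B"
    using L by (intro tendsto_intros) auto
  then have "\<forall>\<^sub>F k in sequentially. \<epsilon> / 2 + L ^ k * B < \<epsilon>"
    by (rule order_tendstoD(2)) (use \<epsilon> in simp)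
  then obtain k where "\<epsilon> / 2 + L ^ k * B < \<epsilon>"
    by (auto simp: eventually_sequentially)
  with step[of k] show "\<forall>\<^sub>F n in sequentially. dist (e n) 0 < \<epsilon>"
    by (auto elim!: eventually_mono)
qed

definition gaussian_moment :: "real \<Rightarrow> nat \<Rightarrow> real" where
  "gaussian_moment \<sigma> r = (if even r then \<sigma> ^ r * fact r / (2 ^ (r div 2) * fact (r div 2)) else 0)"

text \<open>
  The sum of two independent copies of a centered normal variable has the law of \<open>\<surd>2\<close> times that
  variable; in terms of the formula for the moments this is \<open>\<Sum>\<^sub>b (s choose b) = 2\<^sup>s\<close>.
\<close>

lemma gaussian_moment_convolution:
  "(\<Sum>a\<le>r. real (r choose a) * gaussian_moment \<sigma> a * gaussian_moment \<sigma> (r - a))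
    = sqrt 2 ^ r * gaussian_moment \<sigma> r"
proof (cases "even r")
  case False
  then have "gaussian_moment \<sigma> a * gaussian_moment \<sigma> (r - a) = 0" if "a \<le> r" for a
    using that by (auto simp: gaussian_moment_def)
  then have "(\<Sum>a\<le>r. real (r choose a) * (gaussian_moment \<sigma> a * gaussian_moment \<sigma> (r - a))) = 0"
    by (intro sum.neutral) auto
  then show ?thesis using False by (simp add: gaussian_moment_def mult.assoc)
next
  case True
  then obtain s where s: "r = 2 * s" by (elim evenE)
  let ?t = "\<lambda>a. real (r choose a) * gaussian_moment \<sigma> a * gaussian_moment \<sigma> (r - a)"
  have "(\<Sum>a\<le>r. ?t a) = (\<Sum>a\<in>(\<lambda>b. 2 * b) ` {..s}. ?t a)"
  proof (rule sum.mono_neutral_right)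
    show "\<forall>a\<in>{..r} - (\<lambda>b. 2 * b) ` {..s}. ?t a = 0"
      by (auto simp: gaussian_moment_def s elim!: evenE)
  qed (auto simp: s)
  also have "\<dots> = (\<Sum>b\<le>s. ?t (2 * b))"
    by (subst sum.reindex) (auto simp: inj_on_def)
  also have "\<dots> = (\<Sum>b\<le>s. \<sigma> ^ r * fact r / (2 ^ s * fact s) * real (s choose b))"
  proof (rule sum.cong)
    fix b assume b: "b \<in> {..s}"
    have diff: "r - 2 * b = 2 * (s - b)" using s by simp
    have pow: "\<sigma> ^ (2 * b) * \<sigma> ^ (2 * (s - b)) = \<sigma> ^ r" "(2 :: real) ^ b * 2 ^ (s - b) = 2 ^ s"
      using b s by (simp_all flip: power_add add: algebra_simps)
    have "real (r choose (2 * b)) * (fact (2 * b) * fact (2 * (s - b))) = fact r"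
      using b binomial_fact[of "2 * b" r, where 'a = real] unfolding diff[symmetric] by (simp add: s)
    moreover have "?t (2 * b) = real (r choose (2 * b)) * (fact (2 * b) * fact (2 * (s - b)))
        * (\<sigma> ^ (2 * b) * \<sigma> ^ (2 * (s - b))) / ((2 ^ b * 2 ^ (s - b)) * (fact b * fact (s - b)))"
      unfolding diff by (simp add: gaussian_moment_def mult_ac)
    ultimately have "?t (2 * b) = fact r * \<sigma> ^ r / (2 ^ s * (fact b * fact (s - b)))"
      by (simp only: pow)
    also have "\<dots> = \<sigma> ^ r * fact r / (2 ^ s * fact s) * real (s choose b)"
      using b binomial_fact[of b s, where 'a = real] by simp
    finally show "?t (2 * b) = \<sigma> ^ r * fact r / (2 ^ s * fact s) * real (s choose b)" .
  qed simp
  also have "\<dots> = \<sigma> ^ r * fact r / (2 ^ s * fact s) * real (\<Sum>b\<le>s. s choose b)"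
    by (simp only: sum_distrib_left of_nat_sum)
  also have "\<dots> = \<sigma> ^ r * fact r / (2 ^ s * fact s) * 2 ^ s"
    by (simp only: choose_row_sum of_nat_power of_nat_numeral)
  also have "\<dots> = sqrt 2 ^ r * gaussian_moment \<sigma> r"
    by (simp add: gaussian_moment_def s power_mult)
  finally show ?thesis .
qed

context decorrelated_process
begin

lemma moment_0 [simp]: "moment 0 n = 1"
  by (simp add: moment_def prob_space)

lemma moment_1 [simp]: "moment (Suc 0) n = 0"
proof -
  have "moment (Suc 0) n = (\<Sum>k<n. LINT x|M. X ((f ^^ k) x))"
    unfolding moment_def birkhoff_sum_def using X_moments
    by (simp add: Bochner_Integration.integral_sum has_moments_integrable has_moments_funpow)
  also have "\<dots> = 0"
    using integral_funpow[OF has_moments_measurable[OF X_moments]] X_centered by simp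
  finally show ?thesis .
qed

lemma moment_even: "moment (2 * t) n = abs_moment (2 * t) n"
  unfolding moment_def abs_moment_def by (simp add: power_even_abs)

lemma moment_le_abs_moment: "\<bar>moment r n\<bar> \<le> abs_moment r n"
  unfolding moment_def abs_moment_def power_abs[symmetric] by (rule integral_abs_bound)

lemma abs_moment_interpolation:
  assumes "moment (2 * t) n \<le> B * sqrt (real n) ^ (2 * t)" "a \<le> 2 * t" "0 \<le> B"
  shows "abs_moment a n \<le> (1 + B) * sqrt (real n) ^ a"
proof (cases "n = 0")
  case True
  then show ?thesis using assms(3)
    by (cases "a = 0") (simp_all add: abs_moment_def birkhoff_sum_def prob_space zero_power)
next
  case False
  define y where "y = sqrt (real n)"
  have y: "y > 0" using False by (simp add: y_def)
  have point: "\<bar>u\<bar> ^ a \<le> y ^ a * (1 + \<bar>u\<bar> ^ (2 * t) / y ^ (2 * t))" for u :: real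
  proof -
    define v where "v = \<bar>u\<bar> / y"
    have "v ^ a \<le> 1 + v ^ (2 * t)"
    proof (cases "v \<le> 1")
      case True
      then show ?thesis using y by (simp add: v_def add_increasing2 power_le_one)
    next
      case False
      then have "v ^ a \<le> v ^ (2 * t)" using assms(2) by (intro power_increasing) auto
      then show ?thesis by simp
    qed
    then have "y ^ a * v ^ a \<le> y ^ a * (1 + v ^ (2 * t))"
      using y by (intro mult_left_mono) auto
    then show ?thesis using y by (simp add: v_def power_divide)
  qed
  have "abs_moment a n \<le> (LINT x|M. y ^ a * (1 + \<bar>S n x\<bar> ^ (2 * t) / y ^ (2 * t)))"
    unfolding abs_moment_def using has_moments_integrable_abs[OF S_moments]
    by (intro integral_mono point) auto
  also have "\<dots> = y ^ a * (1 + abs_moment (2 * t) n / y ^ (2 * t))"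
    unfolding abs_moment_def using has_moments_integrable_abs[OF S_moments]
    by (simp add: prob_space)
  also have "abs_moment (2 * t) n / y ^ (2 * t) \<le> B"
    using assms(1) y unfolding moment_even by (simp add: y_def pos_divide_le_eq)
  finally show ?thesis using y by (simp add: y_def mult.commute)
qed

text \<open>
  For even \<open>r \<ge> 4\<close> the recursion with error parameter \<open>1\<close> reads \<open>m\<^sub>r(N) \<le> 3 m\<^sub>r(h) + O(N\<^bsup>r/2\<^esup>)\<close> with
  \<open>h \<le> N/2\<close>, because \<open>m\<^sub>1 = 0\<close> removes the terms with \<open>a = 1\<close> and \<open>a = r - 1\<close> and the other mixed terms are
  controlled by the moment of order \<open>r - 2\<close>. As \<open>3 \<cdot> 2\<^bsup>-r/2\<^esup> \<le> 3/4\<close>, a bound of order \<open>N\<^bsup>r/2\<^esup>\<close> propagates from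
  \<open>h\<close> to \<open>N\<close>.
\<close>

lemma even_moment_bounded: "\<exists>B\<ge>0. \<forall>n. moment (2 * t) n \<le> B * sqrt (real n) ^ (2 * t)"
proof (induction t rule: less_induct)
  case (less t)
  consider "t = 0" | "t = 1" | "2 \<le> t" by linarith
  then show ?case
  proof cases
    case 1
    then show ?thesis by (auto intro: exI[of _ 1])
  next
    case 2
    have "Bseq (\<lambda>n. (1 / real n) * (LINT x|M. (S n x)\<^sup>2))"
      using variance_limit by (intro convergent_imp_Bseq convergentI)
    then obtain B where B: "B > 0" "\<And>n. norm ((1 / real n) * (LINT x|M. (S n x)\<^sup>2)) \<le> B"
      by (auto simp: Bseq_def)
    have "moment (2 * t) n \<le> B * sqrt (real n) ^ (2 * t)" for n
    proof (cases "n = 0")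
      case True
      then show ?thesis by (simp add: moment_def birkhoff_sum_def 2)
    next
      case False
      have eq: "moment (2 * t) n = (LINT x|M. (S n x)\<^sup>2)" "sqrt (real n) ^ (2 * t) = real n"
        using 2 by (simp_all add: moment_def)
      show ?thesis using B(2)[of n] False unfolding eq by (simp add: field_simps abs_le_iff)
    qed
    then show ?thesis using B by (intro exI[of _ B]) auto
  next
    case 3
    define r where "r = 2 * t"
    have r: "4 \<le> r" using 3 by (simp add: r_def)
    obtain B0 where B0: "0 \<le> B0" "\<And>n. moment (2 * (t - 1)) n \<le> B0 * sqrt (real n) ^ (2 * (t - 1))"
      using less[of "t - 1"] 3 by auto
    define B1 where "B1 = 1 + B0"
    have B1: "\<bar>moment a n\<bar> \<le> B1 * sqrt (real n) ^ a" if "a \<le> r - 2" for a n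
    proof -
      have "a \<le> 2 * (t - 1)" using that by (simp add: r_def diff_mult_distrib2)
      from abs_moment_interpolation[OF B0(2) this B0(1)] show ?thesis
        using moment_le_abs_moment[of a n] unfolding B1_def by (rule order_trans[rotated])
    qed
    obtain h :: "nat \<Rightarrow> nat" where h: "\<And>N. 2 * h N \<le> N" and
      rec: "\<And>\<epsilon>. 0 < \<epsilon> \<Longrightarrow> \<forall>\<^sub>F N in sequentially.
        \<bar>moment r N - (\<Sum>a\<le>r. real (r choose a) * moment a (h N) * moment (r - a) (h N))\<bar>
        \<le> \<epsilon> * (abs_moment r (h N) + sqrt (real N) ^ r)"
      by (rule moment_recursion[of r]) (use r in auto)
    define D where "D = 2 ^ r * (B1 * B1) + 1"
    have D: "D \<ge> 0" by (simp add: D_def)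
    have step: "\<forall>\<^sub>F N in sequentially. moment r N \<le> 3 * moment r (h N) + D * sqrt (real N) ^ r"
      using rec[OF zero_less_one]
    proof eventually_elim
      case (elim N)
      let ?t = "\<lambda>a. real (r choose a) * moment a (h N) * moment (r - a) (h N)"
      have t_le: "?t a \<le> real (r choose a) * (B1 * B1 * sqrt (real N) ^ r)" if a: "a \<in> {1..<r}" for a
      proof -
        have "moment a (h N) * moment (r - a) (h N) \<le> B1 * B1 * sqrt (real N) ^ r"
        proof (cases "a = 1 \<or> a = r - 1")
          case True
          then have "moment a (h N) * moment (r - a) (h N) = 0" using a r by auto
          moreover have "0 \<le> B1 * B1 * sqrt (real N) ^ r" using B0(1) by (simp add: B1_def)
          ultimately show ?thesis by linarith
        next
          case False
          then have "moment a (h N) * moment (r - a) (h N)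
              \<le> \<bar>moment a (h N)\<bar> * \<bar>moment (r - a) (h N)\<bar>"
            by (simp flip: abs_mult)
          also have "\<dots> \<le> (B1 * sqrt (real (h N)) ^ a) * (B1 * sqrt (real (h N)) ^ (r - a))"
            using a False B0 by (intro mult_mono B1) (auto simp: B1_def)
          also have "\<dots> = B1 * B1 * sqrt (real (h N)) ^ r"
            using a by (simp add: mult_ac flip: power_add)
          also have "\<dots> \<le> B1 * B1 * sqrt (real N) ^ r"
            using h[of N] by (intro mult_left_mono power_mono) auto
          finally show ?thesis .
        qed
        then show ?thesis
          unfolding mult.assoc[of "real (r choose a)"] by (intro mult_left_mono) auto
      qed
      have "(\<Sum>a\<le>r. ?t a) = 2 * moment r (h N) + (\<Sum>a\<in>{1..<r}. ?t a)"
      proof -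
        have "{..r} = insert 0 (insert r {1..<r})" using r by auto
        then show ?thesis using r by simp
      qed
      also have "(\<Sum>a\<in>{1..<r}. ?t a) \<le> (\<Sum>a\<in>{1..<r}. real (r choose a) * (B1 * B1 * sqrt (real N) ^ r))"
        by (intro sum_mono t_le)
      also have "\<dots> \<le> (\<Sum>a\<le>r. real (r choose a) * (B1 * B1 * sqrt (real N) ^ r))"
        by (intro sum_mono2) auto
      also have "\<dots> = 2 ^ r * (B1 * B1 * sqrt (real N) ^ r)"
        using choose_row_sum[of r] by (simp flip: sum_distrib_right of_nat_sum)
      finally have "(\<Sum>a\<le>r. ?t a) \<le> 2 * moment r (h N) + 2 ^ r * (B1 * B1 * sqrt (real N) ^ r)" by simp
      moreover have "abs_moment r (h N) = moment r (h N)" unfolding r_def moment_even ..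
      ultimately show ?case
        using elim by (simp add: D_def algebra_simps abs_le_iff)
    qed
    then obtain N0 where N0: "\<And>N. N0 \<le> N \<Longrightarrow> moment r N \<le> 3 * moment r (h N) + D * sqrt (real N) ^ r"
      by (auto simp: eventually_sequentially)
    have mom0: "0 \<le> moment r N" for N
      unfolding r_def moment_even by (rule abs_moment_nonneg)
    define B where "B = 4 * D + (\<Sum>N<N0. moment r N)"
    have BD: "4 * D \<le> B" using mom0 by (simp add: B_def sum_nonneg)
    then have B_nonneg: "0 \<le> B" using D by simp
    have "moment r N \<le> B * sqrt (real N) ^ r" for N
    proof (induction N rule: less_induct)
      case (less N)
      consider "N = 0" | "1 \<le> N" "N < N0" | "1 \<le> N" "N0 \<le> N" by linarith
      then show ?case
      proof cases
        case 1
        then show ?thesis using r by (simp add: moment_def birkhoff_sum_def zero_power)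
      next
        case 2
        have "moment r N \<le> (\<Sum>N<N0. moment r N)" using 2 mom0 by (intro member_le_sum) auto
        also have "\<dots> \<le> B * 1" using D by (simp add: B_def)
        also have "\<dots> \<le> B * sqrt (real N) ^ r" using 2 B_nonneg by (intro mult_left_mono one_le_power) auto
        finally show ?thesis .
      next
        case 3
        have "sqrt (real (h N)) ^ r \<le> sqrt (real N / 2) ^ r"
          using h[of N] by (intro power_mono) auto
        also have "\<dots> = sqrt (real N) ^ r * (1 / sqrt 2) ^ r"
          by (simp add: real_sqrt_divide power_divide)
        also have "(1 / sqrt 2) ^ r \<le> (1 / sqrt 2) ^ 4" using r by (intro power_decreasing) auto
        also have "(1 / sqrt 2) ^ 4 = (1 / 4 :: real)"
          by (simp add: power_divide power4_eq_xxxx)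
        finally have half: "sqrt (real (h N)) ^ r \<le> sqrt (real N) ^ r / 4"
          by (simp add: mult_left_mono)
        have "moment r N \<le> 3 * moment r (h N) + D * sqrt (real N) ^ r" using N0 3 by simp
        also have "moment r (h N) \<le> B * sqrt (real (h N)) ^ r"
          using h[of N] 3 by (intro less) auto
        also have "\<dots> \<le> B * (sqrt (real N) ^ r / 4)" using half B_nonneg by (rule mult_left_mono)
        also have "D * sqrt (real N) ^ r \<le> B / 4 * sqrt (real N) ^ r"
          using BD by (intro mult_right_mono) auto
        finally show ?thesis by simp
      qed
    qed
    then show ?thesis using B_nonneg unfolding r_def by blast
  qed
qed

lemma abs_moment_bounded: "\<exists>B\<ge>0. \<forall>n. abs_moment r n \<le> B * sqrt (real n) ^ r"
proof -
  obtain B where "B \<ge> 0" "\<And>n. moment (2 * r) n \<le> B * sqrt (real n) ^ (2 * r)"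
    using even_moment_bounded by blast
  then have "abs_moment r n \<le> (1 + B) * sqrt (real n) ^ r" for n
    by (intro abs_moment_interpolation) auto
  with \<open>B \<ge> 0\<close> show ?thesis by (intro exI[of _ "1 + B"]) auto
qed

text \<open>
  Let \<open>e\<close> be the distance of the normalised moment from its putative limit. Subtracting the exact
  recursion of the Gaussian moments gives \<open>e(N) = 2 \<kappa> e(h) + o(1)\<close> with \<open>\<kappa> \<longrightarrow> 2\<^bsup>-r/2\<^esup>\<close>, and
  \<open>2 \<cdot> 2\<^bsup>-3/2\<^esup> < 3/4\<close>.
\<close>

lemma moment_tendsto: "(\<lambda>n. moment r n / sqrt (real n) ^ r) \<longlonglongrightarrow> gaussian_moment \<sigma> r"
proof (induction r rule: less_induct)
  case (less r)
  let ?G = "gaussian_moment \<sigma>"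
  consider "r = 0" | "r = 1" | "r = 2" | "3 \<le> r" by linarith
  then show ?case
  proof cases
    case 3
    then have "(\<lambda>n. moment r n / sqrt (real n) ^ r) = (\<lambda>n. (1 / real n) * (LINT x|M. (S n x)\<^sup>2))"
      by (simp add: moment_def)
    then show ?thesis using variance_limit 3 by (simp add: gaussian_moment_def)
  next
    case 4
    define m where "m a n = moment a n / sqrt (real n) ^ a" for a n
    have IH: "m a \<longlonglongrightarrow> ?G a" if "a < r" for a
      unfolding m_def[abs_def] by (rule less[OF that])
    obtain B where B: "0 \<le> B" "\<And>n. abs_moment r n \<le> B * sqrt (real n) ^ r"
      using abs_moment_bounded by blast
    obtain h :: "nat \<Rightarrow> nat" where h: "\<And>N. 2 * h N \<le> N" "(\<lambda>N. real (h N) / real N) \<longlonglongrightarrow> 1 / 2" and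
      rec: "\<And>\<epsilon>. 0 < \<epsilon> \<Longrightarrow> \<forall>\<^sub>F N in sequentially.
        \<bar>moment r N - (\<Sum>a\<le>r. real (r choose a) * moment a (h N) * moment (r - a) (h N))\<bar>
        \<le> \<epsilon> * (abs_moment r (h N) + sqrt (real N) ^ r)"
      by (rule moment_recursion[of r]) (use 4 in auto)
    have "filterlim (\<lambda>N. real (h N) / real N * real N) at_top sequentially"
      using h(2) by (intro filterlim_tendsto_pos_mult_at_top filterlim_real_sequentially) auto
    moreover have "real (h N) / real N * real N = real (h N)" for N
      using h(1)[of N] by (cases "N = 0") auto
    ultimately have "filterlim (\<lambda>N. real (h N)) at_top sequentially" by simp
    then have h_top: "filterlim h sequentially sequentially"
      by (simp add: filterlim_sequentially_iff_filterlim_real)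
    define \<kappa> where "\<kappa> N = (sqrt (real (h N)) / sqrt (real N)) ^ r" for N
    have \<kappa>: "\<kappa> \<longlonglongrightarrow> (1 / sqrt 2) ^ r"
    proof -
      have "(\<lambda>N. sqrt (real (h N) / real N) ^ r) \<longlonglongrightarrow> sqrt (1 / 2) ^ r"
        by (intro tendsto_intros h(2))
      then show ?thesis by (simp add: \<kappa>_def[abs_def] real_sqrt_divide)
    qed
    define Q where "Q n = (\<Sum>a\<in>{1..<r}. real (r choose a) * m a n * m (r - a) n)" for n
    define Q' where "Q' = (\<Sum>a\<in>{1..<r}. real (r choose a) * ?G a * ?G (r - a))"
    have Q: "Q \<longlonglongrightarrow> Q'"
      unfolding Q_def[abs_def] Q'_def by (intro tendsto_intros IH) auto
    \<comment> \<open>\<open>Q\<close> collects the terms with lower moments, which converge by the induction hypothesis.\<close>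
    have split: "{..r} = insert 0 (insert r {1..<r})" using 4 by auto
    have Q': "2 * ?G r + Q' = sqrt 2 ^ r * ?G r"
      using gaussian_moment_convolution[of r \<sigma>] 4
      unfolding split Q'_def by (simp add: gaussian_moment_def[of _ 0])
    define \<delta> where "\<delta> N = m r N - \<kappa> N * (2 * m r (h N) + Q (h N))" for N
    have \<delta>: "\<delta> \<longlonglongrightarrow> 0"
    proof (rule tendstoI)
      fix \<epsilon> :: real assume \<epsilon>: "0 < \<epsilon>"
      define \<epsilon>' where "\<epsilon>' = \<epsilon> / (2 * (B + 1))"
      have \<epsilon>': "0 < \<epsilon>'" "\<epsilon>' * (B + 1) < \<epsilon>" using \<epsilon> B by (auto simp: \<epsilon>'_def field_simps add_pos_nonneg)
      have "\<forall>\<^sub>F N in sequentially. 1 \<le> h N"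
        using h_top unfolding filterlim_at_top by blast
      then show "\<forall>\<^sub>F N in sequentially. dist (\<delta> N) 0 < \<epsilon>"
        using rec[OF \<epsilon>'(1)]
      proof eventually_elim
        case (elim N)
        have N: "1 \<le> N" using elim h(1)[of N] by linarith
        define y where "y = sqrt (real N)"
        define w where "w = sqrt (real (h N))"
        have yw: "0 < y" "0 < w" "w \<le> y" using N elim h(1)[of N] by (auto simp: y_def w_def)
        have mm: "moment a (h N) = m a (h N) * w ^ a" for a
          using yw by (simp add: m_def w_def)
        have "(\<Sum>a\<le>r. real (r choose a) * moment a (h N) * moment (r - a) (h N))
            = (\<Sum>a\<le>r. w ^ r * (real (r choose a) * m a (h N) * m (r - a) (h N)))"
        proof (rule sum.cong)
          fix a assume "a \<in> {..r}"
          then have ww: "w ^ a * w ^ (r - a) = w ^ r" by (simp flip: power_add)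
          have "real (r choose a) * moment a (h N) * moment (r - a) (h N)
              = (w ^ a * w ^ (r - a)) * (real (r choose a) * m a (h N) * m (r - a) (h N))"
            unfolding mm by (simp only: mult_ac)
          then show "real (r choose a) * moment a (h N) * moment (r - a) (h N)
              = w ^ r * (real (r choose a) * m a (h N) * m (r - a) (h N))"
            by (simp only: ww)
        qed simp
        also have "\<dots> = w ^ r * (2 * m r (h N) + Q (h N))"
        proof -
          have "m 0 (h N) = 1" by (simp add: m_def)
          then have "(\<Sum>a\<le>r. real (r choose a) * m a (h N) * m (r - a) (h N)) = 2 * m r (h N) + Q (h N)"
            unfolding split Q_def using 4 by simp
          then show ?thesis by (simp flip: sum_distrib_left)
        qed
        finally have "\<delta> N = (moment r N - (\<Sum>a\<le>r. real (r choose a) * moment a (h N) * moment (r - a) (h N))) / y ^ r"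
          using yw by (simp add: \<delta>_def m_def[of r N] \<kappa>_def power_divide diff_divide_distrib flip: y_def w_def)
        then have "\<bar>\<delta> N\<bar> \<le> \<epsilon>' * (abs_moment r (h N) + y ^ r) / y ^ r"
          using elim yw by (simp add: abs_divide divide_right_mono y_def)
        also have "\<dots> \<le> \<epsilon>' * (B * y ^ r + y ^ r) / y ^ r"
        proof -
          have "abs_moment r (h N) \<le> B * w ^ r" using B(2)[of "h N"] by (simp add: w_def)
          also have "\<dots> \<le> B * y ^ r" using B yw by (intro mult_left_mono power_mono) auto
          finally show ?thesis
            using \<epsilon>' yw by (intro divide_right_mono mult_left_mono) auto
        qed
        also have "\<dots> = \<epsilon>' * (B + 1)" using yw by (simp add: field_simps)
        finally show ?case using \<epsilon>'(2) by simp
      qed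
    qed
    define \<delta>' where "\<delta>' N = \<bar>2 * \<kappa> N * ?G r + \<kappa> N * Q (h N) + \<delta> N - ?G r\<bar>" for N
    have \<delta>': "\<delta>' \<longlonglongrightarrow> 0"
    proof -
      have "(\<lambda>N. 2 * \<kappa> N * ?G r + \<kappa> N * Q (h N) + \<delta> N - ?G r)
          \<longlonglongrightarrow> 2 * (1 / sqrt 2) ^ r * ?G r + (1 / sqrt 2) ^ r * Q' + 0 - ?G r"
        by (intro tendsto_intros \<kappa> \<delta> filterlim_compose[OF Q h_top])
      also have "2 * (1 / sqrt 2) ^ r * ?G r + (1 / sqrt 2) ^ r * Q' + 0 - ?G r
          = (1 / sqrt 2) ^ r * (2 * ?G r + Q') - ?G r" by (simp add: algebra_simps)
      also have "\<dots> = 0" unfolding Q' by (simp add: power_divide)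
      finally show ?thesis unfolding \<delta>'_def[abs_def] by (rule tendsto_rabs_zero)
    qed
    define e where "e N = m r N - ?G r" for N
    have m_bdd: "\<bar>m r N\<bar> \<le> B" for N
    proof (cases "N = 0")
      case True
      then show ?thesis using 4 B by (simp add: m_def zero_power)
    next
      case False
      then have "\<bar>moment r N\<bar> \<le> B * sqrt (real N) ^ r"
        using moment_le_abs_moment[of r N] B(2)[of N] by linarith
      then show ?thesis using False by (simp add: m_def abs_divide field_simps)
    qed
    have "e \<longlonglongrightarrow> 0"
    proof (rule contraction_tendsto_0)
      show "\<bar>e n\<bar> \<le> B + \<bar>?G r\<bar>" for n
        unfolding e_def using m_bdd[of n] by linarith
      show "(0::real) \<le> 3 / 4" "(3 / 4 :: real) < 1" by auto
      show "filterlim h sequentially sequentially" "\<delta>' \<longlonglongrightarrow> 0" by fact+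
      have "2 * (1 / sqrt 2) ^ r \<le> 2 * (1 / sqrt 2 :: real) ^ 3"
        using 4 by (intro mult_left_mono power_decreasing) auto
      also have "\<dots> = 1 / sqrt 2" by (simp add: power3_eq_cube field_simps)
      also have "\<dots> < 3 / 4"
      proof -
        have "sqrt ((4 / 3)\<^sup>2) < sqrt 2" by (intro real_sqrt_less_mono) (simp add: power2_eq_square)
        then have "4 / 3 < sqrt 2" by simp
        then show ?thesis by (simp add: field_simps)
      qed
      finally have "2 * (1 / sqrt 2) ^ r < (3 / 4 :: real)" .
      moreover have "(\<lambda>N. 2 * \<kappa> N) \<longlonglongrightarrow> 2 * (1 / sqrt 2) ^ r" by (intro tendsto_intros \<kappa>)
      ultimately have "\<forall>\<^sub>F N in sequentially. 2 * \<kappa> N < 3 / 4"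
        by (intro order_tendstoD)
      then show "\<forall>\<^sub>F N in sequentially. \<bar>e N\<bar> \<le> 3 / 4 * \<bar>e (h N)\<bar> + \<delta>' N"
      proof eventually_elim
        case (elim N)
        have "e N = 2 * \<kappa> N * e (h N) + (2 * \<kappa> N * ?G r + \<kappa> N * Q (h N) + \<delta> N - ?G r)"
          by (simp add: e_def \<delta>_def algebra_simps)
        then have "\<bar>e N\<bar> \<le> \<bar>2 * \<kappa> N * e (h N)\<bar> + \<delta>' N"
          unfolding \<delta>'_def by linarith
        also have "\<bar>2 * \<kappa> N * e (h N)\<bar> = 2 * \<kappa> N * \<bar>e (h N)\<bar>"
          by (simp add: abs_mult \<kappa>_def)
        also have "\<dots> \<le> 3 / 4 * \<bar>e (h N)\<bar>"
          using elim by (intro mult_right_mono) auto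
        finally show ?case by simp
      qed
    qed
    then have "m r \<longlonglongrightarrow> ?G r"
      unfolding e_def[abs_def] by (simp add: LIM_zero_iff)
    then show ?thesis unfolding m_def .
  qed (simp_all add: gaussian_moment_def)
qed

end

section \<open>The method of moments\<close>

text \<open>
  The Taylor polynomial of degree \<open>2 s\<close> of a characteristic function differs from it by at most
  \<open>2 \<bar>t\<bar>\<^bsup>2s\<^esup> m\<^bsub>2s\<^esub> / (2s)!\<close>. By \<open>growth\<close> this is small for the limit law when \<open>s\<close> is large, and then, since the
  moments converge, also for \<open>\<mu> n\<close> with large \<open>n\<close>.
\<close>

lemma weak_conv_from_moments:
  fixes \<mu> :: "nat \<Rightarrow> real measure" and \<nu> :: "real measure"
  assumes rd: "\<And>n. real_distribution (\<mu> n)" "real_distribution \<nu>"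
    and int: "\<And>n r. integrable (\<mu> n) (\<lambda>x. x ^ r)" "\<And>r. integrable \<nu> (\<lambda>x. x ^ r)"
    and conv: "\<And>r. (\<lambda>n. LINT x|\<mu> n. x ^ r) \<longlonglongrightarrow> (LINT x|\<nu>. x ^ r)"
    and growth: "\<And>t :: real. (\<lambda>s. \<bar>t\<bar> ^ (2 * s) / fact (2 * s) * (LINT x|\<nu>. x ^ (2 * s))) \<longlonglongrightarrow> 0"
  shows "weak_conv_m \<mu> \<nu>"
proof (rule levy_continuity[OF rd], rule tendstoI)
  fix t \<epsilon> :: real assume \<epsilon>: "0 < \<epsilon>"
  define taylor where "taylor s L = (\<Sum>k\<le>2 * s. ((\<i> * t) ^ k / fact k) * complex_of_real (L k))"
    for s and L :: "nat \<Rightarrow> real"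
  have approx: "cmod (char P t - taylor s (\<lambda>k. LINT x|P. x ^ k))
      \<le> 2 * (\<bar>t\<bar> ^ (2 * s) / fact (2 * s) * (LINT x|P. x ^ (2 * s)))"
    if "real_distribution P" "\<And>r. integrable P (\<lambda>x. x ^ r)" for P s
    using real_distribution.char_approx1[OF that(1), of "2 * s" t] that(2)
    by (simp add: taylor_def power_even_abs)
  have "\<forall>\<^sub>F s in sequentially. \<bar>t\<bar> ^ (2 * s) / fact (2 * s) * (LINT x|\<nu>. x ^ (2 * s)) < \<epsilon> / 6"
    using \<epsilon> by (intro order_tendstoD[OF growth]) auto
  then obtain s where s: "\<bar>t\<bar> ^ (2 * s) / fact (2 * s) * (LINT x|\<nu>. x ^ (2 * s)) < \<epsilon> / 6"
    by (auto simp: eventually_sequentially)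
  have "(\<lambda>n. \<bar>t\<bar> ^ (2 * s) / fact (2 * s) * (LINT x|\<mu> n. x ^ (2 * s)))
      \<longlonglongrightarrow> \<bar>t\<bar> ^ (2 * s) / fact (2 * s) * (LINT x|\<nu>. x ^ (2 * s))"
    by (intro tendsto_intros conv)
  then have ev1: "\<forall>\<^sub>F n in sequentially. \<bar>t\<bar> ^ (2 * s) / fact (2 * s) * (LINT x|\<mu> n. x ^ (2 * s)) < \<epsilon> / 6"
    using s by (rule order_tendstoD)
  have "(\<lambda>n. taylor s (\<lambda>k. LINT x|\<mu> n. x ^ k)) \<longlonglongrightarrow> taylor s (\<lambda>k. LINT x|\<nu>. x ^ k)"
    unfolding taylor_def by (intro tendsto_intros conv)
  then have ev2: "\<forall>\<^sub>F n in sequentially.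
      dist (taylor s (\<lambda>k. LINT x|\<mu> n. x ^ k)) (taylor s (\<lambda>k. LINT x|\<nu>. x ^ k)) < \<epsilon> / 3"
    by (rule tendstoD) (use \<epsilon> in simp)
  show "\<forall>\<^sub>F n in sequentially. dist (char (\<mu> n) t) (char \<nu> t) < \<epsilon>"
    using ev1 ev2
  proof eventually_elim
    case (elim n)
    have "dist (char (\<mu> n) t) (taylor s (\<lambda>k. LINT x|\<mu> n. x ^ k)) < \<epsilon> / 3"
      using approx[OF rd(1) int(1), of n s] elim(1) unfolding dist_norm by linarith
    moreover have "dist (char \<nu> t) (taylor s (\<lambda>k. LINT x|\<nu>. x ^ k)) < \<epsilon> / 3"
      using approx[OF rd(2) int(2), of s] s unfolding dist_norm by linarith
    ultimately show ?case
      using elim(2) dist_triangle[of "char (\<mu> n) t" "char \<nu> t" "taylor s (\<lambda>k. LINT x|\<mu> n. x ^ k)"]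
        dist_triangle[of "taylor s (\<lambda>k. LINT x|\<mu> n. x ^ k)" "char \<nu> t" "taylor s (\<lambda>k. LINT x|\<nu>. x ^ k)"]
      by (simp add: dist_commute)
  qed
qed

lemma real_distribution_centered_gaussian:
  "0 \<le> \<sigma> \<Longrightarrow> real_distribution (centered_gaussian \<sigma>)"
  using prob_space_normal_density[of \<sigma> 0]
  by (auto simp: centered_gaussian_def real_distribution_def real_distribution_axioms_def prob_space_return)

lemma moment_centered_gaussian:
  assumes "0 \<le> \<sigma>"
  shows "has_bochner_integral (centered_gaussian \<sigma>) (\<lambda>x. x ^ r) (gaussian_moment \<sigma> r)"
proof (cases "\<sigma> = 0")
  case True
  then have "integrable (centered_gaussian \<sigma>) (\<lambda>x. x ^ r)"
    using prob_space.finite_measure[OF prob_space_return[of 0 "borel :: real measure"]]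
    by (auto simp: centered_gaussian_def integrable_iff_bounded nn_integral_return)
  moreover have "(LINT x|centered_gaussian \<sigma>. x ^ r) = gaussian_moment \<sigma> r"
    using True by (cases "r = 0") (auto simp: centered_gaussian_def gaussian_moment_def integral_return zero_power measure_return)
  ultimately show ?thesis by (simp add: has_bochner_integral_iff)
next
  case False
  then have \<sigma>: "0 < \<sigma>" using assms by simp
  have "has_bochner_integral lborel (\<lambda>x. normal_density 0 \<sigma> x * x ^ r) (gaussian_moment \<sigma> r)"
  proof (cases "even r")
    case True
    then obtain k where k: "r = 2 * k" by (elim evenE)
    have "fact (2 * k) / ((2 / \<sigma>\<^sup>2) ^ k * fact k) = gaussian_moment \<sigma> r"
      using \<sigma> by (simp add: gaussian_moment_def k power_divide power_mult)
    then show ?thesis using normal_moment_even[OF \<sigma>, of 0 k] by (simp add: k)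
  next
    case False
    then obtain k where k: "r = 2 * k + 1" by (elim oddE)
    then show ?thesis using normal_moment_odd[OF \<sigma>, of 0 k] by (simp add: gaussian_moment_def)
  qed
  then have "has_bochner_integral (density lborel (normal_density 0 \<sigma>)) (\<lambda>x. x ^ r) (gaussian_moment \<sigma> r)"
    by (intro has_bochner_integral_density) (auto simp: normal_density_nonneg)
  then show ?thesis using False by (simp add: centered_gaussian_def)
qed

lemma gaussian_moment_growth:
  "(\<lambda>s. \<bar>t\<bar> ^ (2 * s) / fact (2 * s) * gaussian_moment \<sigma> (2 * s)) \<longlonglongrightarrow> 0"
proof -
  have "(\<lambda>s. inverse (fact s) * (t\<^sup>2 * \<sigma>\<^sup>2 / 2) ^ s) \<longlonglongrightarrow> 0"
    by (rule summable_LIMSEQ_zero[OF summable_exp])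
  moreover have "inverse (fact s) * (t\<^sup>2 * \<sigma>\<^sup>2 / 2) ^ s
      = \<bar>t\<bar> ^ (2 * s) / fact (2 * s) * gaussian_moment \<sigma> (2 * s)" for s
  proof -
    have "\<bar>t\<bar> ^ (2 * s) = (t\<^sup>2) ^ s" "\<sigma> ^ (2 * s) = (\<sigma>\<^sup>2) ^ s" by (simp_all add: power_mult)
    then show ?thesis
      by (simp add: gaussian_moment_def power_divide power_mult_distrib inverse_eq_divide)
  qed
  ultimately show ?thesis by simp
qed

lemma (in decorrelated_process) central_limit:
  assumes "0 \<le> \<sigma>"
  shows "weak_conv_m (\<lambda>n. distr M borel (\<lambda>x. S n x / sqrt (real n))) (centered_gaussian \<sigma>)"
proof (rule weak_conv_from_moments)
  note [measurable] = has_moments_measurable[OF S_moments]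
  show "real_distribution (distr M borel (\<lambda>x. S n x / sqrt (real n)))" for n
    by (intro real_distribution_distr) measurable
  show "real_distribution (centered_gaussian \<sigma>)"
    by (rule real_distribution_centered_gaussian[OF assms])
  show "integrable (distr M borel (\<lambda>x. S n x / sqrt (real n))) (\<lambda>x. x ^ r)" for n r
    using has_moments_integrable[OF has_moments_power[OF S_moments]]
    by (subst integrable_distr_eq) (auto simp: power_divide)
  show "integrable (centered_gaussian \<sigma>) (\<lambda>x. x ^ r)" for r
    using moment_centered_gaussian[OF assms] by (rule integrable.intros)
  have G: "(LINT x|centered_gaussian \<sigma>. x ^ r) = gaussian_moment \<sigma> r" for r
    by (rule has_bochner_integral_integral_eq[OF moment_centered_gaussian[OF assms]])
  show "(\<lambda>n. LINT x|distr M borel (\<lambda>x. S n x / sqrt (real n)). x ^ r)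
      \<longlonglongrightarrow> (LINT x|centered_gaussian \<sigma>. x ^ r)" for r
    using moment_tendsto[of r] unfolding G
    by (subst integral_distr) (auto simp: power_divide moment_def)
  show "(\<lambda>s. \<bar>t\<bar> ^ (2 * s) / fact (2 * s) * (LINT x|centered_gaussian \<sigma>. x ^ (2 * s))) \<longlonglongrightarrow> 0" for t
    unfolding G by (rule gaussian_moment_growth)
qed

section \<open>The asymptotic variance\<close>

text \<open>
  With \<open>c k\<close> the autocorrelations and \<open>L = c 0 + 2 \<Sum>\<^bsub>k \<ge> 1\<^esub> c k\<close>, the second moments have increments
  \<open>L + O(\<theta>\<^sup>n)\<close>, hence differ from \<open>n L\<close> by a bounded amount.
\<close>

lemma (in invariant_map) variance_limit_exists:
  fixes D \<theta> :: real
  assumes mom: "has_moments M X" and \<theta>: "0 < \<theta>" "\<theta> < 1"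
    and decay: "\<And>k. \<bar>LINT x|M. X x * X ((f ^^ k) x)\<bar> \<le> D * \<theta> ^ k"
  shows "\<exists>\<sigma>\<ge>0. (\<lambda>n. (1 / real n) * (LINT x|M. (birkhoff_sum f X n x)\<^sup>2)) \<longlonglongrightarrow> \<sigma>\<^sup>2"
proof -
  define c where "c k = (LINT x|M. X x * X ((f ^^ k) x))" for k
  define a where "a n = (LINT x|M. (birkhoff_sum f X n x)\<^sup>2)" for n
  have D: "0 \<le> D" using order_trans[OF abs_ge_zero decay[of 0]] by simp
  have c_shift: "(LINT x|M. X ((f ^^ i) x) * X ((f ^^ n) x)) = c (n - i)" if "i \<le> n" for i n
  proof -
    have "(LINT x|M. (\<lambda>y. X y * X ((f ^^ (n - i)) y)) ((f ^^ i) x)) = c (n - i)"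
      unfolding c_def
      by (intro integral_funpow has_moments_measurable[OF has_moments_mult] has_moments_funpow mom)
    moreover have "(f ^^ (n - i)) ((f ^^ i) x) = (f ^^ n) x" for x
      using that by (metis comp_apply funpow_add le_add_diff_inverse2)
    ultimately show ?thesis by simp
  qed
  have inc: "a (Suc n) = a n + (c 0 + 2 * (\<Sum>j<n. c (Suc j)))" for n
  proof -
    have 1: "integrable M (\<lambda>x. (birkhoff_sum f X n x)\<^sup>2)"
      "integrable M (\<lambda>x. X ((f ^^ n) x) * X ((f ^^ n) x))"
      "integrable M (\<lambda>x. X ((f ^^ i) x) * X ((f ^^ n) x))" for i
      using mom by (auto intro!: has_moments_integrable has_moments_intros has_moments_funpow birkhoff_sum_has_moments)
    have "(birkhoff_sum f X (Suc n) x)\<^sup>2 = (birkhoff_sum f X n x)\<^sup>2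
        + (X ((f ^^ n) x) * X ((f ^^ n) x) + 2 * (\<Sum>i<n. X ((f ^^ i) x) * X ((f ^^ n) x)))" for x
      by (simp add: birkhoff_sum_def power2_eq_square algebra_simps sum_distrib_left sum_distrib_right)
    then have "a (Suc n) = a n + (c 0 + 2 * (\<Sum>i<n. c (n - i)))"
      unfolding a_def using 1 c_shift[of n n]
      by (simp add: Bochner_Integration.integral_sum c_shift)
    also have "(\<Sum>i<n. c (n - i)) = (\<Sum>j<n. c (Suc j))"
      using sum.nat_diff_reindex[of "\<lambda>j. c (Suc j)" n, symmetric] by (simp add: Suc_diff_Suc)
    finally show ?thesis .
  qed
  have sum_c: "summable (\<lambda>j. c (Suc j))"
  proof (rule summable_comparison_test')
    show "summable (\<lambda>j. D * \<theta> * \<theta> ^ j)" using \<theta> by (intro summable_mult summable_geometric) auto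
    show "norm (c (Suc j)) \<le> D * \<theta> * \<theta> ^ j" for j using decay[of "Suc j"] by (simp add: c_def)
  qed
  define L where "L = c 0 + 2 * (\<Sum>j. c (Suc j))"
  define D' where "D' = 2 * D * \<theta> / (1 - \<theta>)"
  have tail: "\<bar>(a (Suc n) - a n) - L\<bar> \<le> D' * \<theta> ^ n" for n
  proof -
    have "(a (Suc n) - a n) - L = - 2 * (\<Sum>j. c (Suc (j + n)))"
      using suminf_minus_initial_segment[OF sum_c, of n] by (simp add: inc L_def algebra_simps)
    moreover have "\<bar>\<Sum>j. c (Suc (j + n))\<bar> \<le> (\<Sum>j. D * \<theta> * \<theta> ^ n * \<theta> ^ j)"
      unfolding real_norm_def[symmetric]
    proof (rule norm_suminf_le)
      show "summable (\<lambda>j. D * \<theta> * \<theta> ^ n * \<theta> ^ j)" using \<theta> by (intro summable_mult summable_geometric) auto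
      show "norm (c (Suc (j + n))) \<le> D * \<theta> * \<theta> ^ n * \<theta> ^ j" for j
        using decay[of "Suc (j + n)"] by (simp add: c_def power_add mult_ac)
    qed
    moreover have "(\<Sum>j. D * \<theta> * \<theta> ^ n * \<theta> ^ j) = D * \<theta> * \<theta> ^ n * (1 / (1 - \<theta>))"
      using \<theta> by (subst suminf_mult) (auto simp: suminf_geometric)
    ultimately have "\<bar>(a (Suc n) - a n) - L\<bar> \<le> 2 * (D * \<theta> * \<theta> ^ n * (1 / (1 - \<theta>)))" by linarith
    then show ?thesis by (simp add: D'_def mult_ac)
  qed
  have "\<bar>a n - real n * L\<bar> \<le> (\<Sum>i<n. D' * \<theta> ^ i)" for n
  proof (induction n)
    case 0
    then show ?case by (simp add: a_def birkhoff_sum_def)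
  next
    case (Suc n)
    then show ?case using tail[of n] by (simp add: algebra_simps)
  qed
  moreover have "(\<Sum>i<n. D' * \<theta> ^ i) \<le> D' / (1 - \<theta>)" for n
  proof -
    have "(\<Sum>i<n. D' * \<theta> ^ i) = D' * ((1 - \<theta> ^ n) / (1 - \<theta>))"
      using \<theta> by (simp add: sum_distrib_left[symmetric] sum_gp_strict)
    also have "\<dots> \<le> D' * (1 / (1 - \<theta>))"
      using \<theta> D by (intro mult_left_mono divide_right_mono) (auto simp: D'_def)
    finally show ?thesis by simp
  qed
  ultimately have bound: "\<bar>a n - real n * L\<bar> \<le> D' / (1 - \<theta>)" for n by (meson order_trans)
  have "(\<lambda>n. a n / real n - L) \<longlonglongrightarrow> 0"
  proof (rule Lim_null_comparison)
    show "\<forall>\<^sub>F n in sequentially. norm (a n / real n - L) \<le> D' / (1 - \<theta>) / real n"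
      using eventually_gt_at_top[of 0]
    proof eventually_elim
      case (elim n)
      then have "a n / real n - L = (a n - real n * L) / real n" by (simp add: field_simps)
      moreover have "\<bar>a n - real n * L\<bar> / real n \<le> D' / (1 - \<theta>) / real n"
        using bound[of n] by (intro divide_right_mono) auto
      ultimately show ?case by (simp add: abs_divide)
    qed
    show "(\<lambda>n. D' / (1 - \<theta>) / real n) \<longlonglongrightarrow> 0"
      by (rule tendsto_divide_0[OF tendsto_const filterlim_at_top_imp_at_infinity[OF filterlim_real_sequentially]])
  qed
  then have lim: "(\<lambda>n. a n / real n) \<longlonglongrightarrow> L" by (simp add: LIM_zero_iff)
  moreover have "0 \<le> L"
    by (rule LIMSEQ_le_const[OF lim]) (auto simp: a_def)
  ultimately show ?thesis
    by (intro exI[of _ "sqrt L"]) (simp add: a_def)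
qed

section \<open>The central limit theorem\<close>

lemma Lq_norm_le_power:
  assumes "Lq_norm_le M (real q) \<phi> b" "1 \<le> q"
  shows "\<phi> \<in> borel_measurable M" "integrable M (\<lambda>x. \<bar>\<phi> x\<bar> ^ q)" "(LINT x|M. \<bar>\<phi> x\<bar> ^ q) \<le> b ^ q"
proof -
  have eq: "\<bar>\<phi> x\<bar> powr real q = \<bar>\<phi> x\<bar> ^ q" for x
    using assms(2) by (simp add: powr_realpow')
  show "\<phi> \<in> borel_measurable M" "integrable M (\<lambda>x. \<bar>\<phi> x\<bar> ^ q)"
    using assms(1) by (auto simp: Lq_norm_le_def eq)
  let ?I = "LINT x|M. \<bar>\<phi> x\<bar> ^ q"
  have I: "0 \<le> ?I" by simp
  have "?I = (?I powr (1 / real q)) ^ q"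
    using assms(2) I by (simp add: powr_powr flip: powr_realpow')
  also have "\<dots> \<le> b ^ q"
    using assms(1) by (intro power_mono) (auto simp: Lq_norm_le_def Lq_norm_def eq)
  finally show "?I \<le> b ^ q" .
qed

lemma orbit_in_space:
  fixes NA :: "('a \<Rightarrow> real) \<Rightarrow> real" and K :: real
  assumes "\<forall>\<phi>\<in>A. \<phi> \<circ> f \<in> A" "\<forall>\<phi>\<in>A. NA (\<phi> \<circ> f) \<le> K * NA \<phi>" "1 \<le> K" "\<phi> \<in> A"
  shows "(\<lambda>x. \<phi> ((f ^^ s) x)) \<in> A \<and> NA (\<lambda>x. \<phi> ((f ^^ s) x)) \<le> K ^ s * NA \<phi>"
proof (induction s)
  case 0
  then show ?case using assms(4) by simp
next
  case (Suc s)
  have eq: "(\<lambda>x. \<phi> ((f ^^ Suc s) x)) = (\<lambda>x. \<phi> ((f ^^ s) x)) \<circ> f"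
    by (auto simp: fun_eq_iff funpow_swap1)
  have "NA ((\<lambda>x. \<phi> ((f ^^ s) x)) \<circ> f) \<le> K * NA (\<lambda>x. \<phi> ((f ^^ s) x))"
    using Suc assms(2) by blast
  also have "\<dots> \<le> K * (K ^ s * NA \<phi>)"
    using Suc assms(3) by (intro mult_left_mono) auto
  finally show ?case using Suc assms(1) unfolding eq by auto
qed

text \<open>
  Apply the controlled tail property to \<open>\<phi> \<circ> f\<^sup>s\<close>, which lies in \<open>A\<close> and has norm at most \<open>K\<^sup>s \<parallel>\<phi>\<parallel>\<close>. The
  bounds contain \<open>1 + T\<close> and \<open>1 + \<parallel>\<phi>\<parallel>\<close> in place of \<open>T\<close> and \<open>\<parallel>\<phi>\<parallel>\<close> in order to stay positive when these
  vanish.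
\<close>

lemma controlled_tail_orbit_approximation:
  assumes inv: "invariant_map M f" and nA: "normed_function_space (space M) A NA"
    and A: "\<forall>\<phi>\<in>A. \<phi> \<circ> f \<in> A" "\<forall>\<phi>\<in>A. NA (\<phi> \<circ> f) \<le> K * NA \<phi>" "1 \<le> K"
    and ct: "controlled_tail M f A NA V NB B" and \<phi>: "\<phi> \<in> A"
  obtains c :: real where "1 \<le> c"
    "\<And>q::nat. 1 \<le> q \<Longrightarrow> \<exists>d>0. \<exists>\<theta>>0. \<theta> < 1 \<and> (\<forall>s T :: nat. \<exists>w.
      cone_span (space M) B NB (c * (1 + real T) * K ^ s) w \<and>
      (LINT x|M. \<bar>\<phi> ((f ^^ s) x) - w x\<bar> ^ q) \<le> (d * \<theta> ^ T * K ^ s) ^ q)"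
proof -
  have tc: "tail_cone M f V NB B"
    using ct unfolding controlled_tail_def by blast
  interpret cone_mixing M f V NB B
    using inv tc by (simp add: cone_mixing_def cone_mixing_axioms_def)
  obtain c0 :: real and \<alpha> d :: "nat \<Rightarrow> real" where data:
    "c0 \<ge> 1 \<and> (\<forall>q\<ge>1. \<alpha> q > 0 \<and> d q > 0) \<and>
     (\<forall>\<psi>\<in>A. \<forall>T::real. T \<ge> 0 \<longrightarrow>
       (\<exists>\<psi>p\<in>B. \<exists>\<psi>m\<in>B. \<exists>\<psi>2.
         (\<forall>x\<in>space M. \<psi> x = \<psi>p x - \<psi>m x + \<psi>2 x) \<and>
         NB \<psi>p \<le> c0 * T * NA \<psi> \<and> NB \<psi>m \<le> c0 * T * NA \<psi> \<and>
         (\<forall>q\<ge>1. Lq_norm_le M (real q) \<psi>2 (d q * exp (- \<alpha> q * T) * NA \<psi>))))"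
    using ct unfolding controlled_tail_def by (elim conjE exE) (rule that, intro conjI)
  have c0: "1 \<le> c0" and \<alpha>d: "\<And>q. 1 \<le> q \<Longrightarrow> \<alpha> q > 0 \<and> d q > 0"
    using data by simp_all
  note dec = data[THEN conjunct2, THEN conjunct2, rule_format]
  have NA0: "0 \<le> NA \<phi>"
    using nA \<phi> by (simp add: normed_function_space_def)
  define c where "c = 2 * (c0 * (1 + NA \<phi>))"
  have "1 * 1 \<le> c0 * (1 + NA \<phi>)" using c0 NA0 by (intro mult_mono) auto
  then have c: "1 \<le> c" by (simp add: c_def)
  have "\<exists>w. cspan (c * (1 + real T) * K ^ s) w \<and>
      (LINT x|M. \<bar>\<phi> ((f ^^ s) x) - w x\<bar> ^ q) \<le> (d q * (1 + NA \<phi>) * exp (- \<alpha> q) ^ T * K ^ s) ^ q"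
    if q: "1 \<le> q" for q s T :: nat
  proof -
    let ?\<psi> = "\<lambda>x. \<phi> ((f ^^ s) x)"
    have \<psi>: "?\<psi> \<in> A" "NA ?\<psi> \<le> K ^ s * NA \<phi>"
      using orbit_in_space[OF A \<phi>, of s] by auto
    have Ks: "0 < K ^ s" using A(3) by simp
    have NA\<psi>: "NA ?\<psi> \<le> K ^ s * (1 + NA \<phi>)"
      using \<psi>(2) Ks by (simp add: algebra_simps)
    have NA\<psi>0: "0 \<le> NA ?\<psi>"
      using nA \<psi>(1) by (simp add: normed_function_space_def)
    obtain \<psi>p \<psi>m \<psi>2 where split: "\<psi>p \<in> B" "\<psi>m \<in> B"
      "\<forall>x\<in>space M. ?\<psi> x = \<psi>p x - \<psi>m x + \<psi>2 x"
      "NB \<psi>p \<le> c0 * real T * NA ?\<psi>" "NB \<psi>m \<le> c0 * real T * NA ?\<psi>"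
      "\<forall>q\<ge>1. Lq_norm_le M (real q) \<psi>2 (d q * exp (- \<alpha> q * real T) * NA ?\<psi>)"
      using dec[OF \<psi>(1) of_nat_0_le_iff, of T] by (elim bexE exE conjE) (rule that)
    have \<psi>2: "Lq_norm_le M (real q) \<psi>2 (d q * exp (- \<alpha> q * real T) * NA ?\<psi>)"
      using split(6) q by simp
    define R where "R = c0 * (1 + real T) * (K ^ s * (1 + NA \<phi>))"
    have R: "0 < R" using c0 Ks NA0 by (simp add: R_def)
    have "c0 * real T * NA ?\<psi> \<le> R"
      unfolding R_def using c0 NA\<psi> NA\<psi>0 by (intro mult_mono) auto
    then have "cspan (R + R) (\<lambda>x. \<psi>p x - \<psi>m x)"
      using split R by (intro span_diff span_cone) auto
    moreover have "R + R = c * (1 + real T) * K ^ s" by (simp add: R_def c_def algebra_simps)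
    ultimately have "cspan (c * (1 + real T) * K ^ s) (\<lambda>x. \<psi>p x - \<psi>m x)" by simp
    moreover have "(LINT x|M. \<bar>?\<psi> x - (\<psi>p x - \<psi>m x)\<bar> ^ q) \<le> (d q * (1 + NA \<phi>) * exp (- \<alpha> q) ^ T * K ^ s) ^ q"
    proof -
      have "(LINT x|M. \<bar>?\<psi> x - (\<psi>p x - \<psi>m x)\<bar> ^ q) = (LINT x|M. \<bar>\<psi>2 x\<bar> ^ q)"
        by (intro Bochner_Integration.integral_cong) (auto simp: split(3))
      also have "\<dots> \<le> (d q * exp (- \<alpha> q * real T) * NA ?\<psi>) ^ q"
        by (rule Lq_norm_le_power(3)[OF \<psi>2 q])
      also have "exp (- \<alpha> q * real T) = exp (- \<alpha> q) ^ T"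
        by (simp add: exp_of_nat_mult[symmetric] mult.commute)
      also have "(d q * exp (- \<alpha> q) ^ T * NA ?\<psi>) ^ q \<le> (d q * exp (- \<alpha> q) ^ T * (K ^ s * (1 + NA \<phi>))) ^ q"
        using \<alpha>d[OF q] NA\<psi> NA\<psi>0 by (intro power_mono mult_left_mono) auto
      finally show ?thesis by (simp add: mult_ac)
    qed
    ultimately show ?thesis by blast
  qed
  then have "\<exists>d>0. \<exists>\<theta>>0. \<theta> < 1 \<and> (\<forall>s T :: nat. \<exists>w.
      cspan (c * (1 + real T) * K ^ s) w \<and>
      (LINT x|M. \<bar>\<phi> ((f ^^ s) x) - w x\<bar> ^ q) \<le> (d * \<theta> ^ T * K ^ s) ^ q)" if "1 \<le> q" for q :: nat
    using that \<alpha>d[OF that] NA0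
    by (intro exI[of _ "d q * (1 + NA \<phi>)"] exI[of _ "exp (- \<alpha> q)"] conjI) auto
  with c show ?thesis by (rule that)
qed

theorem theorem4p1:
  fixes M :: "'a measure" and f :: "'a \<Rightarrow> 'a"
    and A :: "('a \<Rightarrow> real) set" and NA :: "('a \<Rightarrow> real) \<Rightarrow> real"
  assumes "prob_space M"
    and "f \<in> M \<rightarrow>\<^sub>M M"
    and "distr M M f = M"
    and "normed_function_space (space M) A NA"
    and "\<forall>\<phi>\<in>A. \<phi> \<circ> f \<in> A"
    and "\<exists>K. \<forall>\<phi>\<in>A. NA (\<phi> \<circ> f) \<le> K * NA \<phi>"
    and "exp_mixing_all_orders M f A NA"
    and "\<exists>V NB B. controlled_tail M f A NA V NB B"
  shows "\<forall>\<phi>\<in>A. satisfies_CLT M f \<phi>"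
proof
  fix \<phi> assume \<phi>: "\<phi> \<in> A"
  interpret invariant_map M f
    using assms(1-3) by (simp add: invariant_map_def invariant_map_axioms_def)
  have NA_nonneg: "0 \<le> NA \<psi>" if "\<psi> \<in> A" for \<psi>
    using assms(4) that by (simp add: normed_function_space_def)
  obtain K0 where K0: "\<forall>\<phi>\<in>A. NA (\<phi> \<circ> f) \<le> K0 * NA \<phi>" using assms(6) by blast
  define K where "K = max 1 K0"
  have K: "1 \<le> K" "\<forall>\<phi>\<in>A. NA (\<phi> \<circ> f) \<le> K * NA \<phi>"
  proof -
    show "1 \<le> K" by (simp add: K_def)
    have "K0 * NA \<psi> \<le> K * NA \<psi>" if "\<psi> \<in> A" for \<psi>
      using NA_nonneg[OF that] by (intro mult_right_mono) (auto simp: K_def)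
    then show "\<forall>\<phi>\<in>A. NA (\<phi> \<circ> f) \<le> K * NA \<phi>" using K0 by (meson order_trans)
  qed
  obtain V NB B where ct: "controlled_tail M f A NA V NB B" using assms(8) by blast
  then interpret cone_mixing M f V NB B
    by unfold_locales (simp add: controlled_tail_def)
  have mom: "has_moments M \<phi>"
  proof -
    have Lq: "\<exists>c'. Lq_norm_le M (real q) \<phi> c'" if "1 \<le> q" for q :: nat
      using assms(7) \<phi> that unfolding exp_mixing_all_orders_def by (metis of_nat_1 of_nat_le_iff)
    have "integrable M (\<lambda>x. \<bar>\<phi> x\<bar> ^ q)" for q
      using Lq[of q] Lq_norm_le_power(2)[of M q \<phi>] by (cases "q = 0") auto
    moreover have "\<phi> \<in> borel_measurable M"
      using Lq[of 1] Lq_norm_le_power(1)[of M 1 \<phi>] by auto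
    ultimately show ?thesis by (simp add: has_moments_def)
  qed
  define m where "m = (LINT y|M. \<phi> y)"
  define X where "X x = \<phi> x - m" for x
  have momX: "has_moments M X"
    unfolding X_def[abs_def] by (intro has_moments_diff has_moments_const mom)
  have EX: "(LINT x|M. X x) = 0"
    unfolding X_def using has_moments_integrable[OF mom] by (simp add: prob_space m_def)
  have S_eq: "birkhoff_sum f X n x = birkhoff_sum f \<phi> n x - real n * m" for n x
    by (simp add: birkhoff_sum_def X_def sum_subtractf)
  obtain \<sigma> where \<sigma>: "0 \<le> \<sigma>"
    "(\<lambda>n. (1 / real n) * (LINT x|M. (birkhoff_sum f X n x)\<^sup>2)) \<longlonglongrightarrow> \<sigma>\<^sup>2"
  proof -
    have "exp_mixing_inequalities M f A NA"
      using assms(7) by (simp add: exp_mixing_all_orders_def)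
    from this[unfolded exp_mixing_inequalities_def, rule_format, OF order_refl]
    obtain C \<theta> :: real where C\<theta>: "0 < C" "0 < \<theta>" "\<theta> < 1" and
      mix: "\<And>(\<psi> :: nat \<Rightarrow> 'a \<Rightarrow> real) (n :: nat \<Rightarrow> nat).
          (\<forall>j\<le>1. \<psi> j \<in> A) \<Longrightarrow> n 0 = 0 \<Longrightarrow> (\<forall>j<1. n j \<le> n (Suc j)) \<Longrightarrow>
          \<bar>(LINT x|M. (\<Prod>j\<le>1. \<psi> j ((f ^^ n j) x))) - (\<Prod>j\<le>1. LINT x|M. \<psi> j x)\<bar>
            \<le> C * \<theta> ^ (Min ((\<lambda>j. n (Suc j) - n j) ` {..<1})) * (\<Prod>j\<le>1. NA (\<psi> j))"
      by blast
    have "\<bar>LINT x|M. X x * X ((f ^^ k) x)\<bar> \<le> (C * (NA \<phi> * NA \<phi>)) * \<theta> ^ k" for k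
    proof -
      have int: "integrable M \<phi>" "integrable M (\<lambda>x. \<phi> ((f ^^ k) x))" "integrable M (\<lambda>x. \<phi> x * \<phi> ((f ^^ k) x))"
        by (intro has_moments_integrable has_moments_mult has_moments_funpow mom)+
      have "(LINT x|M. X x * X ((f ^^ k) x))
          = (LINT x|M. \<phi> x * \<phi> ((f ^^ k) x) - m * \<phi> ((f ^^ k) x) - m * \<phi> x + m * m)"
        by (simp add: X_def algebra_simps)
      also have "\<dots> = (LINT x|M. \<phi> x * \<phi> ((f ^^ k) x)) - m * m"
        using int integral_funpow[OF has_moments_measurable[OF mom], of k]
        by (simp add: prob_space m_def[symmetric])
      finally show ?thesis
        using mix[of "\<lambda>_. \<phi>" "\<lambda>j. j * k"] \<phi> by (simp add: m_def mult_ac lessThan_Suc)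
    qed
    then show ?thesis
      using variance_limit_exists[OF momX C\<theta>(2,3)] that by blast
  qed
  obtain c :: real where c: "1 \<le> c" and approx: "\<And>q::nat. 1 \<le> q \<Longrightarrow> \<exists>d>0. \<exists>\<theta>>0. \<theta> < 1 \<and> (\<forall>s T :: nat. \<exists>w.
      cspan (c * (1 + real T) * K ^ s) w \<and>
      (LINT x|M. \<bar>\<phi> ((f ^^ s) x) - w x\<bar> ^ q) \<le> (d * \<theta> ^ T * K ^ s) ^ q)"
    by (rule controlled_tail_orbit_approximation[OF invariant_map_axioms assms(4,5) K(2,1) ct \<phi>]) blast
  have dec: "\<exists>(C :: real) (\<rho> :: real) (\<Lambda> :: nat). 0 \<le> C \<and> 0 < \<rho> \<and> \<rho> < 1 \<and>
      (\<forall>a b l n g. a + b = r \<longrightarrow> 1 \<le> l \<longrightarrow> \<Lambda> * l \<le> g \<longrightarrow>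
        \<bar>cov M (\<lambda>x. birkhoff_sum f X n x ^ a) (\<lambda>x. birkhoff_sum f X n ((f ^^ (n + g)) x) ^ b)\<bar>
          \<le> C * real n ^ r * \<rho> ^ l)" for r
  proof -
    obtain C \<rho> :: real and \<Lambda> :: nat where C: "C > 0" "0 < \<rho>" "\<rho> < 1"
      and decay: "block_decorrelation \<phi> r C \<rho> \<Lambda>"
      by (rule cov_orbit_decay[where r = r, OF mom K(1) c approx])
    have "\<bar>cov M (\<lambda>x. birkhoff_sum f X n x ^ a) (\<lambda>x. birkhoff_sum f X n ((f ^^ (n + g)) x) ^ b)\<bar>
          \<le> (C * (1 + \<bar>m\<bar>) ^ r) * real n ^ r * \<rho> ^ l"
      if "a + b = r" "1 \<le> l" "\<Lambda> * l \<le> g" for a b l n g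
      using cov_centered_birkhoff_powers[OF mom decay _ that(2,3), where m = m and n = n and a = a and b = b]
        C that unfolding X_def[abs_def] by (simp add: power_mult_distrib mult_ac)
    then show ?thesis using C by (intro exI[of _ "C * (1 + \<bar>m\<bar>) ^ r"] exI[of _ \<rho>] exI[of _ \<Lambda>]) auto
  qed
  interpret decorrelated_process M f X \<sigma>
    using momX EX \<sigma>(2) dec by unfold_locales
  have "weak_conv_m (\<lambda>n. distr M borel (\<lambda>x. birkhoff_sum f X n x / sqrt (real n))) (centered_gaussian \<sigma>)"
    by (rule central_limit[OF \<sigma>(1)])
  then show "satisfies_CLT M f \<phi>"
    using \<sigma> unfolding satisfies_CLT_def S_eq m_def by blast
qed

end
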